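(* Let $M$ be a special Lagrangian submanifold of $\mathbb{C}^4$ with $SO(2)\rtimes S_3$-symmetry, with adapted local orthonormal frame $\{X_1,X_2,X_3,X_4\}$. Suppose that $\mathcal{N}_1=\mathrm{span}\{X_1,X_2\}$ is not an integrable distribution, but that $\mathcal{N}_+=\mathrm{span}\{X_1,X_2,[X_1,X_2]\}$ is integrable. Then, up to isometry, $M$ is given locally by either $$F(t,s,u,v)=(t,\phi(s,u,v))\in\mathbb{C}\times\mathbb{C}^3,$$ where $\phi$ is a special Lagrangian submanifold with $S_3$-symmetry in $\mathbb{C}^3$, or $$F(t,s,u,v)=t\,\phi(s,u,v),$$ where $\phi$ is the horizontal lift of a special Lagrangian submanifold with local $S_3$-symmetry in $\mathbb{C}P^3$ to the unit sphere $S^7\subset\mathbb{C}^4$.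
   Context: Let $(N,J,g)$ be a Kähler manifold with Levi-Civita connection $D$ and $\omega(X,Y)=g(X,JY)$. A submanifold $M$ is Lagrangian if $\omega$ vanishes on $M$ and $\dim_{\mathbb{R}}M=\dim_{\mathbb{C}}N$. Its Levi-Civita connection $\nabla$ and its symmetric $(1,2)$-tensor $A$ are given by $D_XY=\nabla_XY+JA(X,Y)$. "Special Lagrangian" means Lagrangian and minimal, i.e. $\mathrm{Tr}(A(X,\cdot))=0$ for all $X$. A special Lagrangian 4-fold has $SO(2)\rtimes S_3$-symmetry if locally there is an orthonormal frame $\{X_1,X_2,X_3,X_4\}$ (the adapted frame) and a strictly positive function $r$ with $A(X_1,X_1)=rX_1$, $A(X_1,X_2)=A(X_2,X_1)=-rX_2$, $A(X_2,X_2)=-rX_1$, and $A(X_i,X_j)=0$ whenever $i\in\{3,4\}$ or $j\in\{3,4\}$. A special Lagrangian 3-fold has (local) $S_3$-symmetry if locally there is an orthonormal frame $\{X_1,X_2,X_3\}$ in which $A$ has the same form: $A(X_1,X_1)=rX_1$, $A(X_1,X_2)=-rX_2$, $A(X_2,X_2)=-rX_1$, $A(X_3,\cdot)=0$, $r>0$. $\mathbb{C}^n$ carries its standard flat Kähler structure. $\mathbb{C}P^n$ is the quotient $S^{2n+1}/S^1$ of the unit sphere in $\mathbb{C}^{n+1}$, with the metric of constant holomorphic sectional curvature $4$ that makes the Hopf fibration $\pi$ a Riemannian submersion. A horizontal lift of a special Lagrangian submanifold of $\mathbb{C}P^n$ is an immersion $\phi$ into $S^{2n+1}$ with $i\phi$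 orthogonal to the image of $d\phi$, which projects isometrically under $\pi$ onto that submanifold; such lifts are minimal C-totally real submanifolds of $S^{2n+1}$. Standing convention: conditions defining a case (here: $[X_1,X_2]\notin\mathcal{N}_1$, and which of the alternatives one is in) are assumed to hold at every point of an open neighbourhood of the point considered. *)

theory Defs
  imports "HOL-Analysis.Analysis" "HOL-Combinatorics.Transposition"
begin

section \<open>Smooth maps, immersions, distributions\<close>

text \<open>All of the following notions are meant for open domains \<open>U\<close>.\<close>

primrec Ck_on :: "nat \<Rightarrow> 'a::real_normed_vector set \<Rightarrow> ('a \<Rightarrow> 'b::real_normed_vector) \<Rightarrow> bool" where
  "Ck_on 0 U f \<longleftrightarrow> continuous_on U f"
| "Ck_on (Suc k) U f \<longleftrightarrow>
     (\<forall>x\<in>U. f differentiable (at x)) \<and> (\<forall>v. Ck_on k U (\<lambda>x. frechet_derivative f (at x) v))"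

definition smooth_on :: "'a::real_normed_vector set \<Rightarrow> ('a \<Rightarrow> 'b::real_normed_vector) \<Rightarrow> bool" where
  "smooth_on U f \<longleftrightarrow> (\<forall>k. Ck_on k U f)"

definition smooth_immersion_on ::
  "'a::real_normed_vector set \<Rightarrow> ('a \<Rightarrow> 'b::real_normed_vector) \<Rightarrow> bool" where
  "smooth_immersion_on U f \<longleftrightarrow>
     open U \<and> smooth_on U f \<and> (\<forall>x\<in>U. inj (frechet_derivative f (at x)))"

definition diffeomorphism_on ::
  "'a::real_normed_vector set \<Rightarrow> 'b::real_normed_vector set \<Rightarrow> ('a \<Rightarrow> 'b) \<Rightarrow> bool" where
  "diffeomorphism_on S T h \<longleftrightarrow>
     open S \<and> open T \<and> (\<exists>k. homeomorphism S T h k \<and> smooth_on S h \<and> smooth_on T k)"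

definition lie_bracket ::
  "('a::real_normed_vector \<Rightarrow> 'a) \<Rightarrow> ('a \<Rightarrow> 'a) \<Rightarrow> 'a \<Rightarrow> 'a" where
  "lie_bracket X Y x = frechet_derivative Y (at x) (X x) - frechet_derivative X (at x) (Y x)"

text \<open>A distribution of rank \<open>DIM('k)\<close> is integrable if there is an integral manifold through
  every point; the first argument only serves to fix the rank.\<close>

definition integrable_distribution_on ::
  "'k::euclidean_space itself \<Rightarrow> 'a::euclidean_space set \<Rightarrow> ('a \<Rightarrow> 'a set) \<Rightarrow> bool" where
  "integrable_distribution_on _ U \<D> \<longleftrightarrow>
     (\<forall>p\<in>U. \<exists>(S :: 'k set) i. smooth_immersion_on S i \<and> p \<in> i ` S \<and> i ` S \<subseteq> U \<and>
        (\<forall>s\<in>S. range (frechet_derivative i (at s)) = \<D> (i s)))"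


section \<open>Lagrangian immersions into a Kaehler coordinate chart\<close>

text \<open>The ambient Kaehler manifold is described in holomorphic coordinates: points and tangent
  vectors are elements of \<open>complex^'n\<close>, the complex structure is multiplication by \<open>\<i>\<close>,
  and \<open>g z v w\<close> is the Riemannian metric at \<open>z\<close>.  A submanifold is given by a
  local parametrization \<open>f\<close> on an open set \<open>U\<close> of \<open>real^'n\<close>; tangent vectors and
  vector fields of the submanifold are expressed in the parameter domain.  As both index types
  agree, the real dimension of the submanifold is the complex dimension of the ambient space.\<close>

type_synonym 'n metric = "complex^'n \<Rightarrow> complex^'n \<Rightarrow> complex^'n \<Rightarrow> real"

text \<open>The Levi-Civita connection is \<open>D\<^sub>u V = dV(u) + \<Gamma>(u, V)\<close>; \<open>\<Gamma>\<close> symmetric means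
  torsion-free, the last conjunct says that \<open>g\<close> is parallel.\<close>

definition is_levi_civita_at ::
  "'n::finite metric \<Rightarrow> complex^'n \<Rightarrow> (complex^'n \<Rightarrow> complex^'n \<Rightarrow> complex^'n) \<Rightarrow> bool" where
  "is_levi_civita_at g z \<Gamma> \<longleftrightarrow>
     bilinear \<Gamma> \<and> (\<forall>u v. \<Gamma> u v = \<Gamma> v u) \<and>
     (\<forall>u v w. frechet_derivative (\<lambda>y. g y v w) (at z) u = g z (\<Gamma> u v) w + g z v (\<Gamma> u w))"

definition christoffel ::
  "'n::finite metric \<Rightarrow> complex^'n \<Rightarrow> complex^'n \<Rightarrow> complex^'n \<Rightarrow> complex^'n" where
  "christoffel g z = (THE \<Gamma>. is_levi_civita_at g z \<Gamma>)"

text \<open>\<open>D\<^sub>X Y\<close> for vector fields \<open>X\<close>, \<open>Y\<close> tangent to the submanifold.\<close>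

definition cov_deriv ::
  "'n::finite metric \<Rightarrow> (real^'n \<Rightarrow> complex^'n) \<Rightarrow>
     (real^'n \<Rightarrow> real^'n) \<Rightarrow> (real^'n \<Rightarrow> real^'n) \<Rightarrow> real^'n \<Rightarrow> complex^'n" where
  "cov_deriv g f X Y x =
     frechet_derivative (\<lambda>y. frechet_derivative f (at y) (Y y)) (at x) (X x)
     + christoffel g (f x) (frechet_derivative f (at x) (X x)) (frechet_derivative f (at x) (Y x))"

text \<open>The tensor \<open>A\<close> in \<open>D\<^sub>X Y = \<nabla>\<^sub>X Y + J A(X,Y)\<close>.  For a Lagrangian immersion \<open>J\<close> maps the
  tangent space onto the normal space, so that both terms are uniquely determined, and
  \<open>\<nabla>\<close> is the Levi-Civita connection of the induced metric.\<close>

definition sff_tensor ::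
  "'n::finite metric \<Rightarrow> (real^'n \<Rightarrow> complex^'n) \<Rightarrow>
     (real^'n \<Rightarrow> real^'n) \<Rightarrow> (real^'n \<Rightarrow> real^'n) \<Rightarrow> real^'n \<Rightarrow> real^'n" where
  "sff_tensor g f X Y x =
     (THE a. \<exists>b. cov_deriv g f X Y x =
        frechet_derivative f (at x) b + \<i> *s frechet_derivative f (at x) a)"

definition lagrangian_immersion ::
  "'n::finite metric \<Rightarrow> (real^'n) set \<Rightarrow> (real^'n \<Rightarrow> complex^'n) \<Rightarrow> bool" where
  "lagrangian_immersion g U f \<longleftrightarrow>
     smooth_immersion_on U f \<and>
     (\<forall>x\<in>U. \<forall>u v. g (f x) (frechet_derivative f (at x) u) (\<i> *s frechet_derivative f (at x) v) = 0)"

text \<open>Minimality: the endomorphism \<open>A(u,\<cdot>)\<close> is trace-free for every tangent vector \<open>u\<close>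
  (extended to a constant field; \<open>A\<close> is tensorial).\<close>

definition special_lagrangian ::
  "'n::finite metric \<Rightarrow> (real^'n) set \<Rightarrow> (real^'n \<Rightarrow> complex^'n) \<Rightarrow> bool" where
  "special_lagrangian g U f \<longleftrightarrow>
     lagrangian_immersion g U f \<and>
     (\<forall>x\<in>U. \<forall>u. trace (matrix (\<lambda>v. sff_tensor g f (\<lambda>_. u) (\<lambda>_. v) x)) = 0)"

text \<open>For \<open>'n = 4\<close> an adapted frame expresses \<open>SO(2) \<rtimes> S\<^sub>3\<close>-symmetry, for \<open>'n = 3\<close> it expresses
  \<open>S\<^sub>3\<close>-symmetry.  The indices other than \<open>1\<close>, \<open>2\<close> are \<open>3\<close>, \<open>4\<close> and \<open>3\<close>, respectively.\<close>

definition adapted_frame ::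
  "'n::{finite,numeral} metric \<Rightarrow> (real^('n::{finite,numeral})) set \<Rightarrow> (real^('n::{finite,numeral}) \<Rightarrow> complex^('n::{finite,numeral})) \<Rightarrow>
     ('n::{finite,numeral} \<Rightarrow> real^('n::{finite,numeral}) \<Rightarrow> real^('n::{finite,numeral})) \<Rightarrow> (real^('n::{finite,numeral}) \<Rightarrow> real) \<Rightarrow> bool" where
  "adapted_frame g U f X r \<longleftrightarrow>
     (\<forall>i. smooth_on U (X i)) \<and>
     (\<forall>x\<in>U.
        (\<forall>i j. g (f x) (frechet_derivative f (at x) (X i x)) (frechet_derivative f (at x) (X j x))
               = (if i = j then 1 else 0)) \<and>
        r x > 0 \<and>
        sff_tensor g f (X 1) (X 1) x = r x *\<^sub>R X 1 x \<and>
        sff_tensor g f (X 1) (X 2) x = - r x *\<^sub>R X 2 x \<and>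
        sff_tensor g f (X 2) (X 1) x = - r x *\<^sub>R X 2 x \<and>
        sff_tensor g f (X 2) (X 2) x = - r x *\<^sub>R X 1 x \<and>
        (\<forall>i j. i \<notin> {1, 2} \<or> j \<notin> {1, 2} \<longrightarrow> sff_tensor g f (X i) (X j) x = 0))"

definition S3_symmetric ::
  "3 metric \<Rightarrow> (real^3) set \<Rightarrow> (real^3 \<Rightarrow> complex^3) \<Rightarrow> bool" where
  "S3_symmetric g U f \<longleftrightarrow>
     (\<forall>p\<in>U. \<exists>V X r. open V \<and> p \<in> V \<and> V \<subseteq> U \<and> adapted_frame g V f X r)"


section \<open>Complex Euclidean space\<close>

text \<open>The inner product of \<open>complex^'n\<close> is the real part of the Hermitian product.\<close>

definition flat_metric :: "'n::finite metric" where
  "flat_metric z v w = v \<bullet> w"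

definition holomorphic_isometry :: "(complex^'n \<Rightarrow> complex^'n) \<Rightarrow> bool" where
  "holomorphic_isometry \<Psi> \<longleftrightarrow>
     (\<exists>L b. orthogonal_transformation L \<and> (\<forall>z. L (\<i> *s z) = \<i> *s L z) \<and> (\<forall>z. \<Psi> z = L z + b))"

text \<open>The identification of \<open>\<complex> \<times> \<complex>\<^sup>3\<close> with \<open>\<complex>\<^sup>4\<close>.\<close>

definition cons_C4 :: "complex \<Rightarrow> complex^3 \<Rightarrow> complex^4" where
  "cons_C4 c w = (\<chi> i. if i = 1 then c else if i = 2 then w $ 1 else if i = 3 then w $ 2 else w $ 3)"


section \<open>Complex projective space of dimension three\<close>

text \<open>Points of the projective space are the \<open>S\<^sup>1\<close>-orbits in the unit sphere of \<open>\<complex>\<^sup>4\<close>.\<close>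

definition hopf :: "complex^4 \<Rightarrow> (complex^4) set" where
  "hopf x = {c *s x | c. cmod c = 1}"

text \<open>The four standard affine charts \<open>z \<mapsto> [1 : z]\<close>, with the entry \<open>1\<close> moved to position \<open>k\<close>,
  together with a section of the Hopf fibration over each of them.\<close>

definition cp_section :: "4 \<Rightarrow> complex^3 \<Rightarrow> complex^4" where
  "cp_section k z =
     (1 / sqrt (1 + (norm z)\<^sup>2)) *\<^sub>R (\<chi> i. cons_C4 1 z $ Transposition.transpose 1 k i)"

definition cp_chart :: "4 \<Rightarrow> complex^3 \<Rightarrow> (complex^4) set" where
  "cp_chart k z = hopf (cp_section k z)"

text \<open>Orthogonal projection of the tangent space of the sphere at \<open>x\<close> onto the horizontal space.\<close>

definition horizontal_part :: "complex^4 \<Rightarrow> complex^4 \<Rightarrow> complex^4" where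
  "horizontal_part x u = u - (u \<bullet> (\<i> *s x)) *\<^sub>R (\<i> *s x)"

text \<open>The Fubini-Study metric in the chart \<open>k\<close>: the metric that makes the Hopf fibration a
  Riemannian submersion.\<close>

definition fubini_study :: "4 \<Rightarrow> 3 metric" where
  "fubini_study k z v w =
     horizontal_part (cp_section k z) (frechet_derivative (cp_section k) (at z) v) \<bullet>
     horizontal_part (cp_section k z) (frechet_derivative (cp_section k) (at z) w)"

text \<open>Properties of a map \<open>\<psi>\<close> into projective space that are local and invariant under a
  change of the affine chart (the transition maps are holomorphic isometries).\<close>

definition cp_locally ::
  "(real^3) set \<Rightarrow> (real^3 \<Rightarrow> (complex^4) set) \<Rightarrow>
     (4 \<Rightarrow> (real^3) set \<Rightarrow> (real^3 \<Rightarrow> complex^3) \<Rightarrow> bool) \<Rightarrow> bool" where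
  "cp_locally W \<psi> P \<longleftrightarrow>
     (\<forall>p\<in>W. \<exists>k V \<psi>'. open V \<and> p \<in> V \<and> V \<subseteq> W \<and> (\<forall>x\<in>V. \<psi> x = cp_chart k (\<psi>' x)) \<and> P k V \<psi>')"

definition cp_special_lagrangian :: "(real^3) set \<Rightarrow> (real^3 \<Rightarrow> (complex^4) set) \<Rightarrow> bool" where
  "cp_special_lagrangian W \<psi> \<longleftrightarrow>
     open W \<and> cp_locally W \<psi> (\<lambda>k. special_lagrangian (fubini_study k))"

definition cp_S3_symmetric :: "(real^3) set \<Rightarrow> (real^3 \<Rightarrow> (complex^4) set) \<Rightarrow> bool" where
  "cp_S3_symmetric W \<psi> \<longleftrightarrow> cp_locally W \<psi> (\<lambda>k. S3_symmetric (fubini_study k))"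

definition horizontal_lift ::
  "(real^3) set \<Rightarrow> (real^3 \<Rightarrow> complex^4) \<Rightarrow> (real^3 \<Rightarrow> (complex^4) set) \<Rightarrow> bool" where
  "horizontal_lift W \<phi> \<psi> \<longleftrightarrow>
     smooth_immersion_on W \<phi> \<and> \<phi> ` W \<subseteq> sphere 0 1 \<and>
     (\<forall>x\<in>W. \<forall>v. (\<i> *s \<phi> x) \<bullet> frechet_derivative \<phi> (at x) v = 0) \<and>
     (\<forall>x\<in>W. hopf (\<phi> x) = \<psi> x) \<and>
     cp_locally W \<psi> (\<lambda>k V \<psi>'. \<forall>x\<in>V. \<forall>u v.
        fubini_study k (\<psi>' x) (frechet_derivative \<psi>' (at x) u) (frechet_derivative \<psi>' (at x) v)
        = frechet_derivative \<phi> (at x) u \<bullet> frechet_derivative \<phi> (at x) v)"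

end

theory Submission
  imports Defs
begin

text \<open>
  Put \<open>F i = df (X i)\<close>.  For a Lagrangian immersion and an orthonormal frame these are unitary
  frames of \<open>\<complex>\<^sup>4\<close>, so that everything can be read off from their derivatives in the fixed
  vector space \<open>\<complex>\<^sup>4\<close>; \<open>\<theta> i\<close> is the coframe and \<open>\<omega> i j\<close> are the connection forms.

  For \<open>a = 3, 4\<close> the form of \<open>A\<close> says that \<open>D (F a)\<close> has no normal part.
  Differentiating this once more and using the symmetry of second derivatives gives the part of the Codazzi
  equation that is needed: \<open>\<omega> a 1\<close> and \<open>\<omega> a 2\<close> satisfy the Cauchy-Riemann type equations
  \<open>\<omega> a 1 + \<i> \<omega> a 2 = (\<beta> a + \<i> \<gamma> a) (\<theta> 1 + \<i> \<theta> 2)\<close> (lemma \<open>cauchy_riemann\<close>).  Consequently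
  \<open>[X 1, X 2]\<close> has the component \<open>- 2 \<gamma> a\<close> along \<open>X a\<close>.  As \<open>X 1, X 2\<close> do not span an
  integrable distribution, \<open>(\<gamma> 3, \<gamma> 4) \<noteq> 0\<close>, and a rotation in the plane of \<open>X 3, X 4\<close>
  achieves \<open>\<gamma> 4 = 0 \<noteq> \<gamma> 3\<close>.  Then the fourth vector of the frame is the unit normal of the
  rank three distribution, whose integrability makes the shape operator in this normal direction
  symmetric and hence kills the remaining mixed component of \<open>D (F 4)\<close>.

  Now the symmetry of second derivatives of \<open>F 4\<close> (flatness of \<open>\<complex>\<^sup>4\<close>) together with
  \<open>\<gamma> 3 \<noteq> 0\<close> forces, with \<open>\<lambda> = \<beta> 4\<close>,
  \<open>D (F 4) v = \<lambda> (df v - \<theta> 4 v F 4)\<close> and \<open>d\<lambda> = - \<lambda>\<^sup>2 \<theta> 4\<close>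
  (lemmas \<open>D_F4\<close> and \<open>D_\<beta>4\<close>).  By uniqueness for linear differential equations \<open>\<lambda>\<close> either vanishes near
  the given point or has no zero there.  If it vanishes, \<open>F 4\<close> is constant, and \<open>f\<close> is the product of a
  line with a map into its unitary complement.  Otherwise \<open>f - F 4 / \<lambda>\<close> is constant, and
  \<open>f\<close> is a cone over \<open>\<plusminus>F 4\<close>, at distance \<open>1 / \<bar>\<lambda>\<bar>\<close> from the vertex.

  In both cases the three-dimensional factor is a slice of \<open>M\<close>, and the frame \<open>F 1, F 2, F 3\<close>
  restricts to it; the derivatives of this frame along the slice are constant multiples of those on \<open>M\<close>,
  so that \<open>A\<close> keeps its form.  For the cone this has to be translated to projective
  space: in an affine chart the Levi-Civita connection of the Fubini-Study metric is the second derivative of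
  a horizontal lift, taken modulo the complex line spanned by the lift (lemma \<open>cov_deriv_lift\<close>).
\<close>

section \<open>Smooth maps\<close>
abbreviation "D f x \<equiv> frechet_derivative f (at x)"

lemma D_eqI: "(f has_derivative f') (at x) \<Longrightarrow> D f x = f'"
  by (metis frechet_derivative_at)

lemma D_works: "f differentiable (at x) \<Longrightarrow> (f has_derivative D f x) (at x)"
  by (simp add: frechet_derivative_works)

lemma D_cong_open:
  assumes "open U" "x \<in> U" "\<And>y. y \<in> U \<Longrightarrow> f y = g y"
  shows "D f x = D g x" "f differentiable (at x) \<longleftrightarrow> g differentiable (at x)"
proof -
  have *: "(f has_derivative f') (at x) \<longleftrightarrow> (g has_derivative f') (at x)" for f'
    using has_derivative_transform_within_open[OF _ assms(1,2), of f f' UNIV g]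
      has_derivative_transform_within_open[OF _ assms(1,2), of g f' UNIV f] assms(3) by auto
  show "D f x = D g x" unfolding frechet_derivative_def * ..
  show "f differentiable (at x) \<longleftrightarrow> g differentiable (at x)" unfolding differentiable_def * ..
qed

lemma Ck_on_Suc_imp: "Ck_on (Suc k) U f \<Longrightarrow> Ck_on k U f"
proof (induction k arbitrary: f)
  case 0
  then show ?case
    by (auto intro!: continuous_at_imp_continuous_on dest: differentiable_imp_continuous_within)
next
  case (Suc k)
  then show ?case by (metis Ck_on.simps(2))
qed

lemma Ck_on_cong:
  assumes "open U" "\<And>y. y \<in> U \<Longrightarrow> f y = g y"
  shows "Ck_on k U f \<longleftrightarrow> Ck_on k U g"
  using assms(2)
proof (induction k arbitrary: f g)
  case 0
  then show ?case by (simp cong: continuous_on_cong)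
next
  case (Suc k)
  have "\<And>x. x \<in> U \<Longrightarrow> D f x = D g x" "\<And>x. x \<in> U \<Longrightarrow> f differentiable (at x) \<longleftrightarrow> g differentiable (at x)"
    using D_cong_open[OF assms(1)] Suc.prems by metis+
  moreover from this have "Ck_on k U (\<lambda>x. D f x v) \<longleftrightarrow> Ck_on k U (\<lambda>x. D g x v)" for v
    by (intro Suc.IH) auto
  ultimately show ?case by simp
qed

text \<open>An explicit derivative may replace \<open>frechet_derivative\<close>; this drives all inductions on the
  order of differentiability below.\<close>
lemma Ck_on_SucI:
  assumes "open U" "\<And>x. x \<in> U \<Longrightarrow> (f has_derivative f' x) (at x)"
    and "\<And>v. Ck_on k U (\<lambda>x. f' x v)"
  shows "Ck_on (Suc k) U f"
proof -
  have "Ck_on k U (\<lambda>x. D f x v) \<longleftrightarrow> Ck_on k U (\<lambda>x. f' x v)" for v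
    by (intro Ck_on_cong assms(1)) (simp add: D_eqI[OF assms(2)])
  with assms show ?thesis by (auto simp: differentiable_def)
qed

lemma Ck_on_const: "Ck_on k U (\<lambda>x. c)"
  by (induction k arbitrary: c) auto

lemma Ck_on_subset: "Ck_on k U f \<Longrightarrow> V \<subseteq> U \<Longrightarrow> Ck_on k V f"
  by (induction k arbitrary: f) (auto intro: continuous_on_subset)

lemma Ck_on_linear:
  assumes "bounded_linear T" "open U" "Ck_on k U f"
  shows "Ck_on k U (\<lambda>x. T (f x))"
  using assms(3)
proof (induction k arbitrary: f)
  case 0
  then show ?case using assms(1) by (auto intro: bounded_linear.continuous_on)
next
  case (Suc k)
  show ?case
    by (rule Ck_on_SucI[OF assms(2), of _ "\<lambda>x v. T (D f x v)"])
      (use Suc assms(1) in \<open>auto intro!: bounded_linear.has_derivative[OF assms(1)] D_works\<close>)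
qed

lemma Ck_on_add:
  assumes "open U" "Ck_on k U f" "Ck_on k U g"
  shows "Ck_on k U (\<lambda>x. f x + g x)"
  using assms(2,3)
proof (induction k arbitrary: f g)
  case 0
  then show ?case by (auto intro: continuous_on_add)
next
  case (Suc k)
  show ?case
    by (rule Ck_on_SucI[OF assms(1), of _ "\<lambda>x v. D f x v + D g x v"])
      (use Suc in \<open>auto intro!: has_derivative_add D_works\<close>)
qed

lemma Ck_on_bilinear:
  assumes "bounded_bilinear B" "open U" "Ck_on k U f" "Ck_on k U g"
  shows "Ck_on k U (\<lambda>x. B (f x) (g x))"
  using assms(3,4)
proof (induction k arbitrary: f g)
  case 0
  then show ?case using assms(1) by (auto intro: bounded_bilinear.continuous_on)
next
  case (Suc k)
  show ?case
  proof (rule Ck_on_SucI[OF assms(2), of _ "\<lambda>x v. B (f x) (D g x v) + B (D f x v) (g x)"])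
    show "((\<lambda>x. B (f x) (g x)) has_derivative (\<lambda>v. B (f x) (D g x v) + B (D f x v) (g x))) (at x)"
      if "x \<in> U" for x
      using Suc.prems that by (auto intro!: bounded_bilinear.FDERIV[OF assms(1)] D_works)
    show "Ck_on k U (\<lambda>x. B (f x) (D g x v) + B (D f x v) (g x))" for v
      using Suc.prems Ck_on_Suc_imp[OF Suc.prems(1)] Ck_on_Suc_imp[OF Suc.prems(2)]
      by (intro Ck_on_add assms(2) Suc.IH) auto
  qed
qed

lemma Ck_on_sum:
  assumes "open U" "\<And>i. i \<in> I \<Longrightarrow> Ck_on k U (f i)"
  shows "Ck_on k U (\<lambda>x. \<Sum>i\<in>I. f i x)"
  using assms(2)
  by (induction I rule: infinite_finite_induct) (auto intro: Ck_on_const Ck_on_add assms(1))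

text \<open>\<open>Ck_on\<close> only speaks about derivatives in constant directions, whereas the chain rule evaluates the
  derivative of the outer map in the variable direction \<open>D f x v\<close>.  Expanding that vector in a basis
  reduces the derivative to products of functions covered by the induction hypothesis.\<close>
lemma Ck_on_compose:
  fixes f :: "'a::real_normed_vector \<Rightarrow> 'b::euclidean_space"
  assumes "open U" "open V" "f ` U \<subseteq> V" "Ck_on k U f" "Ck_on k V g"
  shows "Ck_on k U (\<lambda>x. g (f x))"
  using assms(4,5)
proof (induction k arbitrary: g)
  case 0
  then show ?case using assms(3) continuous_on_compose2[of V g U f] by simp
next
  case (Suc k)
  show ?case
  proof (rule Ck_on_SucI[OF assms(1), of _ "\<lambda>x v. \<Sum>b\<in>Basis. (D f x v \<bullet> b) *\<^sub>R D g (f x) b"])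
    fix x assume x: "x \<in> U"
    then have f: "(f has_derivative D f x) (at x)" and g: "(g has_derivative D g (f x)) (at (f x))"
      using Suc.prems assms(3) x D_works[of f x] D_works[of g "f x"] by (simp_all add: image_subset_iff)
    have lin: "linear (D g (f x))"
      using g has_derivative_linear by blast
    have "D g (f x) v = (\<Sum>b\<in>Basis. (v \<bullet> b) *\<^sub>R D g (f x) b)" for v
    proof -
      have "D g (f x) v = D g (f x) (\<Sum>b\<in>Basis. (v \<bullet> b) *\<^sub>R b)"
        by (simp add: euclidean_representation)
      also have "\<dots> = (\<Sum>b\<in>Basis. (v \<bullet> b) *\<^sub>R D g (f x) b)"
        by (simp only: linear_sum[OF lin] linear_cmul[OF lin])
      finally show ?thesis .
    qed
    then have "(\<lambda>v. D g (f x) (D f x v)) = (\<lambda>v. \<Sum>b\<in>Basis. (D f x v \<bullet> b) *\<^sub>R D g (f x) b)"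
      by (rule ext)
    then show "((\<lambda>x. g (f x)) has_derivative (\<lambda>v. \<Sum>b\<in>Basis. (D f x v \<bullet> b) *\<^sub>R D g (f x) b)) (at x)"
      by (rule has_derivative_eq_rhs[OF has_derivative_compose[OF f g]])
  next
    fix v
    have "Ck_on k U f" using Ck_on_Suc_imp Suc.prems(1) .
    then have "Ck_on k U (\<lambda>x. D g (f x) b)" for b
      using Suc.prems(2) Suc.IH[of "\<lambda>y. D g y b"] by simp
    moreover have "Ck_on k U (\<lambda>x. D f x v \<bullet> b)" for b
      using Suc.prems(1) Ck_on_linear[OF bounded_linear_inner_left assms(1), of k "\<lambda>x. D f x v"] by simp
    ultimately show "Ck_on k U (\<lambda>x. \<Sum>b\<in>Basis. (D f x v \<bullet> b) *\<^sub>R D g (f x) b)"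
      by (intro Ck_on_sum[OF assms(1)] Ck_on_bilinear[OF bounded_bilinear_scaleR assms(1)])
  qed
qed

lemma Ck_on_ident: "Ck_on k U (\<lambda>x. x)"
  by (cases k) (simp_all add: Ck_on_const)

lemma Ck_on_inverse: "Ck_on k (- {0}) (inverse :: 'a::real_normed_field \<Rightarrow> 'a)"
proof (induction k)
  case 0
  show ?case
    using continuous_on_inverse[OF continuous_on_id, of "- {0::'a}"] by simp
next
  case (Suc k)
  have opn: "open (- {0::'a})" by (simp add: open_Compl)
  show ?case
  proof (rule Ck_on_SucI[OF opn, of _ "\<lambda>x v. - (inverse x * v * inverse x)"])
    show "(inverse has_derivative (\<lambda>v. - (inverse x * v * inverse x))) (at x)"
      if "x \<in> - {0}" for x :: 'a
      using that by (intro has_derivative_inverse') simp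
    have "Ck_on k (- {0}) (\<lambda>x. inverse x * v * inverse x)" for v :: 'a
      by (rule Ck_on_bilinear[OF bounded_bilinear_mult opn
          Ck_on_bilinear[OF bounded_bilinear_mult opn Suc Ck_on_const] Suc])
    then show "Ck_on k (- {0}) (\<lambda>x. - (inverse x * v * inverse x))" for v :: 'a
      by (rule Ck_on_linear[OF bounded_linear_minus[OF bounded_linear_ident] opn])
  qed
qed

lemma Ck_on_sqrt: "Ck_on k {0<..} sqrt"
proof (induction k)
  case 0
  show ?case
    using continuous_on_real_sqrt[OF continuous_on_id, of "{0<..}"] by simp
next
  case (Suc k)
  have opn: "open (- {0::real})" by (simp add: open_Compl)
  have inv: "Ck_on k {0<..} (\<lambda>x. inverse (sqrt x))"
    by (rule Ck_on_compose[OF open_greaterThan opn _ Suc Ck_on_inverse]) auto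
  show ?case
  proof (rule Ck_on_SucI[OF open_greaterThan, of _ _ "\<lambda>x v. v / 2 * inverse (sqrt x)"])
    show "(sqrt has_derivative (\<lambda>v. v / 2 * inverse (sqrt x))) (at x)" if "x \<in> {0<..}" for x
    proof -
      have "(*) (inverse (sqrt x) / 2) = (\<lambda>v. v / 2 * inverse (sqrt x))"
        by (simp add: fun_eq_iff)
      then show ?thesis
        using DERIV_real_sqrt[of x] that unfolding has_field_derivative_def by simp
    qed
    show "Ck_on k {0<..} (\<lambda>x. v / 2 * inverse (sqrt x))" for v
      by (rule Ck_on_bilinear[OF bounded_bilinear_mult open_greaterThan Ck_on_const inv])
  qed
qed

lemma smooth_differentiable: "smooth_on U f \<Longrightarrow> x \<in> U \<Longrightarrow> f differentiable (at x)"
  unfolding smooth_on_def by (metis Ck_on.simps(2))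

lemma smooth_has_derivative: "smooth_on U f \<Longrightarrow> x \<in> U \<Longrightarrow> (f has_derivative D f x) (at x)"
  by (simp add: smooth_differentiable D_works)

lemma linear_D_smooth: "smooth_on U f \<Longrightarrow> x \<in> U \<Longrightarrow> linear (D f x)"
  using has_derivative_linear smooth_has_derivative by blast

lemma smooth_continuous: "smooth_on U f \<Longrightarrow> continuous_on U f"
  unfolding smooth_on_def by (metis Ck_on.simps(1))

lemma smooth_D: "smooth_on U f \<Longrightarrow> smooth_on U (\<lambda>x. D f x v)"
  unfolding smooth_on_def by (metis Ck_on.simps(2))

lemma smooth_cong: "open U \<Longrightarrow> (\<And>y. y \<in> U \<Longrightarrow> f y = g y) \<Longrightarrow> smooth_on U f \<longleftrightarrow> smooth_on U g"
  unfolding smooth_on_def using Ck_on_cong by metis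

lemma smooth_congD:
  assumes "open U" "smooth_on U f" "\<And>y. y \<in> U \<Longrightarrow> f y = g y"
  shows "smooth_on U g"
  using smooth_cong[of U f g] assms by blast

lemma smooth_subset: "smooth_on U f \<Longrightarrow> V \<subseteq> U \<Longrightarrow> smooth_on V f"
  unfolding smooth_on_def using Ck_on_subset by blast

lemma smooth_const: "smooth_on U (\<lambda>x. c)"
  unfolding smooth_on_def by (simp add: Ck_on_const)

lemma smooth_ident: "smooth_on U (\<lambda>x. x)"
  unfolding smooth_on_def by (simp add: Ck_on_ident)

lemma smooth_bounded_linear: "bounded_linear T \<Longrightarrow> open U \<Longrightarrow> smooth_on U f \<Longrightarrow> smooth_on U (\<lambda>x. T (f x))"
  unfolding smooth_on_def by (simp add: Ck_on_linear)

lemma smooth_add: "open U \<Longrightarrow> smooth_on U f \<Longrightarrow> smooth_on U g \<Longrightarrow> smooth_on U (\<lambda>x. f x + g x)"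
  unfolding smooth_on_def by (simp add: Ck_on_add)

lemma smooth_bilinear: "bounded_bilinear B \<Longrightarrow> open U \<Longrightarrow> smooth_on U f \<Longrightarrow> smooth_on U g
    \<Longrightarrow> smooth_on U (\<lambda>x. B (f x) (g x))"
  unfolding smooth_on_def by (simp add: Ck_on_bilinear)

lemma smooth_sum: "open U \<Longrightarrow> (\<And>i. i \<in> I \<Longrightarrow> smooth_on U (f i)) \<Longrightarrow> smooth_on U (\<lambda>x. \<Sum>i\<in>I. f i x)"
  unfolding smooth_on_def by (simp add: Ck_on_sum)

lemma smooth_compose:
  fixes f :: "'a::real_normed_vector \<Rightarrow> 'b::euclidean_space"
  shows "open U \<Longrightarrow> open V \<Longrightarrow> f ` U \<subseteq> V \<Longrightarrow> smooth_on U f \<Longrightarrow> smooth_on V g \<Longrightarrow> smooth_on U (\<lambda>x. g (f x))"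
  unfolding smooth_on_def using Ck_on_compose[of U V f _ g] by blast

lemma smooth_minus: "open U \<Longrightarrow> smooth_on U f \<Longrightarrow> smooth_on U (\<lambda>x. - f x)"
  using smooth_bounded_linear[OF bounded_linear_minus[OF bounded_linear_ident]] .

lemma smooth_diff: "open U \<Longrightarrow> smooth_on U f \<Longrightarrow> smooth_on U g \<Longrightarrow> smooth_on U (\<lambda>x. f x - g x)"
  using smooth_add[of U f "\<lambda>x. - g x"] smooth_minus[of U g] by simp

lemmas smooth_scaleR = smooth_bilinear[OF bounded_bilinear_scaleR]
lemmas smooth_mult = smooth_bilinear[OF bounded_bilinear_mult]
lemmas smooth_inner = smooth_bilinear[OF bounded_bilinear_inner]

lemma smooth_inverse:
  fixes f :: "'a::real_normed_vector \<Rightarrow> 'b::{euclidean_space,real_normed_field}"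
  assumes "open U" "smooth_on U f" "\<And>x. x \<in> U \<Longrightarrow> f x \<noteq> 0"
  shows "smooth_on U (\<lambda>x. inverse (f x))"
proof (rule smooth_compose[OF assms(1) _ _ assms(2)])
  show "open (- {0::'b})" by (simp add: open_Compl)
  show "smooth_on (- {0::'b}) inverse" unfolding smooth_on_def by (intro allI Ck_on_inverse)
  show "f ` U \<subseteq> - {0}" by (rule image_subsetI) (simp add: assms(3))
qed

lemma smooth_divide:
  fixes f :: "'a::real_normed_vector \<Rightarrow> 'b::{euclidean_space,real_normed_field}"
  assumes "open U" "smooth_on U g" "smooth_on U f" "\<And>x. x \<in> U \<Longrightarrow> f x \<noteq> 0"
  shows "smooth_on U (\<lambda>x. g x / f x)"
  unfolding divide_inverse by (intro smooth_mult smooth_inverse assms)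

lemma smooth_sqrt:
  assumes "open U" "smooth_on U f" "\<And>x. x \<in> U \<Longrightarrow> f x > 0"
  shows "smooth_on U (\<lambda>x. sqrt (f x))"
proof (rule smooth_compose[OF assms(1) open_greaterThan _ assms(2)])
  show "smooth_on {0::real<..} sqrt" unfolding smooth_on_def by (intro allI Ck_on_sqrt)
  show "f ` U \<subseteq> {0<..}" by (rule image_subsetI) (simp add: assms(3))
qed

lemma smooth_prod:
  fixes f :: "'c \<Rightarrow> 'a::real_normed_vector \<Rightarrow> 'b::real_normed_field"
  assumes "open U" "\<And>i. i \<in> I \<Longrightarrow> smooth_on U (f i)"
  shows "smooth_on U (\<lambda>x. \<Prod>i\<in>I. f i x)"
  using assms(2)
  by (induction I rule: infinite_finite_induct) (simp_all add: smooth_const smooth_mult[OF assms(1)])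

lemma smooth_D_field:
  fixes f :: "'a::euclidean_space \<Rightarrow> 'b::real_normed_vector"
  assumes "open U" "smooth_on U f" "smooth_on U X"
  shows "smooth_on U (\<lambda>x. D f x (X x))"
proof -
  have "smooth_on U (\<lambda>x. \<Sum>b\<in>Basis. (X x \<bullet> b) *\<^sub>R D f x b)"
    by (intro smooth_sum smooth_scaleR assms smooth_D smooth_inner smooth_const)
  moreover have "(\<Sum>b\<in>Basis. (X x \<bullet> b) *\<^sub>R D f x b) = D f x (X x)" if "x \<in> U" for x
  proof -
    note lin = linear_D_smooth[OF assms(2) that]
    have "D f x (X x) = D f x (\<Sum>b\<in>Basis. (X x \<bullet> b) *\<^sub>R b)"
      by (simp add: euclidean_representation)
    also have "\<dots> = (\<Sum>b\<in>Basis. (X x \<bullet> b) *\<^sub>R D f x b)"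
      by (simp only: linear_sum[OF lin] linear_cmul[OF lin])
    finally show ?thesis by simp
  qed
  ultimately show ?thesis
    using smooth_cong[OF assms(1), of "\<lambda>x. \<Sum>b\<in>Basis. (X x \<bullet> b) *\<^sub>R D f x b" "\<lambda>x. D f x (X x)"] by simp
qed

lemma D_compose:
  assumes "f differentiable (at x)" "g differentiable (at (f x))"
  shows "D (\<lambda>x. g (f x)) x v = D g (f x) (D f x v)"
  using D_eqI[OF has_derivative_compose[OF D_works[OF assms(1)] D_works[OF assms(2)]]] by simp

lemma D_linear_compose:
  assumes "bounded_linear T" "f differentiable (at x)"
  shows "D (\<lambda>x. T (f x)) x v = T (D f x v)"
  using D_eqI[OF bounded_linear.has_derivative[OF assms(1) D_works[OF assms(2)]]] by simp

lemma D_bilinear: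
  assumes "bounded_bilinear B" "f differentiable (at x)" "g differentiable (at x)"
  shows "D (\<lambda>x. B (f x) (g x)) x v = B (f x) (D g x v) + B (D f x v) (g x)"
  using D_eqI[OF bounded_bilinear.FDERIV[OF assms(1) D_works[OF assms(2)] D_works[OF assms(3)]]] by simp

lemma D_add:
  assumes "f differentiable (at x)" "g differentiable (at x)"
  shows "D (\<lambda>x. f x + g x) x v = D f x v + D g x v"
  using D_eqI[OF has_derivative_add[OF D_works[OF assms(1)] D_works[OF assms(2)]]] by simp

lemma D_diff:
  assumes "f differentiable (at x)" "g differentiable (at x)"
  shows "D (\<lambda>x. f x - g x) x v = D f x v - D g x v"
  using D_eqI[OF has_derivative_diff[OF D_works[OF assms(1)] D_works[OF assms(2)]]] by simp

lemma D_sum: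
  assumes "\<And>i. i \<in> I \<Longrightarrow> f i differentiable (at x)"
  shows "D (\<lambda>x. \<Sum>i\<in>I. f i x) x v = (\<Sum>i\<in>I. D (f i) x v)"
proof -
  have "((\<lambda>x. \<Sum>i\<in>I. f i x) has_derivative (\<lambda>v. \<Sum>i\<in>I. D (f i) x v)) (at x)"
    by (rule has_derivative_sum) (rule D_works[OF assms])
  then show ?thesis by (simp add: D_eqI)
qed

lemmas D_scaleR = D_bilinear[OF bounded_bilinear_scaleR]
lemmas D_mult = D_bilinear[OF bounded_bilinear_mult]

lemma D_const_on_open:
  assumes "open U" "x \<in> U" "\<And>y. y \<in> U \<Longrightarrow> f y = c"
  shows "D f x v = 0"
  using D_cong_open(1)[OF assms(1,2), of f "\<lambda>_. c"] assms(3) by simp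

section \<open>Symmetry of second derivatives\<close>

lemma DERIV_along_line:
  fixes f :: "'a::real_normed_vector \<Rightarrow> real"
  assumes "smooth_on U f" "x + s *\<^sub>R u + w \<in> U"
  shows "((\<lambda>s. f (x + s *\<^sub>R u + w)) has_real_derivative D f (x + s *\<^sub>R u + w) u) (at s)"
proof -
  have 1: "((\<lambda>s. x + s *\<^sub>R u + w) has_derivative (\<lambda>r. r *\<^sub>R u)) (at s)"
    by (auto intro!: derivative_eq_intros)
  have "((\<lambda>s. f (x + s *\<^sub>R u + w)) has_derivative (\<lambda>r. D f (x + s *\<^sub>R u + w) (r *\<^sub>R u))) (at s)"
    using has_derivative_compose[OF 1 smooth_has_derivative[OF assms]] .
  moreover have "(\<lambda>r. D f (x + s *\<^sub>R u + w) (r *\<^sub>R u)) = (*) (D f (x + s *\<^sub>R u + w) u)"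
    by (simp add: fun_eq_iff linear_cmul[OF linear_D_smooth[OF assms]])
  ultimately show ?thesis unfolding has_field_derivative_def by simp
qed

text \<open>The left hand side does not change when \<open>u\<close> and \<open>v\<close> are exchanged.  Hence this
  form of the mean value theorem, used with shrinking \<open>h\<close>, gives the symmetry of second derivatives.\<close>
lemma second_difference_mean_value:
  fixes f :: "'a::real_normed_vector \<Rightarrow> real"
  assumes f: "smooth_on U f" and h: "h > 0"
    and sub: "\<And>s t. 0 \<le> s \<Longrightarrow> s \<le> h \<Longrightarrow> 0 \<le> t \<Longrightarrow> t \<le> h \<Longrightarrow> x + s *\<^sub>R u + t *\<^sub>R v \<in> U"
  shows "\<exists>s t. 0 \<le> s \<and> s \<le> h \<and> 0 \<le> t \<and> t \<le> h \<and>
    f (x + h *\<^sub>R u + h *\<^sub>R v) - f (x + h *\<^sub>R u) - f (x + h *\<^sub>R v) + f x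
      = h * (h * D (\<lambda>y. D f y u) (x + s *\<^sub>R u + t *\<^sub>R v) v)"
proof -
  define p where "p = (\<lambda>s. f (x + s *\<^sub>R u + h *\<^sub>R v) - f (x + s *\<^sub>R u + 0))"
  have "\<exists>s. 0 < s \<and> s < h \<and> p h - p 0
      = (h - 0) * (D f (x + s *\<^sub>R u + h *\<^sub>R v) u - D f (x + s *\<^sub>R u + 0) u)"
    unfolding p_def
    by (rule MVT2[OF h], intro DERIV_diff DERIV_along_line[OF f])
      (use sub[of _ h] sub[of _ 0] h in auto)
  then obtain s where s: "0 < s" "s < h"
    and ps: "p h - p 0 = h * (D f (x + s *\<^sub>R u + h *\<^sub>R v) u - D f (x + s *\<^sub>R u + 0) u)" by auto
  define q where "q = (\<lambda>t. D f ((x + s *\<^sub>R u) + t *\<^sub>R v + 0) u)"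
  have "\<exists>t. 0 < t \<and> t < h \<and> q h - q 0
      = (h - 0) * D (\<lambda>y. D f y u) ((x + s *\<^sub>R u) + t *\<^sub>R v + 0) v"
    unfolding q_def
    by (rule MVT2[OF h], intro DERIV_along_line[OF smooth_D[OF f]]) (use sub[of s] s in auto)
  then obtain t where t: "0 < t" "t < h"
    and qt: "q h - q 0 = h * D (\<lambda>y. D f y u) (x + s *\<^sub>R u + t *\<^sub>R v) v" by auto
  have "p h - p 0 = h * (h * D (\<lambda>y. D f y u) (x + s *\<^sub>R u + t *\<^sub>R v) v)"
    using ps qt by (simp add: q_def)
  then have "f (x + h *\<^sub>R u + h *\<^sub>R v) - f (x + h *\<^sub>R u) - f (x + h *\<^sub>R v) + f x
      = h * (h * D (\<lambda>y. D f y u) (x + s *\<^sub>R u + t *\<^sub>R v) v)"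
    by (simp add: p_def)
  then show ?thesis
    using s t less_imp_le by blast
qed

lemma second_derivative_symmetric_real:
  fixes f :: "'a::real_normed_vector \<Rightarrow> real"
  assumes U: "open U" and f: "smooth_on U f" and x: "x \<in> U"
  shows "D (\<lambda>y. D f y u) x v = D (\<lambda>y. D f y v) x u"
proof (rule ccontr)
  let ?a = "\<lambda>y. D (\<lambda>y. D f y u) y v" and ?b = "\<lambda>y. D (\<lambda>y. D f y v) y u"
  assume ne: "?a x \<noteq> ?b x"
  define e where "e = \<bar>?a x - ?b x\<bar> / 2"
  have e: "e > 0" using ne by (simp add: e_def)
  have cont: "continuous (at x) ?a" "continuous (at x) ?b"
    using smooth_continuous[OF smooth_D[OF smooth_D[OF f]]] U x
    by (simp_all add: continuous_on_eq_continuous_at)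
  obtain d1 where d1: "d1 > 0" "\<And>y. dist y x < d1 \<Longrightarrow> dist (?a y) (?a x) < e"
    using cont(1) e unfolding continuous_at_eps_delta by blast
  obtain d2 where d2: "d2 > 0" "\<And>y. dist y x < d2 \<Longrightarrow> dist (?b y) (?b x) < e"
    using cont(2) e unfolding continuous_at_eps_delta by blast
  obtain d3 where d3: "d3 > 0" "ball x d3 \<subseteq> U" using U x open_contains_ball by blast
  define d where "d = min d1 (min d2 d3)"
  have d: "d > 0" using d1 d2 d3 by (simp add: d_def)
  define n where "n = norm u + norm v + 1"
  \<comment> \<open>With this step size the whole parallelogram stays in the ball on which both second derivatives
    differ from their values at \<open>x\<close> by less than half the assumed gap.\<close>
  define h where "h = d / (2 * n)"
  have pos: "n > 0" using norm_ge_zero[of u] norm_ge_zero[of v] unfolding n_def by linarith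
  then have h: "h > 0" unfolding h_def using d by simp
  have hd: "h * (norm u + norm v) < d"
  proof -
    have "h * n = d / 2" unfolding h_def using pos by simp
    moreover have "h * (norm u + norm v) \<le> h * n"
      unfolding n_def using h by (intro mult_left_mono) auto
    ultimately show ?thesis using d by linarith
  qed
  have near: "dist (x + s *\<^sub>R u + t *\<^sub>R v) x < d" if "0 \<le> s" "s \<le> h" "0 \<le> t" "t \<le> h" for s t
  proof -
    have "dist (x + s *\<^sub>R u + t *\<^sub>R v) x = norm (s *\<^sub>R u + t *\<^sub>R v)" by (simp add: dist_norm)
    also have "\<dots> \<le> s * norm u + t * norm v" using norm_triangle_ineq[of "s *\<^sub>R u" "t *\<^sub>R v"] that by simp
    also have "\<dots> \<le> h * norm u + h * norm v" using that by (intro add_mono mult_right_mono) auto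
    finally show ?thesis using hd by (simp add: algebra_simps)
  qed
  have inU: "x + s *\<^sub>R u + t *\<^sub>R v \<in> U" if "0 \<le> s" "s \<le> h" "0 \<le> t" "t \<le> h" for s t
    using near[OF that] d3(2) by (auto simp: d_def dist_commute)
  obtain s t where st: "0 \<le> s" "s \<le> h" "0 \<le> t" "t \<le> h" and
    1: "f (x + h *\<^sub>R u + h *\<^sub>R v) - f (x + h *\<^sub>R u) - f (x + h *\<^sub>R v) + f x
      = h * (h * ?a (x + s *\<^sub>R u + t *\<^sub>R v))"
    using second_difference_mean_value[of U f h x u v, OF f h inU] by blast
  have inU': "x + s *\<^sub>R v + t *\<^sub>R u \<in> U" if "0 \<le> s" "s \<le> h" "0 \<le> t" "t \<le> h" for s t
    using inU[OF that(3,4,1,2)] by (simp add: algebra_simps)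
  obtain s' t' where st': "0 \<le> s'" "s' \<le> h" "0 \<le> t'" "t' \<le> h" and
    2: "f (x + h *\<^sub>R v + h *\<^sub>R u) - f (x + h *\<^sub>R v) - f (x + h *\<^sub>R u) + f x
      = h * (h * ?b (x + s' *\<^sub>R v + t' *\<^sub>R u))"
    using second_difference_mean_value[of U f h x v u, OF f h inU'] by blast
  have "f (x + h *\<^sub>R v + h *\<^sub>R u) = f (x + h *\<^sub>R u + h *\<^sub>R v)" by (simp add: algebra_simps)
  then have "h * (h * ?a (x + s *\<^sub>R u + t *\<^sub>R v)) = h * (h * ?b (x + s' *\<^sub>R v + t' *\<^sub>R u))"
    using 1 2 by linarith
  then have eq: "?a (x + s *\<^sub>R u + t *\<^sub>R v) = ?b (x + s' *\<^sub>R v + t' *\<^sub>R u)" using h by simp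
  let ?Q = "x + s' *\<^sub>R v + t' *\<^sub>R u"
  have "dist (?a (x + s *\<^sub>R u + t *\<^sub>R v)) (?a x) < e"
    by (rule d1(2)) (use near[OF st] in \<open>simp add: d_def\<close>)
  then have A: "\<bar>?b ?Q - ?a x\<bar> < e" by (simp only: eq dist_real_def)
  have "dist ?Q x < d" using near[OF st'(3,4,1,2)] by (simp add: algebra_simps)
  then have "dist (?b ?Q) (?b x) < e" by (intro d2(2)) (simp add: d_def)
  then have B: "\<bar>?b ?Q - ?b x\<bar> < e" by (simp only: dist_real_def)
  have "\<bar>?a x - ?b x\<bar> < 2 * e" using A B by linarith
  then show False by (simp add: e_def)
qed

lemma second_derivative_symmetric:
  fixes f :: "'a::real_normed_vector \<Rightarrow> 'b::real_inner"
  assumes U: "open U" and f: "smooth_on U f" and x: "x \<in> U"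
  shows "D (\<lambda>y. D f y u) x v = D (\<lambda>y. D f y v) x u"
proof -
  have key: "D (\<lambda>y. D f y u) x v \<bullet> c = D (\<lambda>y. D (\<lambda>z. f z \<bullet> c) y u) x v" for c u v
  proof -
    have 1: "D (\<lambda>z. f z \<bullet> c) y u = D f y u \<bullet> c" if "y \<in> U" for y
      using D_linear_compose[OF bounded_linear_inner_left smooth_differentiable[OF f that]] .
    have "D (\<lambda>y. D (\<lambda>z. f z \<bullet> c) y u) x = D (\<lambda>y. D f y u \<bullet> c) x"
      by (rule D_cong_open(1)[OF U x]) (rule 1)
    then show ?thesis
      using D_linear_compose[OF bounded_linear_inner_left smooth_differentiable[OF smooth_D[OF f] x]] by simp
  qed
  have "D (\<lambda>y. D f y u) x v \<bullet> c = D (\<lambda>y. D f y v) x u \<bullet> c" for c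
    unfolding key
    by (rule second_derivative_symmetric_real[OF U _ x])
      (rule smooth_bounded_linear[OF bounded_linear_inner_left U f])
  then show ?thesis using vector_eq_rdot by blast
qed

lemma second_derivative_linear:
  assumes U: "open U" and f: "smooth_on U f" and x: "x \<in> U"
  shows "linear (\<lambda>v. D (\<lambda>y. D f y v) x u)"
proof (rule linearI)
  note d = smooth_differentiable[OF smooth_D[OF f] x]
  fix v w :: 'a and a :: real
  have "D (\<lambda>y. D f y (v + w)) x = D (\<lambda>y. D f y v + D f y w) x"
    by (rule D_cong_open(1)[OF U x]) (rule linear_add[OF linear_D_smooth[OF f]])
  then show "D (\<lambda>y. D f y (v + w)) x u = D (\<lambda>y. D f y v) x u + D (\<lambda>y. D f y w) x u"
    by (simp add: D_add[OF d d])
  have "D (\<lambda>y. D f y (a *\<^sub>R v)) x = D (\<lambda>y. a *\<^sub>R D f y v) x"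
    by (rule D_cong_open(1)[OF U x]) (rule linear_cmul[OF linear_D_smooth[OF f]])
  then show "D (\<lambda>y. D f y (a *\<^sub>R v)) x u = a *\<^sub>R D (\<lambda>y. D f y v) x u"
    by (simp add: D_linear_compose[OF bounded_linear_scaleR_right d])
qed

text \<open>The product rule for evaluating the derivative of \<open>f\<close> on a variable vector field; it is what makes
  second fundamental forms tensorial.\<close>
lemma D_D_field:
  fixes f :: "'a::euclidean_space \<Rightarrow> 'b::real_normed_vector"
  assumes U: "open U" and f: "smooth_on U f" and Y: "smooth_on U Y" and x: "x \<in> U"
  shows "D (\<lambda>y. D f y (Y y)) x u = D (\<lambda>y. D f y (Y x)) x u + D f x (D Y x u)"
proof -
  have expand: "L v = (\<Sum>b\<in>Basis. (v \<bullet> b) *\<^sub>R L b)" if "linear L" for L :: "'a \<Rightarrow> 'b" and v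
  proof -
    have "L v = L (\<Sum>b\<in>Basis. (v \<bullet> b) *\<^sub>R b)" by (simp add: euclidean_representation)
    then show ?thesis by (simp only: linear_sum[OF that] linear_cmul[OF that])
  qed
  note dY = smooth_differentiable[OF Y x] and df = smooth_differentiable[OF smooth_D[OF f] x]
  have dYb: "(\<lambda>y. Y y \<bullet> b) differentiable (at x)" for b
    using smooth_differentiable[OF smooth_bounded_linear[OF bounded_linear_inner_left U Y] x] .
  have "D (\<lambda>y. D f y (Y y)) x u = D (\<lambda>y. \<Sum>b\<in>Basis. (Y y \<bullet> b) *\<^sub>R D f y b) x u"
    by (rule fun_cong[OF D_cong_open(1)[OF U x]]) (rule expand[OF linear_D_smooth[OF f]])
  also have "D (\<lambda>y. \<Sum>b\<in>Basis. (Y y \<bullet> b) *\<^sub>R D f y b) x u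
      = (\<Sum>b\<in>Basis. D (\<lambda>y. (Y y \<bullet> b) *\<^sub>R D f y b) x u)"
    by (rule D_sum) (rule bounded_bilinear.FDERIV[OF bounded_bilinear_scaleR D_works[OF dYb] D_works[OF df],
          THEN differentiableI])
  also have "\<dots> = (\<Sum>b\<in>Basis. (Y x \<bullet> b) *\<^sub>R D (\<lambda>y. D f y b) x u + (D Y x u \<bullet> b) *\<^sub>R D f x b)"
    by (simp add: D_scaleR[OF dYb df] D_linear_compose[OF bounded_linear_inner_left dY])
  also have "\<dots> = D (\<lambda>y. D f y (Y x)) x u + D f x (D Y x u)"
    unfolding sum.distrib
    by (simp only: expand[OF second_derivative_linear[OF U f x], symmetric] expand[OF linear_D_smooth[OF f x], symmetric])
  finally show ?thesis .
qed

section \<open>Smooth inverse functions\<close>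

lemma bounded_linear_axis: "bounded_linear (axis i :: 'b::euclidean_space \<Rightarrow> 'b^'n)"
  by (intro linear_conv_bounded_linear[THEN iffD1] linearI) (auto simp: axis_def vec_eq_iff)

lemma smooth_vec_nth: "open U \<Longrightarrow> smooth_on U f \<Longrightarrow> smooth_on U (\<lambda>x. f x $ i)"
  using smooth_bounded_linear[OF bounded_linear_vec_nth] .

lemma smooth_vecI:
  fixes f :: "'a::real_normed_vector \<Rightarrow> ('b::euclidean_space)^'n"
  assumes "open U" "\<And>i. smooth_on U (\<lambda>x. f x $ i)"
  shows "smooth_on U f"
proof -
  have "f = (\<lambda>x. \<Sum>i\<in>UNIV. axis i (f x $ i))"
    by (auto simp: fun_eq_iff vec_eq_iff axis_def)
  moreover have "smooth_on U (\<lambda>x. \<Sum>i\<in>UNIV. axis i (f x $ i))"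
    by (intro smooth_sum smooth_bounded_linear[OF bounded_linear_axis] assms)
  ultimately show ?thesis by simp
qed

lemma smooth_det:
  fixes M :: "'a::real_normed_vector \<Rightarrow> real^'n^'n"
  assumes "open U" "\<And>i j. smooth_on U (\<lambda>x. M x $ i $ j)"
  shows "smooth_on U (\<lambda>x. det (M x))"
  unfolding det_def by (intro smooth_sum smooth_mult smooth_prod smooth_const assms)

text \<open>Cramer's rule exhibits the inverse as a quotient of determinants of smooth matrices.\<close>
lemma smooth_inverse_linear:
  fixes A :: "'a::real_normed_vector \<Rightarrow> real^'n \<Rightarrow> real^'n"
  assumes U: "open U" and A: "\<And>v. smooth_on U (\<lambda>x. A x v)"
    and lin: "\<And>x. x \<in> U \<Longrightarrow> linear (A x)" and bij: "\<And>x. x \<in> U \<Longrightarrow> bij (A x)"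
  shows "smooth_on U (\<lambda>x. inv (A x) v)"
proof -
  let ?M = "\<lambda>x. matrix (A x)"
  let ?Mk = "\<lambda>k x. \<chi> i j. if j = k then v $ i else ?M x $ i $ j"
  have entry: "smooth_on U (\<lambda>x. ?M x $ i $ j)" for i j
    using smooth_vec_nth[OF U A[of "axis j 1"], where i = i] by (simp add: matrix_def)
  have det0: "det (?M x) \<noteq> 0" if "x \<in> U" for x
    using det_nz_iff_inj[OF lin[OF that]] bij[OF that] bij_is_inj by blast
  have entry': "smooth_on U (\<lambda>x. ?Mk k x $ i $ j)" for k i j
    using entry[of i j] smooth_const[of U "v $ i"] by (cases "j = k") auto
  have "smooth_on U (\<lambda>x. \<chi> k. det (?Mk k x) / det (?M x))"
  proof (rule smooth_vecI[OF U])
    show "smooth_on U (\<lambda>x. (\<chi> k. det (?Mk k x) / det (?M x)) $ k)" for k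
      using smooth_divide[OF U smooth_det[OF U entry'] smooth_det[OF U entry] det0, of k]
      by simp
  qed
  moreover have "(\<chi> k. det (?Mk k x) / det (?M x)) = inv (A x) v" if "x \<in> U" for x
  proof -
    have "A x (inv (A x) v) = v" using bij_is_surj[OF bij[OF that]] by (rule surj_f_inv_f)
    then have "?M x *v inv (A x) v = v" using fun_cong[OF matrix_vector_mul(2)[OF lin[OF that]]] by simp
    then have "inv (A x) v = (\<chi> k. det (?Mk k x) / det (?M x))"
      by (rule cramer[OF det0[OF that], THEN iffD1])
    then show ?thesis by (rule sym)
  qed
  ultimately show ?thesis by (rule smooth_congD[OF U])
qed

text \<open>The inverse function theorem provides a continuous inverse \<open>G\<close> with derivative
  \<open>inv (D F (G y))\<close>; by this formula \<open>G\<close> is one degree smoother than it was known to be.\<close>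
lemma smooth_local_inverse:
  fixes F :: "real^'n \<Rightarrow> real^'n"
  assumes U: "open U" and F: "smooth_on U F" and p: "p \<in> U" and inj: "inj (D F p)"
  obtains U' V' G where "open U'" "U' \<subseteq> U" "p \<in> U'" "open V'" "homeomorphism U' V' F G" "smooth_on V' G"
proof -
  define F' where "F' = (\<lambda>x. Blinfun (D F x))"
  have F': "blinfun_apply (F' x) = D F x" if "x \<in> U" for x
    unfolding F'_def using smooth_has_derivative[OF F that]
    by (intro bounded_linear_Blinfun_apply) (rule has_derivative_bounded_linear)
  have der: "(F has_derivative blinfun_apply (F' x)) (at x)" if "x \<in> U" for x
    using smooth_has_derivative[OF F that] F'[OF that] by simp
  have cont: "continuous_on U F'"
  proof (rule continuous_on_blinfun_componentwise)
    show "continuous_on U (\<lambda>x. blinfun_apply (F' x) i)" for i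
      using smooth_continuous[OF smooth_D[OF F, of i]] F' by (simp cong: continuous_on_cong)
  qed
  obtain T where T: "linear T" "\<And>x. T (D F p x) = x"
    using linear_injective_isomorphism[OF linear_D_smooth[OF F p] inj] by blast
  have Tb: "bounded_linear T" using T(1) linear_conv_bounded_linear by blast
  have inv: "Blinfun T o\<^sub>L F' p = id_blinfun"
    by (rule blinfun_eqI) (simp add: bounded_linear_Blinfun_apply[OF Tb] F'[OF p] T(2))
  obtain U' V G g' where U': "open U'" "U' \<subseteq> U" "p \<in> U'" and V: "open V" and "F p \<in> V"
    and hom: "homeomorphism U' V F G"
    and G: "\<And>y. y \<in> V \<Longrightarrow> (G has_derivative (g' y)) (at y)"
    and g': "\<And>y. y \<in> V \<Longrightarrow> g' y = inv (blinfun_apply (F' (G y)))"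
    and bij: "\<And>y. y \<in> V \<Longrightarrow> bij (blinfun_apply (F' (G y)))"
    using inverse_function_theorem[OF U der cont p inv] by metis
  have GU: "G ` V = U'" and GF: "\<And>x. x \<in> U' \<Longrightarrow> G (F x) = x" and FU: "F ` U' = V"
    using hom by (auto simp: homeomorphism_def)
  have bijF: "bij (D F x)" if "x \<in> U'" for x
    using bij[of "F x"] that FU GF F'[of x] U'(2) by auto
  have smB: "smooth_on U' (\<lambda>x. inv (D F x) v)" for v
    by (rule smooth_inverse_linear[OF U'(1) smooth_D[OF smooth_subset[OF F U'(2)]] _ bijF])
      (use linear_D_smooth[OF F] U'(2) in auto)
  have "Ck_on k V G" for k
  proof (induction k)
    case 0
    show ?case using hom by (simp add: homeomorphism_def)
  next
    case (Suc k)
    show ?case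
    proof (rule Ck_on_SucI[OF V])
      fix y assume y: "y \<in> V"
      have "G y \<in> U'" using GU y by blast
      then have "g' y = inv (D F (G y))" using g'[OF y] F'[of "G y"] U'(2) by auto
      then show "(G has_derivative (\<lambda>v. inv (D F (G y)) v)) (at y)" using G[OF y] by simp
    next
      show "Ck_on k V (\<lambda>y. inv (D F (G y)) v)" for v
        using Ck_on_compose[OF V U'(1) _ Suc, of "\<lambda>x. inv (D F x) v"] GU smB[of v]
        unfolding smooth_on_def by blast
    qed
  qed
  then have "smooth_on V G" by (simp add: smooth_on_def)
  then show ?thesis using that U' V hom by blast
qed

lemma smooth_Pair:
  assumes "open U" "smooth_on U f" "smooth_on U g"
  shows "smooth_on U (\<lambda>x. (f x, g x))"
proof -
  have "smooth_on U (\<lambda>x. (f x, 0) + (0, g x))"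
    by (intro smooth_add assms smooth_bounded_linear[OF bounded_linear_Pair[OF bounded_linear_ident bounded_linear_zero]]
        smooth_bounded_linear[OF bounded_linear_Pair[OF bounded_linear_zero bounded_linear_ident]])
  then show ?thesis by simp
qed

lemma D_Pair:
  assumes "f differentiable (at x)" "g differentiable (at x)"
  shows "D (\<lambda>x. (f x, g x)) x v = (D f x v, D g x v)"
  using D_eqI[OF has_derivative_Pair[OF D_works[OF assms(1)] D_works[OF assms(2)]]] by simp

text \<open>A function \<open>t\<close> and a map \<open>w\<close> whose differentials are jointly injective at \<open>p\<close> are
  coordinates near \<open>p\<close>, and the coordinate domain can be chosen as an interval times an open set.\<close>
lemma product_chart:
  fixes t :: "real^4 \<Rightarrow> real" and w :: "real^4 \<Rightarrow> real^3"
  assumes U: "open U" and t: "smooth_on U t" and w: "smooth_on U w" and p: "p \<in> U"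
    and inj: "\<And>v. D t p v = 0 \<Longrightarrow> D w p v = 0 \<Longrightarrow> v = 0"
  obtains V a b W h where "open V" "p \<in> V" "V \<subseteq> U" "open W" "t p \<in> {a<..<b}" "w p \<in> W"
    "homeomorphism ({a<..<b} \<times> W) V h (\<lambda>x. (t x, w x))" "smooth_on ({a<..<b} \<times> W) h"
proof -
  have dim: "DIM(real \<times> (real^3)) = DIM(real^4)" by simp
  obtain J :: "real \<times> (real^3) \<Rightarrow> real^4" and K where J: "linear J" and K: "linear K"
    and "\<And>z. norm (J z) = norm z" "\<And>z. norm (K z) = norm z"
    and KJ: "\<And>z. K (J z) = z" and "\<And>z. J (K z) = z"
    by (rule isomorphisms_UNIV_UNIV[OF dim]) (rule that)
  have Jb: "bounded_linear J" using J by (simp add: linear_conv_bounded_linear)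
  define F where "F = (\<lambda>x. J (t x, w x))"
  have F: "smooth_on U F" unfolding F_def by (intro smooth_bounded_linear[OF Jb U] smooth_Pair U t w)
  have DF: "D F p v = J (D t p v, D w p v)" for v
    unfolding F_def using smooth_differentiable[OF t p] smooth_differentiable[OF w p]
    by (subst D_linear_compose[OF Jb]) (simp_all add: D_Pair differentiable_Pair)
  have "inj (D F p)"
  proof (subst linear_injective_0[OF linear_D_smooth[OF F p]], intro allI impI)
    fix v assume "D F p v = 0"
    then have "(D t p v, D w p v) = 0" using KJ linear_0[OF K] by (metis DF)
    then show "v = 0" using inj by (simp add: zero_prod_def)
  qed
  then obtain U' V' G where U': "open U'" "U' \<subseteq> U" "p \<in> U'" and V': "open V'"
    and hom: "homeomorphism U' V' F G" and G: "smooth_on V' G"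
    using smooth_local_inverse[OF U F p] by metis
  have GF: "\<And>x. x \<in> U' \<Longrightarrow> G (F x) = x" and FG: "\<And>y. y \<in> V' \<Longrightarrow> F (G y) = y"
    and FU: "F ` U' = V'" and GV: "G ` V' = U'"
    using hom by (auto simp: homeomorphism_def)
  have "open (J -` V')"
    using V' bounded_linear.continuous_on[OF Jb continuous_on_id] by (intro open_vimage) auto
  moreover have "(t p, w p) \<in> J -` V'" using FU U'(3) by (auto simp: F_def)
  ultimately obtain A W where AW: "open A" "open W" "(t p, w p) \<in> A \<times> W" "A \<times> W \<subseteq> J -` V'"
    by (rule open_prod_elim) blast
  obtain e where e: "e > 0" "ball (t p) e \<subseteq> A" using AW open_contains_ball by (metis SigmaD1)
  define a b where "a = t p - e" and "b = t p + e"
  have ab: "{a<..<b} = ball (t p) e" by (auto simp: a_def b_def dist_real_def)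
  have sub: "{a<..<b} \<times> W \<subseteq> J -` V'" using e(2) AW(4) ab by blast
  define h where "h = (\<lambda>z. G (J z))"
  define V where "V = U' \<inter> (\<lambda>x. (t x, w x)) -` ({a<..<b} \<times> W)"
  have contt: "continuous_on U' (\<lambda>x. (t x, w x))"
    using smooth_continuous[OF smooth_subset[OF smooth_Pair[OF U t w] U'(2)]] .
  have opS: "open ({a<..<b} \<times> W)" using AW(2) by (intro open_Times) auto
  have opV: "open V"
    using continuous_open_preimage[OF contt U'(1) opS] by (simp add: V_def)
  have tw: "(t (h z), w (h z)) = z" and hU: "h z \<in> U'" if "z \<in> {a<..<b} \<times> W" for z
  proof -
    have JV: "J z \<in> V'" using sub that by blast
    then have "J (t (h z), w (h z)) = J z" using FG[of "J z"] by (simp add: F_def h_def)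
    then show "(t (h z), w (h z)) = z" using KJ by metis
    show "h z \<in> U'" using JV GV by (auto simp: h_def)
  qed
  have ht: "h (t x, w x) = x" if "x \<in> V" for x
    using GF[of x] that by (simp add: h_def V_def F_def)
  have smh: "smooth_on ({a<..<b} \<times> W) h"
    unfolding h_def
    by (rule smooth_compose[OF opS V' _ smooth_bounded_linear[OF Jb opS smooth_ident] G]) (use sub in auto)
  have "homeomorphism ({a<..<b} \<times> W) V h (\<lambda>x. (t x, w x))"
  proof (rule homeomorphismI)
    show "continuous_on ({a<..<b} \<times> W) h" using smooth_continuous[OF smh] .
    show "continuous_on V (\<lambda>x. (t x, w x))"
      by (rule continuous_on_subset[OF contt]) (simp add: V_def)
    show "h ` ({a<..<b} \<times> W) \<subseteq> V"
    proof (rule image_subsetI)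
      fix z assume "z \<in> {a<..<b} \<times> W"
      then show "h z \<in> V" using tw[of z] hU[of z] by (simp add: V_def)
    qed
    show "(\<lambda>x. (t x, w x)) ` V \<subseteq> {a<..<b} \<times> W" by (auto simp: V_def)
  qed (use tw ht in auto)
  moreover have "p \<in> V" using U'(3) AW(3) e(1) by (auto simp: V_def a_def b_def)
  ultimately show ?thesis
    using that[OF opV, of W a b h] U'(2) AW(2,3) smh e(1) by (auto simp: V_def a_def b_def)
qed

section \<open>The Hermitian product and unitary frames\<close>

text \<open>The real part is the inner product and the imaginary part the Kaehler form, so that orthonormal
  Lagrangian frames are exactly the unitary ones.\<close>
definition herm :: "complex^'n \<Rightarrow> complex^'n \<Rightarrow> complex" where
  "herm v w = (\<Sum>i\<in>UNIV. v $ i * cnj (w $ i))"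

lemma herm_add_left: "herm (u + v) w = herm u w + herm v w"
  by (simp add: herm_def sum.distrib algebra_simps)

lemma herm_add_right: "herm u (v + w) = herm u v + herm u w"
  by (simp add: herm_def sum.distrib algebra_simps)

lemma herm_scale_left: "herm (c *s v) w = c * herm v w"
  by (simp add: herm_def sum_distrib_left algebra_simps)

lemma herm_scale_right: "herm v (c *s w) = cnj c * herm v w"
  by (simp add: herm_def sum_distrib_left algebra_simps)

lemma herm_scaleR_left: "herm (a *\<^sub>R v) w = of_real a * herm v w"
  by (simp add: herm_def sum_distrib_left scaleR_conv_of_real[where 'a = complex] algebra_simps)

lemma herm_scaleR_right: "herm v (a *\<^sub>R w) = of_real a * herm v w"
  by (simp add: herm_def sum_distrib_left scaleR_conv_of_real[where 'a = complex] algebra_simps)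

lemma herm_zero [simp]: "herm 0 w = 0" "herm v 0 = 0"
  by (simp_all add: herm_def)

lemma herm_minus_left: "herm (- v) w = - herm v w"
  by (simp add: herm_def sum_negf)

lemma herm_minus_right: "herm v (- w) = - herm v w"
  by (simp add: herm_def sum_negf)

lemma herm_diff_left: "herm (u - v) w = herm u w - herm v w"
  using herm_add_left[of u "- v" w] by (simp add: herm_minus_left)

lemma herm_diff_right: "herm u (v - w) = herm u v - herm u w"
  using herm_add_right[of u v "- w"] by (simp add: herm_minus_right)

lemma herm_cnj: "herm w v = cnj (herm v w)"
  by (simp add: herm_def mult.commute)

lemma herm_sum_left: "herm (\<Sum>i\<in>I. f i) w = (\<Sum>i\<in>I. herm (f i) w)"
  by (induction I rule: infinite_finite_induct) (simp_all add: herm_add_left)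

lemma herm_sum_right: "herm v (\<Sum>i\<in>I. f i) = (\<Sum>i\<in>I. herm v (f i))"
  by (induction I rule: infinite_finite_induct) (simp_all add: herm_add_right)

lemma inner_eq_Re_herm: "v \<bullet> w = Re (herm v w)"
  by (simp add: inner_vec_def herm_def inner_complex_def)

lemma inner_ii_eq_Im_herm: "v \<bullet> (\<i> *s w) = Im (herm v w)"
  by (simp add: inner_eq_Re_herm herm_scale_right)

lemma herm_self: "herm v v = of_real ((norm v)\<^sup>2)"
proof (rule complex_eqI)
  show "Re (herm v v) = Re (of_real ((norm v)\<^sup>2))"
    by (simp add: inner_eq_Re_herm[symmetric] power2_norm_eq_inner)
  show "Im (herm v v) = Im (of_real ((norm v)\<^sup>2))"
    using arg_cong[OF herm_cnj[of v v], of Im] by simp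
qed

lemma herm_self_eq_0: "herm v v = 0 \<longleftrightarrow> v = 0"
  by (simp add: herm_self)

lemma bounded_bilinear_herm: "bounded_bilinear (herm :: complex^'n \<Rightarrow> _)"
proof -
  have "bilinear (herm :: complex^'n \<Rightarrow> _)"
    unfolding bilinear_def
    by (auto intro!: linearI simp: herm_add_left herm_add_right herm_scaleR_left herm_scaleR_right
        scaleR_conv_of_real[where 'a = complex])
  then show ?thesis by (simp add: bilinear_conv_bounded_bilinear)
qed

lemma bounded_linear_scale: "bounded_linear (\<lambda>v :: complex^'n. c *s v)"
  by (intro linear_conv_bounded_linear[THEN iffD1] linearI)
    (auto simp: vec_eq_iff algebra_simps scaleR_conv_of_real[where 'a = complex])

lemma bounded_bilinear_scale:
  "bounded_bilinear (\<lambda>c (v :: complex^'n). c *s v)"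
proof -
  have "bilinear (\<lambda>c (v :: complex^'n). c *s v)"
    unfolding bilinear_def
    by (auto intro!: linearI simp: vec_eq_iff algebra_simps scaleR_conv_of_real[where 'a = complex])
  then show ?thesis by (simp add: bilinear_conv_bounded_bilinear)
qed

lemma scaleR_eq_scale: "a *\<^sub>R v = of_real a *s (v :: complex^'n)"
  by (simp add: vec_eq_iff scaleR_conv_of_real[where 'a = complex])

lemmas smooth_herm = smooth_bilinear[OF bounded_bilinear_herm]
lemmas D_herm = D_bilinear[OF bounded_bilinear_herm]
lemmas smooth_Re = smooth_bounded_linear[OF bounded_linear_Re]
lemmas smooth_Im = smooth_bounded_linear[OF bounded_linear_Im]
lemmas D_Re = D_linear_compose[OF bounded_linear_Re]
lemmas D_Im = D_linear_compose[OF bounded_linear_Im]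

lemma smooth_herm_differentiable:
  assumes "smooth_on U f" "smooth_on U g" "x \<in> U"
  shows "(\<lambda>x. herm (f x) (g x)) differentiable (at x)"
  using bounded_bilinear.FDERIV[OF bounded_bilinear_herm smooth_has_derivative[OF assms(1,3)]
      smooth_has_derivative[OF assms(2,3)]]
  by (auto simp: differentiable_def)

text \<open>Orthonormality says that the matrix of the \<open>F i\<close> has its adjoint as right inverse; for a
  square matrix this is also a left inverse.\<close>
lemma unitary_expansion:
  fixes F :: "'n::finite \<Rightarrow> complex^'n"
  assumes "\<And>i j. herm (F i) (F j) = (if i = j then 1 else 0)"
  shows "v = (\<Sum>k\<in>UNIV. herm v (F k) *s F k)"
proof -
  let ?P = "(\<chi> i j. F i $ j) :: complex^'n^'n" and ?Q = "(\<chi> i j. cnj (F j $ i)) :: complex^'n^'n"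
  have "?P ** ?Q = mat 1"
    using assms by (simp add: matrix_matrix_mult_def mat_def vec_eq_iff herm_def)
  then have QP: "?Q ** ?P = mat 1" by (simp add: matrix_left_right_inverse)
  have *: "(\<Sum>i\<in>UNIV. cnj (F i $ j) * F i $ k) = (if j = k then 1 else 0)" for j k
    using arg_cong[OF QP, of "\<lambda>A. A $ j $ k"] by (simp add: matrix_matrix_mult_def mat_def)
  show ?thesis
  proof (subst vec_eq_iff, intro allI)
    fix k
    have "(\<Sum>i\<in>UNIV. herm v (F i) *s F i) $ k = (\<Sum>i\<in>UNIV. \<Sum>j\<in>UNIV. v $ j * (cnj (F i $ j) * F i $ k))"
      by (simp add: herm_def sum_distrib_right mult.assoc)
    also have "\<dots> = (\<Sum>j\<in>UNIV. v $ j * (\<Sum>i\<in>UNIV. cnj (F i $ j) * F i $ k))"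
      by (subst sum.swap) (simp add: sum_distrib_left)
    also have "\<dots> = v $ k" by (simp add: * if_distrib cong: if_cong)
    finally show "v $ k = (\<Sum>i\<in>UNIV. herm v (F i) *s F i) $ k" by simp
  qed
qed

section \<open>Levi-Civita connections and second fundamental forms\<close>

text \<open>The value of a Hermitian metric at one point, as a real bilinear form.\<close>
definition hermitian_form :: "(complex^'n \<Rightarrow> complex^'n \<Rightarrow> real) \<Rightarrow> bool" where
  "hermitian_form B \<longleftrightarrow> bilinear B \<and> (\<forall>v w. B v w = B w v) \<and> (\<forall>v. v \<noteq> 0 \<longrightarrow> B v v > 0) \<and>
     (\<forall>v w. B (\<i> *s v) (\<i> *s w) = B v w)"

lemma hermitian_formD:
  assumes "hermitian_form B"
  shows "B (u + v) w = B u w + B v w" "B u (v + w) = B u v + B u w"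
    "B (a *\<^sub>R v) w = a * B v w" "B v (a *\<^sub>R w) = a * B v w"
    "B (u - v) w = B u w - B v w" "B v w = B w v"
    "B v v = 0 \<Longrightarrow> v = 0" "B (\<i> *s v) (\<i> *s w) = B v w" "B v 0 = 0" "B 0 v = 0"
    "B (sum f I) w = (\<Sum>i\<in>I. B (f i) w)" "B w (sum f I) = (\<Sum>i\<in>I. B w (f i))"
proof -
  have lin: "linear (\<lambda>v. B v w)" "linear (B w)" for w
    using assms by (simp_all add: hermitian_form_def bilinear_def)
  show "B (u + v) w = B u w + B v w" using linear_add[OF lin(1)] .
  show "B u (v + w) = B u v + B u w" using linear_add[OF lin(2)] .
  show "B (a *\<^sub>R v) w = a * B v w" using linear_cmul[OF lin(1)] by simp
  show "B v (a *\<^sub>R w) = a * B v w" using linear_cmul[OF lin(2)] by simp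
  show "B (u - v) w = B u w - B v w" using linear_diff[OF lin(1)] .
  show "B v w = B w v" using assms unfolding hermitian_form_def by blast
  show "v = 0" if "B v v = 0" using assms that unfolding hermitian_form_def by force
  show "B (\<i> *s v) (\<i> *s w) = B v w" using assms unfolding hermitian_form_def by blast
  show "B v 0 = 0" using linear_0[OF lin(2)] .
  show "B 0 v = 0" using linear_0[OF lin(1)] .
  show "B (sum f I) w = (\<Sum>i\<in>I. B (f i) w)" using linear_sum[OF lin(1)] .
  show "B w (sum f I) = (\<Sum>i\<in>I. B w (f i))" using linear_sum[OF lin(2)] .
qed

text \<open>The difference of two such connections is symmetric in its two arguments and skew with respect to the
  metric in the last one; a trilinear form that is symmetric in one pair of arguments and skew in an
  overlapping pair vanishes.\<close>
lemma levi_civita_unique: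
  assumes B: "hermitian_form (g z)" and "is_levi_civita_at g z \<Gamma>" "is_levi_civita_at g z \<Gamma>'"
  shows "\<Gamma> = \<Gamma>'"
proof -
  define T where "T u v = \<Gamma> u v - \<Gamma>' u v" for u v
  note B' = hermitian_formD[OF B]
  have sym: "T u v = T v u" for u v
    using assms(2,3) unfolding is_levi_civita_at_def T_def by metis
  have "g z (\<Gamma> u v) w + g z v (\<Gamma> u w) = g z (\<Gamma>' u v) w + g z v (\<Gamma>' u w)" for u v w
    using assms(2,3) unfolding is_levi_civita_at_def by metis
  then have "g z (\<Gamma> u v) w + g z (\<Gamma> u w) v = g z (\<Gamma>' u v) w + g z (\<Gamma>' u w) v" for u v w
    using B'(6) by metis
  then have skew: "g z (T u v) w = - g z (T u w) v" for u v w
    unfolding T_def B'(5) by (simp add: algebra_simps)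
  have "g z (T u v) w = 0" for u v w
  proof -
    have "g z (T u v) w = - g z (T w u) v" using skew[of u v w] sym[of u w] by simp
    also have "\<dots> = g z (T v w) u" using skew[of w u v] sym[of w v] by simp
    also have "\<dots> = - g z (T u v) w" using skew[of v w u] sym[of v u] by simp
    finally show ?thesis by simp
  qed
  then have "T u v = 0" for u v using B'(7) by blast
  then show ?thesis by (simp add: T_def fun_eq_iff)
qed

lemma christoffel_eqI:
  assumes "hermitian_form (g z)" "is_levi_civita_at g z \<Gamma>"
  shows "christoffel g z = \<Gamma>"
  unfolding christoffel_def
  by (rule the_equality) (use assms levi_civita_unique[of g z, OF assms(1)] in auto)

lemma hermitian_form_flat: "hermitian_form (flat_metric z)"
  unfolding hermitian_form_def flat_metric_def
proof (intro conjI allI impI)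
  show "bilinear (\<lambda>v w :: complex^'a. v \<bullet> w)"
    using bounded_bilinear_inner by (simp add: bilinear_conv_bounded_bilinear)
  show "(\<i> *s v) \<bullet> (\<i> *s w) = v \<bullet> w" for v w :: "complex^'a"
    by (simp add: inner_eq_Re_herm herm_scale_left herm_scale_right)
qed (auto simp: inner_commute)

lemma christoffel_flat: "christoffel flat_metric z = (\<lambda>u v. 0)"
proof (rule christoffel_eqI[OF hermitian_form_flat])
  show "is_levi_civita_at flat_metric z (\<lambda>u v. 0)"
    unfolding is_levi_civita_at_def flat_metric_def bilinear_def
    by (auto intro!: linearI)
qed

lemma cov_deriv_flat: "cov_deriv flat_metric f X Y x = D (\<lambda>y. D f y (Y y)) x (X x)"
  by (simp add: cov_deriv_def christoffel_flat)

text \<open>The complex structure maps the tangent space to its orthogonal complement, so that the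
  description in \<open>sff_tensor\<close> determines its value.\<close>
lemma tangent_normal_unique:
  assumes B: "hermitian_form (g z)" and lin: "linear T" and inj: "inj T"
    and lag: "\<And>u v. g z (T u) (\<i> *s T v) = 0"
    and eq: "T b + \<i> *s T a = T b' + \<i> *s T a'"
  shows "a = a'"
proof -
  note B' = hermitian_formD[OF B]
  have "T (b - b') = \<i> *s T (a' - a)"
    using eq by (simp add: linear_diff[OF lin] vec_eq_iff algebra_simps)
  then have "g z (T (a' - a)) (T (a' - a)) = g z (T (b - b')) (\<i> *s T (a' - a))"
    using B'(8) by metis
  then have "T (a' - a) = 0" using lag B'(7) by metis
  then have "T (a' - a) = T 0" by (simp add: linear_0[OF lin])
  then show ?thesis using inj by (simp add: inj_eq)
qed

lemma sff_tensor_eqI: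
  assumes "hermitian_form (g (f x))" "linear (D f x)" "inj (D f x)"
    and "\<And>u v. g (f x) (D f x u) (\<i> *s D f x v) = 0"
    and "cov_deriv g f X Y x = D f x b + \<i> *s D f x a"
  shows "sff_tensor g f X Y x = a"
  unfolding sff_tensor_def
proof (rule the_equality)
  show "\<exists>b. cov_deriv g f X Y x = D f x b + \<i> *s D f x a" using assms(5) by blast
  fix a' assume "\<exists>b. cov_deriv g f X Y x = D f x b + \<i> *s D f x a'"
  then obtain b' where "D f x b' + \<i> *s D f x a' = D f x b + \<i> *s D f x a" using assms(5) by metis
  then show "a' = a" by (rule tangent_normal_unique[of g, OF assms(1-4)])
qed

text \<open>The coefficients of the cubic form \<open>Re ((e\<^sub>1 + \<i> e\<^sub>2)\<^sup>3)\<close>: for an adapted frame,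
  \<open>r x * cubic i j k\<close> is the inner product of \<open>A (X i, X j)\<close> with \<open>X k\<close>.\<close>
definition cubic :: "'n::{finite,numeral} \<Rightarrow> 'n \<Rightarrow> 'n \<Rightarrow> real" where
  "cubic i j k = (if i = 1 \<and> j = 1 \<and> k = 1 then 1
     else if (i, j, k) \<in> {(1, 2, 2), (2, 1, 2), (2, 2, 1)} then - 1 else 0)"

lemma distinct_4: "(1::4) \<noteq> 2" "(1::4) \<noteq> 3" "(1::4) \<noteq> 4" "(2::4) \<noteq> 3" "(2::4) \<noteq> 4" "(3::4) \<noteq> 4"
  "(2::4) \<noteq> 1" "(3::4) \<noteq> 1" "(4::4) \<noteq> 1" "(3::4) \<noteq> 2" "(4::4) \<noteq> 2" "(4::4) \<noteq> 3"
  by simp_all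

lemma distinct_3: "(1::3) \<noteq> 2" "(1::3) \<noteq> 3" "(2::3) \<noteq> 3" "(2::3) \<noteq> 1" "(3::3) \<noteq> 1" "(3::3) \<noteq> 2"
  by simp_all

lemma trace_via_basis:
  fixes T :: "real^'n \<Rightarrow> real^'n" and Y :: "'n \<Rightarrow> real^'n" and c :: "'n \<Rightarrow> real^'n \<Rightarrow> real"
  assumes T: "linear T" and c: "\<And>k. linear (c k)" and rep: "\<And>v. v = (\<Sum>k\<in>UNIV. c k v *\<^sub>R Y k)"
  shows "trace (matrix T) = (\<Sum>k\<in>UNIV. c k (T (Y k)))"
proof -
  have "T (axis i 1) $ i = (\<Sum>k\<in>UNIV. c k (axis i 1) * T (Y k) $ i)" for i
  proof -
    have "T (axis i 1) = T (\<Sum>k\<in>UNIV. c k (axis i 1) *\<^sub>R Y k)" using rep[of "axis i 1"] by simp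
    also have "\<dots> = (\<Sum>k\<in>UNIV. c k (axis i 1) *\<^sub>R T (Y k))"
      by (simp only: linear_sum[OF T] linear_cmul[OF T])
    finally show ?thesis by simp
  qed
  then have "trace (matrix T) = (\<Sum>i\<in>UNIV. \<Sum>k\<in>UNIV. c k (axis i 1) * T (Y k) $ i)"
    by (simp add: trace_def matrix_def)
  also have "\<dots> = (\<Sum>k\<in>UNIV. \<Sum>i\<in>UNIV. c k (axis i 1) * T (Y k) $ i)" by (rule sum.swap)
  also have "\<dots> = (\<Sum>k\<in>UNIV. c k (T (Y k)))"
  proof (rule sum.cong[OF refl])
    fix k
    have "T (Y k) = (\<Sum>i\<in>UNIV. (T (Y k) $ i) *\<^sub>R axis i 1)"
      by (simp add: vec_eq_iff axis_def if_distrib cong: if_cong)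
    then have "c k (T (Y k)) = c k (\<Sum>i\<in>UNIV. (T (Y k) $ i) *\<^sub>R axis i 1)" by simp
    also have "\<dots> = (\<Sum>i\<in>UNIV. T (Y k) $ i * c k (axis i 1))"
      by (simp add: linear_sum[OF c] linear_cmul[OF c])
    finally show "(\<Sum>i\<in>UNIV. c k (axis i 1) * T (Y k) $ i) = c k (T (Y k))"
      by (simp add: mult.commute)
  qed
  finally show ?thesis .
qed

lemma orthonormal_coordinates:
  fixes T :: "real^'n \<Rightarrow> complex^'n" and Y :: "'n \<Rightarrow> real^'n"
  assumes B: "hermitian_form B" and T: "linear T" "inj T"
    and orth: "\<And>i j. B (T (Y i)) (T (Y j)) = (if i = j then 1 else 0)"
  shows "v = (\<Sum>k\<in>UNIV. B (T v) (T (Y k)) *\<^sub>R Y k)"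
proof -
  note B' = hermitian_formD[OF B]
  have injY: "inj Y"
    by (rule injI) (metis orth zero_neq_one)
  have "independent (range Y)"
    unfolding independent_explicit
  proof (intro conjI allI impI ballI)
    show "finite (range Y)" by simp
    fix u y assume u: "(\<Sum>v\<in>range Y. u v *\<^sub>R v) = 0" and "y \<in> range Y"
    then obtain k where k: "y = Y k" by blast
    have "(\<Sum>i\<in>UNIV. u (Y i) *\<^sub>R Y i) = 0"
      using u sum.reindex[OF injY, of "\<lambda>y. u y *\<^sub>R y"] by (simp add: o_def)
    then have "B (T (\<Sum>i\<in>UNIV. u (Y i) *\<^sub>R Y i)) (T (Y k)) = 0" by (simp add: linear_0[OF T(1)] B')
    then have "(\<Sum>i\<in>UNIV. u (Y i) * (if i = k then 1 else 0)) = 0"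
      by (simp add: linear_sum[OF T(1)] linear_cmul[OF T(1)] B' orth)
    then show "u y = 0" by (simp add: k if_distrib cong: if_cong)
  qed
  moreover have "card (range Y) = DIM(real^'n)" by (simp add: card_image[OF injY])
  ultimately have "span (range Y) = UNIV"
    using card_eq_dim[of "range Y" "UNIV :: (real^'n) set"] by (simp add: dim_UNIV) auto
  then obtain u where u: "v = (\<Sum>y\<in>range Y. u y *\<^sub>R y)"
    using span_finite[of "range Y"] by auto
  then have u': "v = (\<Sum>i\<in>UNIV. u (Y i) *\<^sub>R Y i)" using sum.reindex[OF injY, of "\<lambda>y. u y *\<^sub>R y"] by (simp add: o_def)
  have "B (T v) (T (Y k)) = (\<Sum>i\<in>UNIV. u (Y i) * (if i = k then 1 else 0))" for k
    by (subst u') (simp add: linear_sum[OF T(1)] linear_cmul[OF T(1)] B' orth)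
  then have "B (T v) (T (Y k)) = u (Y k)" for k by (simp add: if_distrib cong: if_cong)
  then show ?thesis using u' by simp
qed


lemma ii_scaleR: "\<i> *s (a *\<^sub>R v) = a *\<^sub>R (\<i> *s (v :: complex^'n))"
  by (simp add: scaleR_eq_scale vec_eq_iff algebra_simps)

lemma ii_sum: "\<i> *s (\<Sum>i\<in>I. f i) = (\<Sum>i\<in>I. \<i> *s (f i :: complex^'n))"
  using linear_sum[OF bounded_linear.linear[OF bounded_linear_scale]] .

lemma cubic_trace: "(\<Sum>k\<in>UNIV. cubic i k k) = 0" for i :: 3
  using exhaust_3[of i] by (auto simp: sum_3 cubic_def distinct_3)

lemma cubic_3_sum:
  fixes Y :: "3 \<Rightarrow> 'a::real_vector"
  shows "(\<Sum>k\<in>UNIV. cubic i j k *\<^sub>R Y k) =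
    (if i = 1 \<and> j = 1 then Y 1 else if (i, j) \<in> {(1, 2), (2, 1)} then - Y 2
     else if i = 2 \<and> j = 2 then - Y 1 else 0)"
  using exhaust_3[of i] exhaust_3[of j] by (auto simp: sum_3 cubic_def distinct_3)

lemma cubic_4_sum:
  fixes Y :: "4 \<Rightarrow> 'a::real_vector"
  shows "(\<Sum>k\<in>UNIV. cubic i j k *\<^sub>R Y k) =
    (if i = 1 \<and> j = 1 then Y 1 else if (i, j) \<in> {(1, 2), (2, 1)} then - Y 2
     else if i = 2 \<and> j = 2 then - Y 1 else 0)"
  using exhaust_4[of i] exhaust_4[of j] by (auto simp: sum_4 cubic_def distinct_4)

text \<open>How a map is recognized as special Lagrangian with \<open>S\<^sub>3\<close>-symmetry: it suffices to know, for the fields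
  of one orthonormal frame, the normal part of the second derivative.  Up to tangent terms the second
  derivative depends only on the values of the fields, so that \<open>A\<close> is determined on constant fields as
  well, and the trace vanishes because the cubic form is trace-free.\<close>
lemma adapted_framing:
  fixes g :: "3 metric" and \<psi> :: "real^3 \<Rightarrow> complex^3" and Y :: "3 \<Rightarrow> real^3 \<Rightarrow> real^3"
  assumes imm: "smooth_immersion_on W \<psi>" and Y: "\<And>i. smooth_on W (Y i)"
    and B: "\<And>x. x \<in> W \<Longrightarrow> hermitian_form (g (\<psi> x))"
    and \<Gamma>: "\<And>x. x \<in> W \<Longrightarrow> bilinear (christoffel g (\<psi> x))"
    and orth: "\<And>x i j. x \<in> W \<Longrightarrow> g (\<psi> x) (D \<psi> x (Y i x)) (D \<psi> x (Y j x)) = (if i = j then 1 else 0)"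
    and lag: "\<And>x i j. x \<in> W \<Longrightarrow> g (\<psi> x) (D \<psi> x (Y i x)) (\<i> *s D \<psi> x (Y j x)) = 0"
    and r: "\<And>x. x \<in> W \<Longrightarrow> r x > 0"
    and cov: "\<And>x i j. x \<in> W \<Longrightarrow> \<exists>b. cov_deriv g \<psi> (Y i) (Y j) x
        = D \<psi> x b + \<i> *s D \<psi> x (r x *\<^sub>R (\<Sum>k\<in>UNIV. cubic i j k *\<^sub>R Y k x))"
  shows "special_lagrangian g W \<psi>" "adapted_frame g W \<psi> Y r"
proof -
  have W: "open W" and sm: "smooth_on W \<psi>" and inj: "\<And>x. x \<in> W \<Longrightarrow> inj (D \<psi> x)"
    using imm by (auto simp: smooth_immersion_on_def)
  have *: "(\<forall>u v. g (\<psi> x) (D \<psi> x u) (\<i> *s D \<psi> x v) = 0) \<and>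
      (\<forall>i j. sff_tensor g \<psi> (Y i) (Y j) x = r x *\<^sub>R (\<Sum>k\<in>UNIV. cubic i j k *\<^sub>R Y k x)) \<and>
      (\<forall>u. trace (matrix (\<lambda>v. sff_tensor g \<psi> (\<lambda>_. u) (\<lambda>_. v) x)) = 0)" if x: "x \<in> W" for x
  proof -
    define T where "T = D \<psi> x"
    define c where "c = (\<lambda>k v. g (\<psi> x) (T v) (T (Y k x)))"
    define a where "a = (\<lambda>i j. r x *\<^sub>R (\<Sum>k\<in>UNIV. cubic i j k *\<^sub>R Y k x))"
    note B' = hermitian_formD[OF B[OF x]]
    have T: "linear T" "inj T" using linear_D_smooth[OF sm x] inj[OF x] by (simp_all add: T_def)
    have rep: "v = (\<Sum>k\<in>UNIV. c k v *\<^sub>R Y k x)" for v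
      unfolding c_def
      by (rule orthonormal_coordinates[OF B[OF x] T]) (use orth[OF x] in \<open>simp add: T_def\<close>)
    have c: "linear (c k)" for k
      unfolding c_def by (rule linearI) (simp_all add: B' linear_add[OF T(1)] linear_cmul[OF T(1)])
    have cY: "c k (Y j x) = (if j = k then 1 else 0)" for j k
      using orth[OF x, of j k] by (simp add: c_def T_def)
    have Trep: "T v = (\<Sum>k\<in>UNIV. c k v *\<^sub>R T (Y k x))" for v
    proof -
      have "T v = T (\<Sum>k\<in>UNIV. c k v *\<^sub>R Y k x)" using rep[of v] by simp
      then show ?thesis by (simp only: linear_sum[OF T(1)] linear_cmul[OF T(1)])
    qed
    have lag': "g (\<psi> x) (T u) (\<i> *s T v) = 0" for u v
    proof -
      have "g (\<psi> x) (T u) (\<i> *s T v) = g (\<psi> x) (\<Sum>k\<in>UNIV. c k u *\<^sub>R T (Y k x)) (\<i> *s (\<Sum>k\<in>UNIV. c k v *\<^sub>R T (Y k x)))"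
        using Trep by metis
      also have "\<dots> = 0"
        using lag[OF x] by (simp add: B' ii_sum ii_scaleR T_def)
      finally show ?thesis .
    qed
    have sffI: "sff_tensor g \<psi> X Z x = a'" if "cov_deriv g \<psi> X Z x = T b' + \<i> *s T a'" for X Z a' b'
      by (rule sff_tensor_eqI[of g \<psi> x, OF B[OF x]]) (use T lag' that in \<open>simp_all add: T_def\<close>)
    have sffY: "sff_tensor g \<psi> (Y i) (Y j) x = a i j" for i j
      using cov[OF x, of i j] sffI unfolding T_def a_def by blast
    define Q where "Q = (\<lambda>u v. cov_deriv g \<psi> (\<lambda>_. u) (\<lambda>_. v) x)"
    have bil: "bilinear (christoffel g (\<psi> x))" by (rule \<Gamma>[OF x])
    have Q1: "linear (\<lambda>u. Q u v)" for v
      unfolding Q_def cov_deriv_def T_def[symmetric]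
      by (rule linearI) (simp_all add: linear_add[OF T(1)] linear_cmul[OF T(1)]
          bilinear_ladd[OF bil] bilinear_lmul[OF bil] algebra_simps
          linear_add[OF linear_D_smooth[OF smooth_D[OF sm] x]] linear_cmul[OF linear_D_smooth[OF smooth_D[OF sm] x]])
    have Q2: "linear (\<lambda>v. Q u v)" for u
      unfolding Q_def cov_deriv_def T_def[symmetric]
      by (rule linearI) (simp_all add: linear_add[OF T(1)] linear_cmul[OF T(1)]
          bilinear_radd[OF bil] bilinear_rmul[OF bil] algebra_simps
          linear_add[OF second_derivative_linear[OF W sm x]] linear_cmul[OF second_derivative_linear[OF W sm x]])
    \<comment> \<open>Replacing the frame by constant fields changes the covariant derivative by a tangent vector only.\<close>
    have "\<exists>b. Q (Y i x) (Y j x) = T b + \<i> *s T (a i j)" for i j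
    proof -
      obtain b where b: "cov_deriv g \<psi> (Y i) (Y j) x = T b + \<i> *s T (a i j)"
        using cov[OF x, of i j] unfolding T_def a_def by blast
      have "cov_deriv g \<psi> (Y i) (Y j) x = Q (Y i x) (Y j x) + T (D (Y j) x (Y i x))"
        unfolding Q_def cov_deriv_def T_def D_D_field[OF W sm Y x, of j "Y i x"] by simp
      then have "Q (Y i x) (Y j x) = T (b - D (Y j) x (Y i x)) + \<i> *s T (a i j)"
        using b by (simp add: linear_diff[OF T(1)] algebra_simps)
      then show ?thesis by blast
    qed
    then obtain b where b: "\<And>i j. Q (Y i x) (Y j x) = T (b i j) + \<i> *s T (a i j)" by metis
    define A where "A = (\<lambda>u v. \<Sum>i\<in>UNIV. \<Sum>j\<in>UNIV. (c i u * c j v) *\<^sub>R a i j)"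
    have Qrep: "Q u v = T (\<Sum>i\<in>UNIV. \<Sum>j\<in>UNIV. (c i u * c j v) *\<^sub>R b i j) + \<i> *s T (A u v)" for u v
    proof -
      have "Q u v = Q (\<Sum>i\<in>UNIV. c i u *\<^sub>R Y i x) (\<Sum>j\<in>UNIV. c j v *\<^sub>R Y j x)"
        using rep by metis
      also have "\<dots> = (\<Sum>j\<in>UNIV. \<Sum>i\<in>UNIV. (c j v * c i u) *\<^sub>R Q (Y i x) (Y j x))"
        by (simp add: linear_sum[OF Q1] linear_sum[OF Q2] linear_cmul[OF Q1] linear_cmul[OF Q2] scaleR_sum_right)
      also have "\<dots> = (\<Sum>i\<in>UNIV. \<Sum>j\<in>UNIV. (c i u * c j v) *\<^sub>R Q (Y i x) (Y j x))"
        by (subst sum.swap) (simp only: mult.commute)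
      also have "\<dots> = T (\<Sum>i\<in>UNIV. \<Sum>j\<in>UNIV. (c i u * c j v) *\<^sub>R b i j) + \<i> *s T (A u v)"
        unfolding A_def b
        by (simp add: linear_sum[OF T(1)] linear_cmul[OF T(1)] ii_sum ii_scaleR sum.distrib scaleR_add_right)
      finally show ?thesis .
    qed
    have sffc: "sff_tensor g \<psi> (\<lambda>_. u) (\<lambda>_. v) x = A u v" for u v
      using sffI Qrep unfolding Q_def by blast
    have A2: "linear (A u)" for u
      unfolding A_def
      by (rule linearI) (simp_all add: linear_add[OF c] linear_cmul[OF c] scaleR_sum_right
          algebra_simps sum.distrib)
    have "trace (matrix (\<lambda>v. sff_tensor g \<psi> (\<lambda>_. u) (\<lambda>_. v) x)) = 0" for u
    proof -
      have "trace (matrix (\<lambda>v. sff_tensor g \<psi> (\<lambda>_. u) (\<lambda>_. v) x)) = trace (matrix (A u))"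
        by (simp add: sffc)
      also have "\<dots> = (\<Sum>k\<in>UNIV. c k (A u (Y k x)))"
        using trace_via_basis[OF A2 c rep] .
      also have "\<dots> = (\<Sum>k\<in>UNIV. \<Sum>i\<in>UNIV. c i u * (r x * cubic i k k))"
        by (simp add: A_def cY if_distrib if_distribR a_def linear_sum[OF c] linear_cmul[OF c] mult.assoc cong: if_cong)
      also have "\<dots> = (\<Sum>i\<in>UNIV. c i u * (r x * (\<Sum>k\<in>UNIV. cubic i k k)))"
        by (subst sum.swap) (simp add: sum_distrib_left)
      finally show ?thesis by (simp add: cubic_trace)
    qed
    then show ?thesis using lag' sffY by (simp add: T_def a_def)
  qed
  show "special_lagrangian g W \<psi>"
    unfolding special_lagrangian_def lagrangian_immersion_def using imm * by simp
  show "adapted_frame g W \<psi> Y r"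
    unfolding adapted_frame_def using Y orth r * by (auto simp: cubic_3_sum)
qed

lemma lagrangian_decomposition:
  fixes T :: "real^'n \<Rightarrow> complex^'n" and Y :: "'n \<Rightarrow> real^'n"
  assumes T: "linear T" and F: "\<And>i j. herm (T (Y i)) (T (Y j)) = (if i = j then 1 else 0)"
  shows "v = T (\<Sum>k\<in>UNIV. Re (herm v (T (Y k))) *\<^sub>R Y k) + \<i> *s T (\<Sum>k\<in>UNIV. Im (herm v (T (Y k))) *\<^sub>R Y k)"
proof -
  have split: "z *s w = Re z *\<^sub>R w + \<i> *s (Im z *\<^sub>R w)" for z and w :: "complex^'n"
    by (simp add: vec_eq_iff complex_eq_iff)
  have "v = (\<Sum>k\<in>UNIV. herm v (T (Y k)) *s T (Y k))" by (rule unitary_expansion[where F = "\<lambda>k. T (Y k)"]) (rule F)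
  also have "\<dots> = (\<Sum>k\<in>UNIV. Re (herm v (T (Y k))) *\<^sub>R T (Y k) + \<i> *s (Im (herm v (T (Y k))) *\<^sub>R T (Y k)))"
    by (rule sum.cong[OF refl split])
  finally show ?thesis
    by (simp add: linear_sum[OF T] linear_cmul[OF T] ii_sum sum.distrib)
qed

text \<open>The hypotheses on \<open>A\<close>, rewritten as statements about derivatives of a unitary frame
  in \<open>\<complex>\<^sup>4\<close>.\<close>
lemma adapted_frame_flat:
  fixes X :: "4 \<Rightarrow> real^4 \<Rightarrow> real^4"
  assumes sl: "special_lagrangian flat_metric U f" and ad: "adapted_frame flat_metric U f X r" and x: "x \<in> U"
  shows "herm (D f x (X i x)) (D f x (X j x)) = (if i = j then 1 else 0)"
    and "Im (herm (D f x u) (D f x v)) = 0"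
    and "Im (herm (D (\<lambda>y. D f y (X j y)) x (X i x)) (D f x (X k x))) = r x * cubic i j k"
proof -
  have imm: "smooth_immersion_on U f"
    and lag: "\<And>u v. flat_metric (f x) (D f x u) (\<i> *s D f x v) = 0"
    using sl x by (auto simp: special_lagrangian_def lagrangian_immersion_def)
  have sm: "smooth_on U f" and inj: "inj (D f x)" using imm x by (auto simp: smooth_immersion_on_def)
  show im: "Im (herm (D f x u) (D f x v)) = 0" for u v
    using lag[of u v] by (simp add: flat_metric_def inner_ii_eq_Im_herm)
  have re: "Re (herm (D f x (X i x)) (D f x (X j x))) = (if i = j then 1 else 0)" for i j
    using ad x by (simp add: adapted_frame_def flat_metric_def inner_eq_Re_herm)
  show F: "herm (D f x (X i x)) (D f x (X j x)) = (if i = j then 1 else 0)" for i j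
    by (rule complex_eqI) (simp_all add: re im)
  let ?v = "D (\<lambda>y. D f y (X j y)) x (X i x)"
  note T = linear_D_smooth[OF sm x]
  have "sff_tensor flat_metric f (X i) (X j) x = (\<Sum>k\<in>UNIV. Im (herm ?v (D f x (X k x))) *\<^sub>R X k x)"
    by (rule sff_tensor_eqI[of flat_metric f x, OF hermitian_form_flat T inj lag, unfolded cov_deriv_flat])
      (rule lagrangian_decomposition[OF T F])
  moreover have "sff_tensor flat_metric f (X i) (X j) x = (\<Sum>k\<in>UNIV. (r x * cubic i j k) *\<^sub>R X k x)"
  proof -
    have "sff_tensor flat_metric f (X i) (X j) x = r x *\<^sub>R (\<Sum>k\<in>UNIV. cubic i j k *\<^sub>R X k x)"
      using ad x unfolding adapted_frame_def cubic_4_sum by auto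
    then show ?thesis by (simp add: scaleR_sum_right)
  qed
  ultimately have eq: "(\<Sum>k\<in>UNIV. Im (herm ?v (D f x (X k x))) *\<^sub>R X k x) = (\<Sum>k\<in>UNIV. (r x * cubic i j k) *\<^sub>R X k x)"
    by simp
  have coord: "Re (herm (D f x (\<Sum>k\<in>UNIV. c k *\<^sub>R X k x)) (D f x (X k x))) = c k" for c k
    by (simp add: linear_sum[OF T] linear_cmul[OF T] herm_sum_left herm_scaleR_left F if_distrib cong: if_cong)
  show "Im (herm ?v (D f x (X k x))) = r x * cubic i j k"
    using arg_cong[OF eq, of "\<lambda>w. Re (herm (D f x w) (D f x (X k x)))"] unfolding coord .
qed

section \<open>Adapted frames\<close>

text \<open>All information about the adapted frame in terms of the Hermitian product of \<open>\<complex>\<^sup>4\<close>.  The form of the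
  last conditions is preserved by rotations in the plane of \<open>Z 3\<close> and \<open>Z 4\<close>.\<close>
locale adapted_lagrangian =
  fixes U :: "(real^4) set" and f :: "real^4 \<Rightarrow> complex^4"
    and Z :: "4 \<Rightarrow> real^4 \<Rightarrow> real^4" and r :: "real^4 \<Rightarrow> real"
  assumes open_U: "open U" and smooth_f: "smooth_on U f"
    and smooth_Z: "\<And>i. smooth_on U (Z i)"
    and inj_f: "\<And>x. x \<in> U \<Longrightarrow> inj (D f x)"
    and unitary: "\<And>x i j. x \<in> U \<Longrightarrow> herm (D f x (Z i x)) (D f x (Z j x)) = (if i = j then 1 else 0)"
    and lagrangian: "\<And>x u v. x \<in> U \<Longrightarrow> Im (herm (D f x u) (D f x v)) = 0"
    and sff: "\<And>x i j k. x \<in> U \<Longrightarrow>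
      Im (herm (D (\<lambda>y. D f y (Z j y)) x (Z i x)) (D f x (Z k x))) = r x * cubic i j k"
    and r_pos: "\<And>x. x \<in> U \<Longrightarrow> r x > 0"
begin

definition F :: "4 \<Rightarrow> real^4 \<Rightarrow> complex^4" where
  "F i = (\<lambda>y. D f y (Z i y))"

definition \<theta> :: "4 \<Rightarrow> real^4 \<Rightarrow> real^4 \<Rightarrow> real" where
  "\<theta> i x v = Re (herm (D f x v) (F i x))"

text \<open>The connection forms of the Levi-Civita connection of the induced metric: by the Gauss formula, the
  tangent part of the derivative of \<open>F i\<close> is its covariant derivative.\<close>
definition \<omega> :: "4 \<Rightarrow> 4 \<Rightarrow> real^4 \<Rightarrow> real^4 \<Rightarrow> real" where
  "\<omega> i j x v = Re (herm (D (F i) x v) (F j x))"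

lemma smooth_F: "smooth_on U (F i)"
  unfolding F_def by (rule smooth_D_field[OF open_U smooth_f smooth_Z])

lemma herm_F: "x \<in> U \<Longrightarrow> herm (F i x) (F j x) = (if i = j then 1 else 0)"
  using unitary by (simp add: F_def)

lemma linear_Df: "x \<in> U \<Longrightarrow> linear (D f x)"
  using linear_D_smooth[OF smooth_f] .

lemma linear_DF: "x \<in> U \<Longrightarrow> linear (D (F i) x)"
  using linear_D_smooth[OF smooth_F] .

lemma linear_\<theta>: "x \<in> U \<Longrightarrow> linear (\<theta> i x)"
  unfolding \<theta>_def
  by (rule linearI) (simp_all add: linear_add[OF linear_Df] linear_cmul[OF linear_Df] herm_add_left herm_scaleR_left)

lemma linear_\<omega>: "x \<in> U \<Longrightarrow> linear (\<omega> i j x)"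
  unfolding \<omega>_def
  by (rule linearI) (simp_all add: linear_add[OF linear_DF] linear_cmul[OF linear_DF] herm_add_left herm_scaleR_left)

lemma Df_expansion: "x \<in> U \<Longrightarrow> D f x v = (\<Sum>k\<in>UNIV. \<theta> k x v *\<^sub>R F k x)"
proof -
  assume x: "x \<in> U"
  have "herm (D f x v) (F k x) = of_real (\<theta> k x v)" for k
    using lagrangian[OF x, of v "Z k x"] by (simp add: complex_eq_iff \<theta>_def F_def)
  then show ?thesis
    using unitary_expansion[of "\<lambda>i. F i x" "D f x v"] herm_F[OF x] by (simp add: scaleR_eq_scale)
qed

lemma expansion: "x \<in> U \<Longrightarrow> v = (\<Sum>k\<in>UNIV. \<theta> k x v *\<^sub>R Z k x)"
proof -
  assume x: "x \<in> U"
  have "D f x v = D f x (\<Sum>k\<in>UNIV. \<theta> k x v *\<^sub>R Z k x)"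
    using Df_expansion[OF x, of v]
    by (simp add: linear_sum[OF linear_Df[OF x]] linear_cmul[OF linear_Df[OF x]] F_def)
  then show ?thesis using inj_f[OF x] by (simp add: inj_eq)
qed

lemma linear_expansion:
  assumes x: "x \<in> U" and L: "linear L"
  shows "L v = (\<Sum>k\<in>UNIV. \<theta> k x v *\<^sub>R L (Z k x))"
proof -
  have "L v = L (\<Sum>k\<in>UNIV. \<theta> k x v *\<^sub>R Z k x)" using expansion[OF x, of v] by simp
  then show ?thesis by (simp only: linear_sum[OF L] linear_cmul[OF L])
qed

lemma \<theta>_Z: "x \<in> U \<Longrightarrow> \<theta> i x (Z j x) = (if i = j then 1 else 0)"
  using herm_F[of x j i] by (auto simp: \<theta>_def F_def)

lemma sff_at:
  assumes x: "x \<in> U"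
  shows "Im (herm (D (F j) x v) (F k x)) = r x * (\<Sum>i\<in>UNIV. \<theta> i x v * cubic i j k)"
proof -
  have "linear (\<lambda>v. Im (herm (D (F j) x v) (F k x)))"
    by (rule linearI) (simp_all add: linear_add[OF linear_DF[OF x]] linear_cmul[OF linear_DF[OF x]]
        herm_add_left herm_scaleR_left)
  from linear_expansion[OF x this, of v] show ?thesis
    using sff[OF x] by (simp add: F_def sum_distrib_left mult.left_commute)
qed

lemma \<omega>_skew: "x \<in> U \<Longrightarrow> \<omega> i j x v = - \<omega> j i x v"
proof -
  assume x: "x \<in> U"
  note d = smooth_differentiable[OF smooth_F x]
  have "D (\<lambda>y. herm (F i y) (F j y)) x v = 0"
    by (rule D_const_on_open[OF open_U x]) (rule herm_F)
  then have "herm (F i x) (D (F j) x v) + herm (D (F i) x v) (F j x) = 0"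
    by (simp add: D_herm[OF d d])
  then have "Re (herm (F i x) (D (F j) x v)) + Re (herm (D (F i) x v) (F j x)) = 0"
    by (metis plus_complex.sel(1) zero_complex.sel(1))
  moreover have "Re (herm (F i x) (D (F j) x v)) = Re (herm (D (F j) x v) (F i x))"
    by (subst herm_cnj) simp
  ultimately show ?thesis by (simp add: \<omega>_def)
qed

text \<open>The second fundamental form vanishes on \<open>Z 3\<close> and \<open>Z 4\<close>.\<close>
lemma DF_flat_direction:
  assumes x: "x \<in> U" and a: "a \<in> {3, 4}"
  shows "D (F a) x v = (\<Sum>k\<in>UNIV. \<omega> a k x v *\<^sub>R F k x)"
proof -
  have "Im (herm (D (F a) x v) (F k x)) = 0" for k
    using a by (auto simp: sff_at[OF x] sum_4 cubic_def distinct_4)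
  then have "herm (D (F a) x v) (F k x) = of_real (\<omega> a k x v)" for k
    by (simp add: complex_eq_iff \<omega>_def)
  then show ?thesis
    using unitary_expansion[of "\<lambda>i. F i x" "D (F a) x v"] herm_F[OF x] by (simp add: scaleR_eq_scale)
qed

text \<open>Differentiating \<open>Im (herm (D (F a) y v) (F j y)) = 0\<close> in the direction \<open>u\<close> and using that
  \<open>D (\<lambda>y. D (F a) y v) x u\<close> is symmetric in \<open>u\<close> and \<open>v\<close>.\<close>
lemma codazzi_herm:
  assumes x: "x \<in> U" and a: "a \<in> {3, 4}"
  shows "Im (herm (D (F a) x v) (D (F j) x u)) = Im (herm (D (F a) x u) (D (F j) x v))"
proof -
  have *: "Im (herm (D (F a) x v) (D (F j) x u)) + Im (herm (D (\<lambda>y. D (F a) y v) x u) (F j x)) = 0" for u v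
  proof -
    note d1 = smooth_differentiable[OF smooth_D[OF smooth_F] x]
    note d2 = smooth_differentiable[OF smooth_F x]
    have "D (\<lambda>y. Im (herm (D (F a) y v) (F j y))) x u = 0"
      by (rule D_const_on_open[OF open_U x, of _ 0]) (use a in \<open>auto simp: sff_at sum_4 cubic_def distinct_4\<close>)
    then show ?thesis
      by (simp add: D_Im[OF smooth_herm_differentiable[OF smooth_D[OF smooth_F] smooth_F x]] D_herm[OF d1 d2])
  qed
  show ?thesis
    using *[of v u] *[of u v] second_derivative_symmetric[OF open_U smooth_F x, of a v u] by simp
qed

lemma codazzi_cubic:
  assumes x: "x \<in> U" and a: "a \<in> {3, 4}"
  shows "(\<Sum>k\<in>UNIV. \<omega> a k x v * (\<Sum>i\<in>UNIV. \<theta> i x u * cubic i j k)) =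
    (\<Sum>k\<in>UNIV. \<omega> a k x u * (\<Sum>i\<in>UNIV. \<theta> i x v * cubic i j k))"
proof -
  have *: "Im (herm (D (F a) x v) (D (F j) x u)) =
      - r x * (\<Sum>k\<in>UNIV. \<omega> a k x v * (\<Sum>i\<in>UNIV. \<theta> i x u * cubic i j k))" for u v
  proof -
    have swap: "Im (herm (F k x) (D (F j) x u)) = - (r x * (\<Sum>i\<in>UNIV. \<theta> i x u * cubic i j k))" for k
      by (subst herm_cnj) (simp add: sff_at[OF x])
    have "Im (herm (D (F a) x v) (D (F j) x u)) = (\<Sum>k\<in>UNIV. \<omega> a k x v * Im (herm (F k x) (D (F j) x u)))"
      by (subst DF_flat_direction[OF x a]) (simp add: herm_sum_left herm_scaleR_left)
    then show ?thesis by (simp add: swap sum_distrib_left sum_negf mult.left_commute)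
  qed
  have "r x * (\<Sum>k\<in>UNIV. \<omega> a k x v * (\<Sum>i\<in>UNIV. \<theta> i x u * cubic i j k)) =
    r x * (\<Sum>k\<in>UNIV. \<omega> a k x u * (\<Sum>i\<in>UNIV. \<theta> i x v * cubic i j k))"
    using codazzi_herm[OF x a, of v j u] unfolding * by simp
  then show ?thesis using r_pos[OF x] by simp
qed

text \<open>The diagonal and the rotational coefficient of the shape operator of \<open>Z a\<close> on the plane spanned by
  \<open>Z 1\<close> and \<open>Z 2\<close>; \<open>\<gamma>\<close> measures the failure of this plane field to be integrable.\<close>
definition \<beta> :: "4 \<Rightarrow> real^4 \<Rightarrow> real" where "\<beta> a x = \<omega> a 1 x (Z 1 x)"
definition \<gamma> :: "4 \<Rightarrow> real^4 \<Rightarrow> real" where "\<gamma> a x = \<omega> a 2 x (Z 1 x)"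

text \<open>The matrices that are symmetric with respect to the cubic form \<open>Re z\<^sup>3\<close>, that is, for which
  \<open>C (B x, y, z)\<close> is symmetric, are the complex linear ones.  Vectors in the span of \<open>Z 3\<close> and
  \<open>Z 4\<close> do not contribute, which says that this span is autoparallel.\<close>
lemma cauchy_riemann:
  assumes x: "x \<in> U" and a: "a \<in> {3, 4}"
  shows "\<omega> a 1 x v = \<beta> a x * \<theta> 1 x v - \<gamma> a x * \<theta> 2 x v"
    and "\<omega> a 2 x v = \<gamma> a x * \<theta> 1 x v + \<beta> a x * \<theta> 2 x v"
  using codazzi_cubic[OF x a, of v "Z 1 x" 1] codazzi_cubic[OF x a, of v "Z 1 x" 2]
  by (simp_all add: sum_4 cubic_def distinct_4 \<theta>_Z[OF x] \<beta>_def \<gamma>_def algebra_simps)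

lemma smooth_\<omega>: "smooth_on U X \<Longrightarrow> smooth_on U (\<lambda>x. \<omega> i j x (X x))"
  unfolding \<omega>_def
  by (rule smooth_Re[OF open_U smooth_herm[OF open_U smooth_D_field[OF open_U smooth_F] smooth_F]])

lemma smooth_\<beta>: "smooth_on U (\<beta> a)" and smooth_\<gamma>: "smooth_on U (\<gamma> a)"
  using smooth_\<omega>[OF smooth_Z] by (simp_all add: \<beta>_def[abs_def] \<gamma>_def[abs_def])

lemma Df_lie_bracket:
  assumes x: "x \<in> U"
  shows "D f x (lie_bracket (Z i) (Z j) x) = D (F j) x (Z i x) - D (F i) x (Z j x)"
  unfolding lie_bracket_def F_def D_D_field[OF open_U smooth_f smooth_Z x]
  using second_derivative_symmetric[OF open_U smooth_f x, of "Z i x" "Z j x"]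
  by (simp add: linear_diff[OF linear_Df[OF x]])

lemma \<theta>_lie_bracket:
  assumes x: "x \<in> U" and a: "a \<in> {3, 4}"
  shows "\<theta> a x (lie_bracket (Z 1) (Z 2) x) = - 2 * \<gamma> a x"
proof -
  have "\<theta> a x (lie_bracket (Z 1) (Z 2) x) = \<omega> 2 a x (Z 1 x) - \<omega> 1 a x (Z 2 x)"
    unfolding \<theta>_def \<omega>_def Df_lie_bracket[OF x] by (simp add: herm_diff_left)
  also have "\<dots> = \<omega> a 1 x (Z 2 x) - \<omega> a 2 x (Z 1 x)"
    using \<omega>_skew[OF x, of 2 a "Z 1 x"] \<omega>_skew[OF x, of 1 a "Z 2 x"] by simp
  finally show ?thesis
    by (simp add: cauchy_riemann[OF x a] \<theta>_Z[OF x] distinct_4)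
qed

text \<open>Otherwise \<open>[Z 1, Z 2]\<close> would have no component outside the plane of \<open>Z 1\<close> and
  \<open>Z 2\<close>.\<close>
lemma \<gamma>_nonzero:
  assumes x: "x \<in> U" and "lie_bracket (Z 1) (Z 2) x \<notin> span {Z 1 x, Z 2 x}"
  shows "(\<gamma> 3 x)\<^sup>2 + (\<gamma> 4 x)\<^sup>2 > 0"
proof (rule ccontr)
  let ?b = "lie_bracket (Z 1) (Z 2) x"
  assume "\<not> (\<gamma> 3 x)\<^sup>2 + (\<gamma> 4 x)\<^sup>2 > 0"
  then have "\<gamma> 3 x = 0" "\<gamma> 4 x = 0" by (auto simp: not_less sum_power2_le_zero_iff)
  then have "?b = \<theta> 1 x ?b *\<^sub>R Z 1 x + \<theta> 2 x ?b *\<^sub>R Z 2 x"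
    using expansion[OF x, of ?b] \<theta>_lie_bracket[OF x, of 3] \<theta>_lie_bracket[OF x, of 4] by (simp add: sum_4)
  moreover have "\<theta> 1 x ?b *\<^sub>R Z 1 x + \<theta> 2 x ?b *\<^sub>R Z 2 x \<in> span {Z 1 x, Z 2 x}"
    by (intro span_add span_scale span_base) auto
  ultimately show False using assms(2) by simp
qed

text \<open>The cubic form involves only the first two indices, which such a rotation leaves alone.\<close>
lemma rotate:
  assumes c: "smooth_on U c" and s: "smooth_on U s" and cs: "\<And>x. x \<in> U \<Longrightarrow> (c x)\<^sup>2 + (s x)\<^sup>2 = 1"
  defines "Z' \<equiv> \<lambda>i x. if i = 3 then c x *\<^sub>R Z 3 x + s x *\<^sub>R Z 4 x
      else if i = 4 then c x *\<^sub>R Z 4 x - s x *\<^sub>R Z 3 x else Z i x"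
  shows "adapted_lagrangian U f Z' r"
proof -
  define R where "R = (\<lambda>(i::4) (j::4) x. if i = 3 then (if j = 3 then c x else if j = 4 then s x else 0)
      else if i = 4 then (if j = 4 then c x else if j = 3 then - s x else 0) else if i = j then 1 else 0)"
  have smR: "smooth_on U (R i j)" for i j
    unfolding R_def using c s smooth_minus[OF open_U s] smooth_const[of U "0::real"] smooth_const[of U "1::real"]
    by (cases "i = 3"; cases "i = 4"; cases "j = 3"; cases "j = 4"; cases "i = j") (simp_all add: distinct_4)
  have Z': "Z' i x = (\<Sum>j\<in>UNIV. R i j x *\<^sub>R Z j x)" for i x
    using exhaust_4[of i] by (auto simp: Z'_def R_def sum_4 distinct_4)
  have smZ': "smooth_on U (Z' i)" for i
  proof -
    have "smooth_on U (\<lambda>x. \<Sum>j\<in>UNIV. R i j x *\<^sub>R Z j x)"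
      by (intro smooth_sum smooth_scaleR open_U smR smooth_Z)
    moreover have "(\<lambda>x. \<Sum>j\<in>UNIV. R i j x *\<^sub>R Z j x) = Z' i" using Z' by (simp add: fun_eq_iff)
    ultimately show ?thesis by simp
  qed
  have FZ': "D f x (Z' i x) = (\<Sum>j\<in>UNIV. R i j x *\<^sub>R F j x)" if "x \<in> U" for i x
    unfolding Z' F_def by (simp add: linear_sum[OF linear_Df[OF that]] linear_cmul[OF linear_Df[OF that]])
  have RR: "(\<Sum>k\<in>UNIV. R i k x * R j k x) = (if i = j then 1 else 0)" if "x \<in> U" for i j x
    using exhaust_4[of i] exhaust_4[of j] cs[OF that]
    by (auto simp: R_def sum_4 distinct_4 power2_eq_square algebra_simps)
  show ?thesis
  proof (unfold_locales)
    fix x i j assume x: "x \<in> U"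
    have "herm (D f x (Z' i x)) (D f x (Z' j x)) = of_real (\<Sum>k\<in>UNIV. R i k x * R j k x)"
      by (simp add: FZ'[OF x] herm_sum_left herm_sum_right herm_scaleR_left herm_scaleR_right herm_F[OF x]
          if_distrib mult.commute cong: if_cong)
    then show "herm (D f x (Z' i x)) (D f x (Z' j x)) = (if i = j then 1 else 0)"
      by (simp add: RR[OF x])
  next
    fix x i j k assume x: "x \<in> U"
    note dF = smooth_differentiable[OF smooth_F x] and dR = smooth_differentiable[OF smR x]
    have dRF: "(\<lambda>y. R j m y *\<^sub>R F m y) differentiable (at x)" for m
      using smooth_differentiable[OF smooth_scaleR[OF open_U smR smooth_F] x] .
    have "D (\<lambda>y. D f y (Z' j y)) x = D (\<lambda>y. \<Sum>m\<in>UNIV. R j m y *\<^sub>R F m y) x"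
      by (rule D_cong_open(1)[OF open_U x]) (rule FZ')
    then have DF': "D (\<lambda>y. D f y (Z' j y)) x v = (\<Sum>m\<in>UNIV. R j m x *\<^sub>R D (F m) x v + D (R j m) x v *\<^sub>R F m x)" for v
      by (simp add: D_sum[OF dRF] D_scaleR[OF dR dF])
    have \<theta>Z': "\<theta> l x (Z' i x) = R i l x" for l
      unfolding Z' by (simp add: linear_sum[OF linear_\<theta>[OF x]] linear_cmul[OF linear_\<theta>[OF x]] \<theta>_Z[OF x]
          if_distrib cong: if_cong)
    have "Im (herm (D (\<lambda>y. D f y (Z' j y)) x (Z' i x)) (D f x (Z' k x)))
       = (\<Sum>n\<in>UNIV. \<Sum>m\<in>UNIV. R j m x * (R k n x * (r x * (\<Sum>l\<in>UNIV. R i l x * cubic l m n))))"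
      by (simp add: DF' FZ'[OF x] herm_sum_left herm_sum_right herm_scaleR_left herm_scaleR_right herm_add_left
          herm_F[OF x] sff_at[OF x] \<theta>Z' if_distrib sum_distrib_left sum.distrib algebra_simps cong: if_cong)
    also have "\<dots> = r x * (R i 1 x * R j 1 x * R k 1 x - R i 1 x * R j 2 x * R k 2 x
        - R i 2 x * R j 1 x * R k 2 x - R i 2 x * R j 2 x * R k 1 x)"
      by (simp add: sum_4 cubic_def distinct_4 algebra_simps)
    also have "\<dots> = r x * cubic i j k"
    proof -
      have R1: "R i 1 x = (if i = 1 then 1 else 0)" and R2: "R i 2 x = (if i = 2 then 1 else 0)" for i
        using exhaust_4[of i] by (auto simp: R_def distinct_4)
      show ?thesis
        using distinct_4 unfolding R1 R2 cubic_def by auto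
    qed
    finally show "Im (herm (D (\<lambda>y. D f y (Z' j y)) x (Z' i x)) (D f x (Z' k x))) = r x * cubic i j k" .
  qed (fact open_U smooth_f smZ' | rule inj_f lagrangian r_pos; assumption)+
qed

end

section \<open>The conical direction\<close>

context adapted_lagrangian
begin

text \<open>The shape operator of a hypersurface is symmetric: here for an integral manifold \<open>i\<close> with normal
  \<open>F 4\<close>, by differentiating the orthogonality of \<open>F 4\<close> and the tangent vectors of \<open>f \<circ> i\<close>.\<close>
lemma tangent_to_leaf_imp_symmetric:
  assumes "open S" and i: "smooth_on S i" and iS: "i ` S \<subseteq> U"
    and perp: "\<And>s u. s \<in> S \<Longrightarrow> \<theta> 4 (i s) (D i s u) = 0" and s: "s \<in> S"
  shows "Re (herm (D f (i s) (D i s u)) (D (F 4) (i s) (D i s w)))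
    = Re (herm (D f (i s) (D i s w)) (D (F 4) (i s) (D i s u)))"
proof -
  define m where "m = (\<lambda>s. f (i s))"
  define N where "N = (\<lambda>s. F 4 (i s))"
  have m: "smooth_on S m" unfolding m_def by (rule smooth_compose[OF assms(1) open_U iS i smooth_f])
  have N: "smooth_on S N" unfolding N_def by (rule smooth_compose[OF assms(1) open_U iS i smooth_F])
  have Dm: "D m s u = D f (i s) (D i s u)" if "s \<in> S" for s u
    unfolding m_def using smooth_differentiable[OF i that] smooth_differentiable[OF smooth_f, of "i s"] iS that
    by (intro D_compose) auto
  have DN: "D N s u = D (F 4) (i s) (D i s u)" if "s \<in> S" for s u
    unfolding N_def using smooth_differentiable[OF i that] smooth_differentiable[OF smooth_F, of "i s"] iS that
    by (intro D_compose) auto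
  have *: "Re (herm (D m s u) (D N s w)) + Re (herm (D (\<lambda>s. D m s u) s w) (N s)) = 0" for u w
  proof -
    have "D (\<lambda>s. Re (herm (D m s u) (N s))) s w = 0"
      by (rule D_const_on_open[OF assms(1) s, of _ 0]) (use perp in \<open>simp add: Dm N_def \<theta>_def\<close>)
    then show ?thesis
      by (simp add: D_Re[OF smooth_herm_differentiable[OF smooth_D[OF m] N s]]
          D_herm[OF smooth_differentiable[OF smooth_D[OF m] s] smooth_differentiable[OF N s]])
  qed
  have "Re (herm (D m s u) (D N s w)) = Re (herm (D m s w) (D N s u))"
    using *[of u w] *[of w u] second_derivative_symmetric[OF assms(1) m s, of u w] by simp
  then show ?thesis by (simp add: Dm[OF s] DN[OF s])
qed

text \<open>If \<open>\<gamma> 4 = 0\<close>, the distribution is the orthogonal complement of \<open>Z 4\<close>.  By the symmetry of the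
  shape operator \<open>\<omega> 4 3\<close> takes on \<open>Z k\<close> the value of \<open>\<omega> 4 k\<close> on \<open>Z 3\<close>, which is zero
  by \<open>cauchy_riemann\<close>.\<close>
lemma integrable_imp_\<omega>_zero:
  assumes \<gamma>4: "\<And>x. x \<in> U \<Longrightarrow> \<gamma> 4 x = 0" and \<gamma>3: "\<And>x. x \<in> U \<Longrightarrow> \<gamma> 3 x \<noteq> 0"
    and int: "integrable_distribution_on TYPE(real^3) U
        (\<lambda>x. span {Z 1 x, Z 2 x, lie_bracket (Z 1) (Z 2) x})" and x: "x \<in> U"
  shows "\<omega> 4 3 x (Z 1 x) = 0" "\<omega> 4 3 x (Z 2 x) = 0"
proof -
  let ?b = "\<lambda>x. lie_bracket (Z 1) (Z 2) x"
  let ?E = "\<lambda>x. span {Z 1 x, Z 2 x, ?b x}"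
  have perp: "\<theta> 4 y v = 0" if y: "y \<in> U" and v: "v \<in> ?E y" for y v
  proof -
    have "\<theta> 4 y (?b y) = 0" using \<theta>_lie_bracket[OF y, of 4] \<gamma>4[OF y] by simp
    then have "\<And>w. w \<in> {Z 1 y, Z 2 y, ?b y} \<Longrightarrow> \<theta> 4 y w = 0" by (auto simp: \<theta>_Z[OF y] distinct_4)
    then show ?thesis using linear_eq_0_on_span[OF linear_\<theta>[OF y] _ v] by blast
  qed
  have Z3: "Z 3 x \<in> ?E x"
  proof -
    have "?b x = \<theta> 1 x (?b x) *\<^sub>R Z 1 x + \<theta> 2 x (?b x) *\<^sub>R Z 2 x + (- 2 * \<gamma> 3 x) *\<^sub>R Z 3 x"
      using expansion[OF x, of "?b x"] \<theta>_lie_bracket[OF x, of 3] \<theta>_lie_bracket[OF x, of 4] \<gamma>4[OF x]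
      by (simp add: sum_4)
    then have "(- 2 * \<gamma> 3 x) *\<^sub>R Z 3 x = ?b x - \<theta> 1 x (?b x) *\<^sub>R Z 1 x - \<theta> 2 x (?b x) *\<^sub>R Z 2 x"
      by (simp add: algebra_simps)
    moreover have "?b x - \<theta> 1 x (?b x) *\<^sub>R Z 1 x - \<theta> 2 x (?b x) *\<^sub>R Z 2 x \<in> ?E x"
      by (intro span_diff span_scale span_base) auto
    ultimately have "(1 / (- 2 * \<gamma> 3 x)) *\<^sub>R ((- 2 * \<gamma> 3 x) *\<^sub>R Z 3 x) \<in> ?E x"
      by (metis span_scale)
    then show ?thesis using \<gamma>3[OF x] by simp
  qed
  obtain S :: "(real^3) set" and i where Si: "smooth_immersion_on S i \<and> x \<in> i ` S \<and> i ` S \<subseteq> U \<and>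
      (\<forall>s\<in>S. range (D i s) = ?E (i s))"
    using bspec[OF int[unfolded integrable_distribution_on_def] x] by (elim exE) (rule that)
  then have S: "smooth_immersion_on S i" "x \<in> i ` S" "i ` S \<subseteq> U"
    and ran: "\<And>s. s \<in> S \<Longrightarrow> range (D i s) = ?E (i s)" by blast+
  have opS: "open S" and smi: "smooth_on S i" using S(1) by (auto simp: smooth_immersion_on_def)
  obtain s where s: "s \<in> S" "x = i s" using S(2) by blast
  have perpS: "\<theta> 4 (i s) (D i s u) = 0" if "s \<in> S" for s u
    using perp[of "i s" "D i s u"] S(3) ran[OF that] that by blast
  have sym: "Re (herm (D f x a) (D (F 4) x b)) = Re (herm (D f x b) (D (F 4) x a))"
    if "a \<in> ?E x" "b \<in> ?E x" for a b
  proof -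
    have "?E x = range (D i s)" using ran[OF s(1)] unfolding s(2) by simp
    then have "a \<in> range (D i s)" "b \<in> range (D i s)" using that by simp_all
    then obtain u w where "a = D i s u" "b = D i s w" by blast
    then show ?thesis using tangent_to_leaf_imp_symmetric[OF opS smi S(3) perpS s(1), of u w] s(2) by simp
  qed
  have swap: "Re (herm (D f x (Z i x)) (D (F 4) x v)) = \<omega> 4 i x v" for i v
    unfolding \<omega>_def F_def[symmetric] by (subst herm_cnj) (simp add: F_def)
  have "Z 1 x \<in> ?E x" "Z 2 x \<in> ?E x" by (simp_all add: span_base)
  then have "\<omega> 4 3 x (Z 1 x) = \<omega> 4 1 x (Z 3 x)" "\<omega> 4 3 x (Z 2 x) = \<omega> 4 2 x (Z 3 x)"
    using sym[OF Z3, of "Z 1 x"] sym[OF Z3, of "Z 2 x"] unfolding swap by simp_all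
  then show "\<omega> 4 3 x (Z 1 x) = 0" "\<omega> 4 3 x (Z 2 x) = 0"
    by (simp_all add: cauchy_riemann[OF x, of 4] \<theta>_Z[OF x] distinct_4)
qed

end

text \<open>The frame after rotation, with \<open>Z 4\<close> normal to the integrable distribution of rank three.\<close>
locale conical_lagrangian = adapted_lagrangian +
  assumes \<gamma>4: "\<And>x. x \<in> U \<Longrightarrow> \<gamma> 4 x = 0" and \<gamma>3: "\<And>x. x \<in> U \<Longrightarrow> \<gamma> 3 x \<noteq> 0"
    and \<omega>43_1: "\<And>x. x \<in> U \<Longrightarrow> \<omega> 4 3 x (Z 1 x) = 0"
    and \<omega>43_2: "\<And>x. x \<in> U \<Longrightarrow> \<omega> 4 3 x (Z 2 x) = 0"
begin

lemma smooth_\<beta>4: "smooth_on U (\<beta> 4)"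
  by (rule smooth_\<beta>)

lemma \<omega>4_12:
  assumes "x \<in> U" "k \<in> {1, 2}"
  shows "\<omega> 4 k x v = \<beta> 4 x * \<theta> k x v"
  using assms cauchy_riemann[OF assms(1), of 4 v] \<gamma>4[OF assms(1)] by auto

lemma DF4_minus:
  assumes x: "x \<in> U"
  shows "D (F 4) x v - \<beta> 4 x *\<^sub>R D f x v
    = (\<omega> 4 3 x v - \<beta> 4 x * \<theta> 3 x v) *\<^sub>R F 3 x - (\<beta> 4 x * \<theta> 4 x v) *\<^sub>R F 4 x"
proof -
  have "\<omega> 4 4 x v = 0" using \<omega>_skew[OF x, of 4 4 v] by simp
  then show ?thesis
    unfolding DF_flat_direction[OF x, of 4, simplified] Df_expansion[OF x, of v]
    by (simp add: sum_4 \<omega>4_12[OF x] algebra_simps)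
qed

text \<open>The form \<open>D (F 4) - \<beta> 4 df\<close> is orthogonal to \<open>F 1\<close> and \<open>F 2\<close>.  Differentiating this and
  antisymmetrizing removes the second derivatives of \<open>F 4\<close> and of \<open>f\<close> and leaves an equation
  between first derivatives.\<close>
lemma flatness:
  assumes x: "x \<in> U" and k: "k \<in> {1, 2}"
  defines "S \<equiv> \<lambda>u v. - (\<omega> 4 3 x v - \<beta> 4 x * \<theta> 3 x v) * \<omega> 3 k x u + (\<beta> 4 x)\<^sup>2 * \<theta> 4 x v * \<theta> k x u"
  shows "S u v - S v u = D (\<beta> 4) x u * \<theta> k x v - D (\<beta> 4) x v * \<theta> k x u"
proof -
  let ?H = "\<lambda>v y. D (F 4) y v - \<beta> 4 y *\<^sub>R D f y v"
  have smH: "smooth_on U (?H v)" for v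
    by (intro smooth_diff smooth_scaleR open_U smooth_D smooth_F smooth_f smooth_\<beta>)
  have S: "S u v = Re (herm (?H v x) (D (F k) x u))" for u v
  proof -
    have 1: "Re (herm (F j x) (D (F k) x u)) = - \<omega> j k x u" for j
      using \<omega>_skew[OF x, of k j u] by (subst herm_cnj) (simp add: \<omega>_def)
    have "Re (herm (?H v x) (D (F k) x u)) = (\<omega> 4 3 x v - \<beta> 4 x * \<theta> 3 x v) * Re (herm (F 3 x) (D (F k) x u))
        - \<beta> 4 x * \<theta> 4 x v * Re (herm (F 4 x) (D (F k) x u))"
      unfolding DF4_minus[OF x] by (simp add: herm_diff_left herm_scaleR_left)
    then show ?thesis
      unfolding 1 S_def \<omega>4_12[OF x k] by (simp add: power2_eq_square algebra_simps)
  qed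
  have *: "S u v + Re (herm (D (?H v) x u) (F k x)) = 0" for u v
  proof -
    have "Re (herm (?H v y) (F k y)) = 0" if "y \<in> U" for y
      using \<omega>4_12[OF that k, of v] by (simp add: herm_diff_left herm_scaleR_left \<omega>_def \<theta>_def)
    then have "D (\<lambda>y. Re (herm (?H v y) (F k y))) x u = 0"
      by (intro D_const_on_open[OF open_U x, of _ 0])
    then show ?thesis
      by (simp add: S D_Re[OF smooth_herm_differentiable[OF smH smooth_F x]]
          D_herm[OF smooth_differentiable[OF smH x] smooth_differentiable[OF smooth_F x]])
  qed
  have DH: "D (?H v) x u = D (\<lambda>y. D (F 4) y v) x u
      - (\<beta> 4 x *\<^sub>R D (\<lambda>y. D f y v) x u + D (\<beta> 4) x u *\<^sub>R D f x v)" for u v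
    using smooth_differentiable[OF smooth_D[OF smooth_F] x, of 4 v]
      smooth_differentiable[OF smooth_scaleR[OF open_U smooth_\<beta> smooth_D[OF smooth_f]] x, of 4 v]
      smooth_differentiable[OF smooth_D[OF smooth_f] x, of v] smooth_differentiable[OF smooth_\<beta> x, of 4]
    by (simp add: D_diff D_scaleR)
  show ?thesis
    using *[of u v] *[of v u] second_derivative_symmetric[OF open_U smooth_F x, of 4 u v]
      second_derivative_symmetric[OF open_U smooth_f x, of u v]
    unfolding DH by (simp add: herm_diff_left herm_add_left herm_scaleR_left \<theta>_def)
qed

text \<open>The equation \<open>flatness\<close>, evaluated on pairs of frame vectors.  The coefficient \<open>\<gamma> 3\<close> enters with
  \<open>k = 2\<close>, and its non-vanishing gives the two statements about \<open>\<omega> 4 3\<close>; the other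
  equations then determine the derivative of \<open>\<beta> 4\<close>.\<close>
lemma conical_at:
  assumes x: "x \<in> U"
  shows "D (\<beta> 4) x (Z 1 x) = 0" "D (\<beta> 4) x (Z 2 x) = 0" "D (\<beta> 4) x (Z 3 x) = 0"
    "D (\<beta> 4) x (Z 4 x) = - (\<beta> 4 x)\<^sup>2" "\<omega> 4 3 x (Z 3 x) = \<beta> 4 x" "\<omega> 4 3 x (Z 4 x) = 0"
proof -
  note simps = \<theta>_Z[OF x] distinct_4 \<omega>43_1[OF x] \<omega>43_2[OF x] cauchy_riemann[OF x, of 3]
  show "D (\<beta> 4) x (Z 1 x) = 0" "D (\<beta> 4) x (Z 2 x) = 0"
    using flatness[OF x, of 1 "Z 1 x" "Z 2 x"] flatness[OF x, of 2 "Z 1 x" "Z 2 x"] by (simp_all add: simps)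
  have "(\<omega> 4 3 x (Z 3 x) - \<beta> 4 x) * \<gamma> 3 x = 0"
    using flatness[OF x, of 2 "Z 1 x" "Z 3 x"] by (auto simp: simps)
  then show 1: "\<omega> 4 3 x (Z 3 x) = \<beta> 4 x" using \<gamma>3[OF x] by auto
  show "D (\<beta> 4) x (Z 3 x) = 0"
    using flatness[OF x, of 1 "Z 1 x" "Z 3 x"] by (simp add: simps 1)
  have "\<omega> 4 3 x (Z 4 x) * \<gamma> 3 x = 0"
    using flatness[OF x, of 2 "Z 1 x" "Z 4 x"] by (simp add: simps)
  then show 2: "\<omega> 4 3 x (Z 4 x) = 0" using \<gamma>3[OF x] by simp
  show "D (\<beta> 4) x (Z 4 x) = - (\<beta> 4 x)\<^sup>2"
    using flatness[OF x, of 1 "Z 1 x" "Z 4 x"] by (simp add: simps 2)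
qed

text \<open>This is how the unit radial field of a cone behaves, with \<open>1 / \<beta> 4\<close> as the signed distance from the vertex;
  \<open>\<beta> 4 = 0\<close> is the case of a product.\<close>
lemma D_F4:
  assumes x: "x \<in> U"
  shows "D (F 4) x v = \<beta> 4 x *\<^sub>R (D f x v - \<theta> 4 x v *\<^sub>R F 4 x)"
proof -
  have "\<omega> 4 3 x v = \<beta> 4 x * \<theta> 3 x v"
    using linear_expansion[OF x linear_\<omega>[OF x], of 4 3 v] conical_at[OF x] \<omega>43_1[OF x] \<omega>43_2[OF x]
    by (simp add: sum_4)
  then show ?thesis using DF4_minus[OF x, of v] by (simp add: algebra_simps)
qed

lemma D_\<beta>4:
  assumes x: "x \<in> U"
  shows "D (\<beta> 4) x v = - (\<beta> 4 x)\<^sup>2 * \<theta> 4 x v"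
  using linear_expansion[OF x linear_D_smooth[OF smooth_\<beta>4 x], of v] conical_at[OF x]
  by (simp add: sum_4)

end

text \<open>The rotation takes \<open>(\<gamma> 3, \<gamma> 4)\<close> to \<open>(\<rho>, 0)\<close>, because these coefficients
  depend linearly on the vector \<open>Z a\<close>.\<close>
lemma conical_frame_exists:
  fixes U :: "(real^4) set" and f :: "real^4 \<Rightarrow> complex^4"
    and X :: "4 \<Rightarrow> real^4 \<Rightarrow> real^4" and r :: "real^4 \<Rightarrow> real"
  assumes sl: "special_lagrangian flat_metric U f" and ad: "adapted_frame flat_metric U f X r"
    and nonint: "\<And>x. x \<in> U \<Longrightarrow> lie_bracket (X 1) (X 2) x \<notin> span {X 1 x, X 2 x}"
    and int: "integrable_distribution_on TYPE(real^3) U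
           (\<lambda>x. span {X 1 x, X 2 x, lie_bracket (X 1) (X 2) x})"
  shows "\<exists>Z. conical_lagrangian U f Z r"
proof -
  have imm: "smooth_immersion_on U f"
    using sl by (simp add: special_lagrangian_def lagrangian_immersion_def)
  interpret A: adapted_lagrangian U f X r
  proof
    show "open U" "smooth_on U f" "\<And>x. x \<in> U \<Longrightarrow> inj (D f x)"
      using imm by (auto simp: smooth_immersion_on_def)
    show "smooth_on U (X i)" for i using ad by (simp add: adapted_frame_def)
    show "0 < r x" if "x \<in> U" for x using ad that by (simp add: adapted_frame_def)
  qed (use adapted_frame_flat[OF sl ad] in auto)
  define \<rho> where "\<rho> = (\<lambda>x. sqrt ((A.\<gamma> 3 x)\<^sup>2 + (A.\<gamma> 4 x)\<^sup>2))"
  have pos: "(A.\<gamma> 3 x)\<^sup>2 + (A.\<gamma> 4 x)\<^sup>2 > 0" if "x \<in> U" for x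
    using A.\<gamma>_nonzero[OF that nonint[OF that]] .
  then have \<rho>: "\<rho> x > 0" "(\<rho> x)\<^sup>2 = (A.\<gamma> 3 x)\<^sup>2 + (A.\<gamma> 4 x)\<^sup>2" if "x \<in> U" for x
    using pos[OF that] by (simp_all add: \<rho>_def)
  have sm\<rho>: "smooth_on U \<rho>"
    unfolding \<rho>_def power2_eq_square
    by (rule smooth_sqrt[OF A.open_U])
      (use pos in \<open>auto simp: power2_eq_square intro!: smooth_add smooth_mult A.open_U A.smooth_\<gamma>\<close>)
  define c where "c = (\<lambda>x. A.\<gamma> 3 x / \<rho> x)"
  define s where "s = (\<lambda>x. A.\<gamma> 4 x / \<rho> x)"
  have cs: "smooth_on U c" "smooth_on U s"
    unfolding c_def s_def using smooth_divide[OF A.open_U A.smooth_\<gamma> sm\<rho>] \<rho>(1) by (metis less_irrefl)+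
  have cs1: "(c x)\<^sup>2 + (s x)\<^sup>2 = 1" if "x \<in> U" for x
    unfolding c_def s_def power_divide add_divide_distrib[symmetric] \<rho>(2)[OF that, symmetric]
    using \<rho>(1)[OF that] by simp
  define Z where "Z = (\<lambda>i x. if i = 3 then c x *\<^sub>R X 3 x + s x *\<^sub>R X 4 x
      else if i = 4 then c x *\<^sub>R X 4 x - s x *\<^sub>R X 3 x else X i x)"
  interpret B: adapted_lagrangian U f Z r
    unfolding Z_def by (rule A.rotate[OF cs cs1])
  have Z: "Z 1 = X 1" "Z 2 = X 2" "Z 3 = (\<lambda>x. c x *\<^sub>R X 3 x + s x *\<^sub>R X 4 x)"
    "Z 4 = (\<lambda>x. c x *\<^sub>R X 4 x - s x *\<^sub>R X 3 x)"
    by (simp_all add: Z_def fun_eq_iff distinct_4)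
  have F12: "B.F 1 = A.F 1" "B.F 2 = A.F 2" by (simp_all add: A.F_def B.F_def Z)
  have comb: "Re (herm (D (\<lambda>y. p y *\<^sub>R A.F 3 y + q y *\<^sub>R A.F 4 y) x v) (A.F 2 x))
      = p x * A.\<omega> 3 2 x v + q x * A.\<omega> 4 2 x v"
    if x: "x \<in> U" and p: "smooth_on U p" and q: "smooth_on U q" for x v p q
  proof -
    note d = smooth_differentiable[OF smooth_scaleR[OF A.open_U p A.smooth_F] x]
      smooth_differentiable[OF smooth_scaleR[OF A.open_U q A.smooth_F] x]
      smooth_differentiable[OF p x] smooth_differentiable[OF q x] smooth_differentiable[OF A.smooth_F x]
    show ?thesis
      by (simp add: D_add[OF d(1,2)] D_scaleR[OF d(3,5)] D_scaleR[OF d(4,5)] herm_add_left herm_scaleR_left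
          A.herm_F[OF x] distinct_4 A.\<omega>_def)
  qed
  have Fc: "B.F 3 x = c x *\<^sub>R A.F 3 x + s x *\<^sub>R A.F 4 x" "B.F 4 x = (- s x) *\<^sub>R A.F 3 x + c x *\<^sub>R A.F 4 x"
    if "x \<in> U" for x
    using linear_add[OF A.linear_Df[OF that]] linear_diff[OF A.linear_Df[OF that]] linear_cmul[OF A.linear_Df[OF that]]
    by (simp_all add: A.F_def B.F_def Z)
  have g3: "B.\<gamma> 3 x = c x * A.\<gamma> 3 x + s x * A.\<gamma> 4 x" if x: "x \<in> U" for x
  proof -
    have "D (B.F 3) x = D (\<lambda>y. c y *\<^sub>R A.F 3 y + s y *\<^sub>R A.F 4 y) x"
      by (rule D_cong_open(1)[OF A.open_U x]) (rule Fc)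
    then show ?thesis
      unfolding B.\<gamma>_def B.\<omega>_def F12 Z using comb[OF x cs] by (simp add: A.\<gamma>_def)
  qed
  have g4: "B.\<gamma> 4 x = - s x * A.\<gamma> 3 x + c x * A.\<gamma> 4 x" if x: "x \<in> U" for x
  proof -
    have "D (B.F 4) x = D (\<lambda>y. (- s y) *\<^sub>R A.F 3 y + c y *\<^sub>R A.F 4 y) x"
      by (rule D_cong_open(1)[OF A.open_U x]) (rule Fc)
    then show ?thesis
      unfolding B.\<gamma>_def B.\<omega>_def F12 Z using comb[OF x smooth_minus[OF A.open_U cs(2)] cs(1)]
      by (simp add: A.\<gamma>_def)
  qed
  have B4: "B.\<gamma> 4 x = 0" if "x \<in> U" for x
    unfolding g4[OF that] by (simp add: c_def s_def)
  have B3: "B.\<gamma> 3 x \<noteq> 0" if x: "x \<in> U" for x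
  proof -
    have "B.\<gamma> 3 x * \<rho> x = (\<rho> x)\<^sup>2"
      unfolding g3[OF x] \<rho>(2)[OF x] using \<rho>(1)[OF x] by (simp add: c_def s_def power2_eq_square field_simps)
    then show ?thesis using \<rho>(1)[OF x] by auto
  qed
  have int': "integrable_distribution_on TYPE(real^3) U
        (\<lambda>x. span {Z 1 x, Z 2 x, lie_bracket (Z 1) (Z 2) x})"
    using int by (simp add: Z)
  have "conical_lagrangian U f Z r"
    by unfold_locales (use B4 B3 B.integrable_imp_\<omega>_zero[OF B4 B3 int'] in auto)
  then show ?thesis by (rule exI[of _ Z])
qed

section \<open>Splitting off the conical direction\<close>

text \<open>Along the segment \<open>b\<close> satisfies a linear ordinary differential equation \<open>b' = b k\<close>; with an
  antiderivative \<open>H\<close> of \<open>k\<close>, the function \<open>b exp (- H)\<close> is constant.\<close>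
lemma linear_ode_zero:
  fixes b :: "'a::euclidean_space \<Rightarrow> real"
  assumes b: "smooth_on U b" and k: "\<And>v. continuous_on U (\<lambda>x. k x v)"
    and D: "\<And>x v. x \<in> U \<Longrightarrow> D b x v = b x * k x v"
    and seg: "closed_segment p x \<subseteq> U" and p: "b p = 0"
  shows "b x = 0"
proof -
  define c where "c = (\<lambda>s. p + s *\<^sub>R (x - p))"
  have c: "c s \<in> U" if "s \<in> {0..1}" for s
  proof -
    have "c s \<in> closed_segment p x"
      using that unfolding in_segment c_def by (intro exI[of _ s]) (simp add: algebra_simps)
    then show ?thesis using seg by blast
  qed
  have contc: "continuous_on {0..1} c" unfolding c_def by (intro continuous_intros)
  have contk: "continuous_on {0..1} (\<lambda>s. k (c s) (x - p))"
    by (rule continuous_on_compose2[OF k contc]) (use c in auto)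
  obtain H where H: "\<And>s. s \<in> {0..1} \<Longrightarrow> (H has_vector_derivative k (c s) (x - p)) (at s within {0..1})"
    using antiderivative_continuous[OF contk] by blast
  have der: "((\<lambda>s. b (c s) * exp (- H s)) has_field_derivative 0) (at s within {0..1})" if s: "s \<in> {0..1}" for s
  proof -
    have 1: "((\<lambda>s. b (p + s *\<^sub>R (x - p) + 0)) has_real_derivative D b (p + s *\<^sub>R (x - p) + 0) (x - p)) (at s)"
      by (rule DERIV_along_line[OF b]) (use c[OF s] in \<open>simp add: c_def\<close>)
    have 2: "((\<lambda>s. b (c s)) has_field_derivative b (c s) * k (c s) (x - p)) (at s within {0..1})"
      using has_field_derivative_at_within[OF 1] D[OF c[OF s], of "x - p"] by (simp add: c_def)
    have 3: "(H has_field_derivative k (c s) (x - p)) (at s within {0..1})"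
      using H[OF s] by (simp add: has_real_derivative_iff_has_vector_derivative)
    show ?thesis
      by (rule derivative_eq_intros 2 3 | simp)+
  qed
  obtain d where d: "\<And>s. s \<in> {0..1} \<Longrightarrow> b (c s) * exp (- H s) = d"
    using has_field_derivative_zero_constant[OF _ der] by (metis convex_real_interval(5))
  have "b (c 1) * exp (- H 1) = b (c 0) * exp (- H 0)" using d[of 0] d[of 1] by simp
  then show ?thesis using p by (simp add: c_def)
qed

lemma constant_on_convex:
  assumes "convex S" "\<And>x. x \<in> S \<Longrightarrow> f differentiable (at x)" "\<And>x v. x \<in> S \<Longrightarrow> D f x v = 0"
    and "x \<in> S" "y \<in> S"
  shows "f x = f y"
proof -
  have "(f has_derivative (\<lambda>v. 0)) (at x within S)" if "x \<in> S" for x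
  proof -
    have "D f x = (\<lambda>v. 0)" using assms(3)[OF that] by (simp add: fun_eq_iff)
    then show ?thesis using has_derivative_at_withinI[OF D_works[OF assms(2)[OF that]]] by simp
  qed
  then obtain c where "\<And>x. x \<in> S \<Longrightarrow> f x = c" using has_derivative_zero_constant[OF assms(1)] by metis
  then show ?thesis using assms(4,5) by simp
qed

text \<open>The frame indices that remain when the direction \<open>Z 4\<close> is split off.\<close>
definition emb :: "3 \<Rightarrow> 4" where "emb i = (if i = 1 then 1 else if i = 2 then 2 else 3)"

lemma emb_simps [simp]: "emb 1 = 1" "emb 2 = 2" "emb 3 = 3" "emb i = emb j \<longleftrightarrow> i = j" "emb i \<noteq> 4" "4 \<noteq> emb i"
  using exhaust_3[of i] exhaust_3[of j] by (auto simp: emb_def distinct_3 distinct_4)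

lemma cubic_emb: "cubic (emb i) (emb j) (emb k) = cubic i j k"
proof -
  have "emb l = 1 \<longleftrightarrow> l = 1" "emb l = 2 \<longleftrightarrow> l = 2" for l
    using emb_simps(4)[of l 1] emb_simps(4)[of l 2] by simp_all
  then show ?thesis by (simp add: cubic_def)
qed

lemma sum_4_emb: "(\<Sum>k\<in>UNIV. g k) = (\<Sum>k\<in>UNIV. g (emb k)) + g 4"
  for g :: "4 \<Rightarrow> 'a::ab_group_add"
  by (simp add: sum_4 sum_3)

text \<open>The two cases are treated together.  In both of them \<open>f\<close> is recovered from a function \<open>t\<close> that
  increases along \<open>\<epsilon> Z 4\<close> with unit speed and a map \<open>q\<close> that is constant along \<open>Z 4\<close>.  For a
  product, \<open>q\<close> is the projection of \<open>f\<close> along the line and \<open>\<kappa> = \<epsilon> = 1\<close>; for a cone,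
  \<open>q = \<epsilon> F 4\<close> is the radial projection to the unit sphere and \<open>\<kappa> = 1 / t\<close>, where the sign \<open>\<epsilon>\<close>
  turns \<open>F 4\<close> away from the vertex.\<close>
locale product_lagrangian = adapted_lagrangian +
  fixes t :: "real^4 \<Rightarrow> real" and q :: "real^4 \<Rightarrow> complex^4" and \<kappa> :: "real^4 \<Rightarrow> real" and \<epsilon> :: real
  assumes smooth_t: "smooth_on U t" and smooth_q: "smooth_on U q" and \<epsilon>: "\<epsilon> * \<epsilon> = 1"
    and D_t: "\<And>x v. x \<in> U \<Longrightarrow> D t x v = \<epsilon> * \<theta> 4 x v"
    and D_q: "\<And>x v. x \<in> U \<Longrightarrow> D q x v = \<kappa> x *\<^sub>R (D f x v - \<theta> 4 x v *\<^sub>R F 4 x)"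
    and \<kappa>_pos: "\<And>x. x \<in> U \<Longrightarrow> \<kappa> x > 0"
    and \<kappa>_t: "\<And>x y. x \<in> U \<Longrightarrow> y \<in> U \<Longrightarrow> t x = t y \<Longrightarrow> \<kappa> x = \<kappa> y"
begin

text \<open>Since \<open>q\<close> is an immersion transversally to \<open>Z 4\<close>, with tangent space spanned by the other
  three frame vectors, their real coordinates at \<open>p\<close> serve as coordinates of the slice.\<close>
definition w :: "real^4 \<Rightarrow> real^4 \<Rightarrow> real^3" where
  "w p x = (\<chi> j. Re (herm (q x) (F (emb j) p)))"

lemma smooth_w: "smooth_on U (w p)"
proof (rule smooth_vecI[OF open_U])
  show "smooth_on U (\<lambda>x. w p x $ j)" for j
    unfolding w_def
    using smooth_Re[OF open_U smooth_herm[OF open_U smooth_q smooth_const, of "F (emb j) p"]] by simp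
qed

lemma D_w: "x \<in> U \<Longrightarrow> D (w p) x v $ j = Re (herm (D q x v) (F (emb j) p))"
proof -
  assume x: "x \<in> U"
  have "D (w p) x v $ j = D (\<lambda>x. w p x $ j) x v"
    using D_linear_compose[OF bounded_linear_vec_nth smooth_differentiable[OF smooth_w x]] by metis
  also have "\<dots> = D (\<lambda>x. Re (herm (q x) (F (emb j) p))) x v" by (simp add: w_def)
  also have "\<dots> = Re (herm (D q x v) (F (emb j) p))"
    by (simp add: D_Re[OF smooth_herm_differentiable[OF smooth_q smooth_const x]]
        D_herm[OF smooth_differentiable[OF smooth_q x]])
  finally show ?thesis .
qed

lemma D_q_Z4: "x \<in> U \<Longrightarrow> D q x (Z 4 x) = 0"
  by (simp add: D_q \<theta>_Z F_def)

lemma D_w_Z4: "x \<in> U \<Longrightarrow> D (w p) x (Z 4 x) = 0"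
  by (simp add: vec_eq_iff D_w D_q_Z4)

lemma chart_injective:
  assumes p: "p \<in> U" and "D t p v = 0" "D (w p) p v = 0"
  shows "v = 0"
proof -
  have "\<epsilon> \<noteq> 0" using \<epsilon> by auto
  then have 4: "\<theta> 4 p v = 0" using assms(2) by (simp add: D_t[OF p])
  have "\<theta> (emb j) p v = 0" for j
  proof -
    have "D (w p) p v $ j = \<kappa> p * Re (herm (D f p v) (F (emb j) p))"
      by (simp add: D_w[OF p] D_q[OF p] 4 herm_scaleR_left)
    then have "D (w p) p v $ j = \<kappa> p * \<theta> (emb j) p v" by (simp add: \<theta>_def)
    then show ?thesis using assms(3) \<kappa>_pos[OF p] by simp
  qed
  then show ?thesis using expansion[OF p, of v] 4 by (simp add: sum_4_emb)
qed

end

text \<open>The coordinates \<open>(t, w p)\<close> near \<open>p\<close>, with inverse \<open>h\<close>.\<close>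
locale lagrangian_chart = product_lagrangian +
  fixes p :: "real^4" and V :: "(real^4) set" and a b :: real and W :: "(real^3) set"
    and h :: "real \<times> (real^3) \<Rightarrow> real^4"
  assumes p: "p \<in> U" and open_V: "open V" and V_sub: "V \<subseteq> U" and open_W: "open W" and tp: "t p \<in> {a<..<b}"
    and hom: "homeomorphism ({a<..<b} \<times> W) V h (\<lambda>x. (t x, w p x))"
    and smooth_h: "smooth_on ({a<..<b} \<times> W) h"
begin

lemma open_S: "open ({a<..<b} \<times> W)"
  using open_W by (intro open_Times) auto

lemma diffeo: "diffeomorphism_on ({a<..<b} \<times> W) V h"
  unfolding diffeomorphism_on_def
  using open_S open_V hom smooth_h smooth_subset[OF smooth_Pair[OF open_U smooth_t smooth_w] V_sub] by blast

lemma h_in: "s \<in> {a<..<b} \<Longrightarrow> y \<in> W \<Longrightarrow> h (s, y) \<in> U"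
  using hom V_sub by (auto simp: homeomorphism_def)

lemma t_h: "s \<in> {a<..<b} \<Longrightarrow> y \<in> W \<Longrightarrow> t (h (s, y)) = s"
  and w_h: "s \<in> {a<..<b} \<Longrightarrow> y \<in> W \<Longrightarrow> w p (h (s, y)) = y"
  using hom by (auto simp: homeomorphism_def)

lemma D_h:
  assumes s: "s \<in> {a<..<b}" and y: "y \<in> W"
  shows "D h (s, y) (D t (h (s, y)) v, D (w p) (h (s, y)) v) = v"
proof -
  let ?x = "h (s, y)"
  have xV: "?x \<in> V" using hom s y by (auto simp: homeomorphism_def)
  have xU: "?x \<in> U" using xV V_sub by blast
  note dt = smooth_differentiable[OF smooth_t xU] and dw = smooth_differentiable[OF smooth_w xU, of p]
  have dtw: "(\<lambda>x. (t x, w p x)) differentiable (at ?x)"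
    using smooth_differentiable[OF smooth_Pair[OF open_U smooth_t smooth_w] xU] .
  have dh: "h differentiable (at (t ?x, w p ?x))"
    using smooth_differentiable[OF smooth_h, of "(s, y)"] s y by (simp add: t_h w_h)
  have "D (\<lambda>x. h (t x, w p x)) ?x = D (\<lambda>x. x) ?x"
    by (rule D_cong_open(1)[OF open_V xV]) (use hom in \<open>auto simp: homeomorphism_def\<close>)
  then have "D (\<lambda>x. h (t x, w p x)) ?x v = v" by simp
  then show ?thesis
    using D_compose[OF dtw dh, of v] D_Pair[OF dt dw, of v] by (simp add: t_h[OF s y] w_h[OF s y])
qed

lemma D_h_time: "s \<in> {a<..<b} \<Longrightarrow> y \<in> W \<Longrightarrow> D h (s, y) (1, 0) = \<epsilon> *\<^sub>R Z 4 (h (s, y))"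
proof -
  assume s: "s \<in> {a<..<b}" and y: "y \<in> W"
  have lin: "linear (D (w p) (h (s, y)))" using linear_D_smooth[OF smooth_w h_in[OF s y]] .
  have "D t (h (s, y)) (\<epsilon> *\<^sub>R Z 4 (h (s, y))) = 1"
    using \<epsilon> by (simp add: D_t[OF h_in[OF s y]] linear_cmul[OF linear_\<theta>[OF h_in[OF s y]]] \<theta>_Z[OF h_in[OF s y]])
  moreover have "D (w p) (h (s, y)) (\<epsilon> *\<^sub>R Z 4 (h (s, y))) = 0"
    by (simp add: linear_cmul[OF lin] D_w_Z4[OF h_in[OF s y]])
  ultimately show ?thesis using D_h[OF s y, of "\<epsilon> *\<^sub>R Z 4 (h (s, y))"] by simp
qed

text \<open>The slice through \<open>p\<close>, the three-dimensional factor, and the frame whose image under the differential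
  of this factor is \<open>F 1, F 2, F 3\<close>.\<close>
definition g :: "real^3 \<Rightarrow> real^4" where "g y = h (t p, y)"

definition \<phi> :: "real^3 \<Rightarrow> complex^4" where "\<phi> y = q (g y)"

definition Y :: "3 \<Rightarrow> real^3 \<Rightarrow> real^3" where
  "Y i y = (1 / \<kappa> p) *\<^sub>R D (w p) (g y) (Z (emb i) (g y))"

lemma g_in: "y \<in> W \<Longrightarrow> g y \<in> U"
  unfolding g_def using h_in[OF tp] .

lemma g_image: "g ` W \<subseteq> U" using g_in by blast

lemma \<kappa>_g: "y \<in> W \<Longrightarrow> \<kappa> (g y) = \<kappa> p"
  using \<kappa>_t[OF g_in p] t_h[OF tp] by (simp add: g_def)

lemma smooth_g: "smooth_on W g"
  unfolding g_def
  by (rule smooth_compose[OF open_W open_S _ smooth_Pair[OF open_W smooth_const smooth_ident] smooth_h])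
    (use tp in auto)

lemma smooth_comp_g:
  assumes "smooth_on U G"
  shows "smooth_on W (\<lambda>y. G (g y))"
  by (rule smooth_compose[OF open_W open_U g_image smooth_g assms])

lemma D_comp_g: "smooth_on U G \<Longrightarrow> y \<in> W \<Longrightarrow> D (\<lambda>y. G (g y)) y u = D G (g y) (D g y u)"
  by (intro D_compose smooth_differentiable[OF smooth_g] smooth_differentiable[OF _ g_in])

text \<open>The coordinate lines \<open>s \<mapsto> h (s, y)\<close> are integral curves of \<open>\<epsilon> Z 4\<close>, along which
  \<open>q\<close> does not change.\<close>
lemma q_h: assumes s: "s \<in> {a<..<b}" and y: "y \<in> W" shows "q (h (s, y)) = \<phi> y"
proof -
  have der: "((\<lambda>s. q (h (s, y))) has_derivative (\<lambda>r. 0)) (at s)" if s: "s \<in> {a<..<b}" for s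
  proof -
    have 1: "((\<lambda>s. (s, y)) has_derivative (\<lambda>r. (r, 0))) (at s)"
      by (intro derivative_eq_intros) auto
    have sy: "(s, y) \<in> {a<..<b} \<times> W" using s y by simp
    have 2: "((\<lambda>s. h (s, y)) has_derivative (\<lambda>r. D h (s, y) (r, 0))) (at s)"
      using has_derivative_compose[OF 1 smooth_has_derivative[OF smooth_h sy]] .
    have 3: "((\<lambda>s. q (h (s, y))) has_derivative (\<lambda>r. D q (h (s, y)) (D h (s, y) (r, 0)))) (at s)"
      using has_derivative_compose[OF 2 smooth_has_derivative[OF smooth_q h_in[OF s y]]] .
    have "D q (h (s, y)) (D h (s, y) (r, 0)) = 0" for r
    proof -
      have "(r, 0::real^3) = r *\<^sub>R (1, 0)" by simp
      then have "D h (s, y) (r, 0) = r *\<^sub>R (\<epsilon> *\<^sub>R Z 4 (h (s, y)))"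
        using linear_cmul[OF linear_D_smooth[OF smooth_h sy], of r "(1, 0)"] D_h_time[OF s y] by simp
      then show ?thesis
        using linear_cmul[OF linear_D_smooth[OF smooth_q h_in[OF s y]]] D_q_Z4[OF h_in[OF s y]] by simp
    qed
    then show ?thesis using 3 by simp
  qed
  have "q (h (s, y)) = q (h (t p, y))"
    by (rule constant_on_convex[of "{a<..<b}" "\<lambda>s. q (h (s, y))", OF _ _ _ s tp])
      (use der D_eqI[OF der] in \<open>auto simp: differentiable_def\<close>)
  then show ?thesis by (simp add: \<phi>_def g_def)
qed

lemma D_g_tangent: "y \<in> W \<Longrightarrow> \<theta> 4 (g y) (D g y u) = 0"
proof -
  assume y: "y \<in> W"
  have "D (\<lambda>y. t (g y)) y u = 0"
    by (rule D_const_on_open[OF open_W y, of _ "t p"]) (simp add: g_def t_h[OF tp])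
  then show ?thesis using \<epsilon> by (auto simp: D_comp_g[OF smooth_t y] D_t[OF g_in[OF y]])
qed

lemma D_w_g: "y \<in> W \<Longrightarrow> D (w p) (g y) (D g y u) = u"
proof -
  assume y: "y \<in> W"
  have "D (\<lambda>y. w p (g y)) y = D (\<lambda>y. y) y"
    by (rule D_cong_open(1)[OF open_W y]) (simp add: g_def w_h[OF tp])
  then show ?thesis using D_comp_g[OF smooth_w y, of p u] by simp
qed

text \<open>Vectors orthogonal to \<open>Z 4\<close> are tangent to the slice, since \<open>t\<close> is constant in their
  directions; this is why derivatives along the slice agree with those on \<open>M\<close>.\<close>
lemma D_g_w:
  assumes y: "y \<in> W" and v: "\<theta> 4 (g y) v = 0"
  shows "D g y (D (w p) (g y) v) = v"
proof -
  have 1: "D g y u = D h (t p, y) (0, u)" for u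
  proof -
    have "(\<lambda>y. (t p, y)) differentiable (at y)" "h differentiable (at (t p, y))"
      using smooth_differentiable[OF smooth_Pair[OF open_W smooth_const smooth_ident] y]
        smooth_differentiable[OF smooth_h, of "(t p, y)"] tp y by auto
    from D_compose[OF this, of u] have "D g y u = D h (t p, y) (D (\<lambda>y. (t p, y)) y u)"
      by (simp add: g_def[abs_def])
    then show ?thesis by (simp add: D_Pair)
  qed
  have "D t (g y) v = 0" using v by (simp add: D_t[OF g_in[OF y]])
  then show ?thesis using D_h[OF tp y, of v] by (simp add: 1 g_def[symmetric])
qed

lemma smooth_\<phi>: "smooth_on W \<phi>"
  unfolding \<phi>_def[abs_def] by (rule smooth_comp_g[OF smooth_q])

lemma D_\<phi>: "y \<in> W \<Longrightarrow> D \<phi> y u = \<kappa> p *\<^sub>R D f (g y) (D g y u)"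
  unfolding \<phi>_def[abs_def]
  by (simp add: D_comp_g[OF smooth_q] D_q[OF g_in] D_g_tangent \<kappa>_g)

lemma immersion_\<phi>: "smooth_immersion_on W \<phi>"
  unfolding smooth_immersion_on_def
proof (intro conjI ballI open_W smooth_\<phi>)
  fix y assume y: "y \<in> W"
  show "inj (D \<phi> y)"
  proof (subst linear_injective_0[OF linear_D_smooth[OF smooth_\<phi> y]], intro allI impI)
    fix u assume "D \<phi> y u = 0"
    then have "D f (g y) (D g y u) = D f (g y) 0"
      using \<kappa>_pos[OF p] by (simp add: D_\<phi>[OF y] linear_0[OF linear_Df[OF g_in[OF y]]])
    then have "D g y u = 0" using inj_f[OF g_in[OF y]] by (simp add: inj_eq)
    then show "u = 0" using D_w_g[OF y, of u] by (simp add: linear_0[OF linear_D_smooth[OF smooth_w g_in[OF y]]])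
  qed
qed

lemma \<phi>_lagrangian: "y \<in> W \<Longrightarrow> Im (herm (D \<phi> y u) (D \<phi> y v)) = 0"
  by (simp add: D_\<phi> herm_scaleR_left herm_scaleR_right lagrangian[OF g_in])

lemma \<phi>_orthogonal: "y \<in> W \<Longrightarrow> herm (D \<phi> y u) (F 4 (g y)) = 0"
  using D_g_tangent[of y u] lagrangian[OF g_in, of y "D g y u" "Z 4 (g y)"]
  by (simp add: D_\<phi> herm_scaleR_left complex_eq_iff \<theta>_def F_def)

lemma smooth_Y: "smooth_on W (Y i)"
  unfolding Y_def[abs_def]
  by (intro smooth_bounded_linear[OF bounded_linear_scaleR_right open_W] smooth_comp_g[of "\<lambda>x. D (w p) x (Z (emb i) x)"]
      smooth_D_field open_U smooth_w smooth_Z)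

lemma D_g_Y: "y \<in> W \<Longrightarrow> D g y (Y i y) = (1 / \<kappa> p) *\<^sub>R Z (emb i) (g y)"
  unfolding Y_def
  by (subst linear_cmul[OF linear_D_smooth[OF smooth_g]]) (simp_all add: D_g_w \<theta>_Z[OF g_in])

lemma D_\<phi>_Y: "y \<in> W \<Longrightarrow> D \<phi> y (Y i y) = F (emb i) (g y)"
  using \<kappa>_pos[OF p] by (simp add: D_\<phi> D_g_Y linear_cmul[OF linear_Df[OF g_in]] F_def)

text \<open>The derivative of \<open>F j\<close> in the direction of \<open>Z i / \<kappa>\<close>, expanded in the unitary frame.  The last
  summand is a multiple of \<open>F 4\<close>.  It disappears in both cases: for a product \<open>F 4\<close> is constant and
  orthogonal to the factor \<open>\<complex>\<^sup>3\<close>, and for a cone it is \<open>\<plusminus>\<phi>\<close>, which projects to zero.\<close>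
lemma second_fundamental_form_\<phi>:
  assumes y: "y \<in> W"
  shows "\<exists>e c. D (\<lambda>y. D \<phi> y (Y j y)) y (Y i y) = D \<phi> y e
    + \<i> *s D \<phi> y ((r (g y) / \<kappa> p) *\<^sub>R (\<Sum>k\<in>UNIV. cubic i j k *\<^sub>R Y k y)) + c *\<^sub>R F 4 (g y)"
proof -
  let ?x = "g y"
  let ?v = "(1 / \<kappa> p) *\<^sub>R Z (emb i) ?x"
  note x = g_in[OF y] and lin = linear_D_smooth[OF smooth_\<phi> y]
  have split: "z *s u = Re z *\<^sub>R u + Im z *\<^sub>R (\<i> *s u)" for z and u :: "complex^4"
    by (simp add: vec_eq_iff complex_eq_iff)
  have "D (\<lambda>y. D \<phi> y (Y j y)) y = D (\<lambda>y. F (emb j) (g y)) y"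
    by (rule D_cong_open(1)[OF open_W y]) (rule D_\<phi>_Y)
  then have "D (\<lambda>y. D \<phi> y (Y j y)) y (Y i y) = D (F (emb j)) ?x ?v"
    by (simp add: D_comp_g[OF smooth_F y] D_g_Y[OF y])
  also have "\<dots> = (\<Sum>k\<in>UNIV. herm (D (F (emb j)) ?x ?v) (F k ?x) *s F k ?x)"
    by (rule unitary_expansion) (rule herm_F[OF x])
  also have "\<dots> = (\<Sum>k\<in>UNIV. \<omega> (emb j) k ?x ?v *\<^sub>R F k ?x + (r ?x * (1 / \<kappa> p * cubic (emb i) (emb j) k)) *\<^sub>R (\<i> *s F k ?x))"
  proof (rule sum.cong[OF refl])
    fix k
    have "Im (herm (D (F (emb j)) ?x ?v) (F k ?x)) = r ?x * (1 / \<kappa> p * cubic (emb i) (emb j) k)"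
      by (simp add: sff_at[OF x] linear_cmul[OF linear_\<theta>[OF x]] \<theta>_Z[OF x] if_distrib if_distribR cong: if_cong)
    then show "herm (D (F (emb j)) ?x ?v) (F k ?x) *s F k ?x =
        \<omega> (emb j) k ?x ?v *\<^sub>R F k ?x + (r ?x * (1 / \<kappa> p * cubic (emb i) (emb j) k)) *\<^sub>R (\<i> *s F k ?x)"
      by (subst split) (simp add: \<omega>_def)
  qed
  also have "\<dots> = (\<Sum>k\<in>UNIV. \<omega> (emb j) (emb k) ?x ?v *\<^sub>R F (emb k) ?x)
      + (\<Sum>k\<in>UNIV. (r ?x * (1 / \<kappa> p * cubic i j k)) *\<^sub>R (\<i> *s F (emb k) ?x)) + \<omega> (emb j) 4 ?x ?v *\<^sub>R F 4 ?x"
  proof -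
    have "cubic (emb i) (emb j) 4 = 0" by (simp add: cubic_def distinct_4)
    then show ?thesis by (simp add: sum_4_emb sum.distrib cubic_emb)
  qed
  also have "(\<Sum>k\<in>UNIV. \<omega> (emb j) (emb k) ?x ?v *\<^sub>R F (emb k) ?x) = D \<phi> y (\<Sum>k\<in>UNIV. \<omega> (emb j) (emb k) ?x ?v *\<^sub>R Y k y)"
    by (simp add: linear_sum[OF lin] linear_cmul[OF lin] D_\<phi>_Y[OF y])
  also have "(\<Sum>k\<in>UNIV. (r ?x * (1 / \<kappa> p * cubic i j k)) *\<^sub>R (\<i> *s F (emb k) ?x))
      = \<i> *s D \<phi> y ((r ?x / \<kappa> p) *\<^sub>R (\<Sum>k\<in>UNIV. cubic i j k *\<^sub>R Y k y))"
    by (simp add: linear_sum[OF lin] linear_cmul[OF lin] D_\<phi>_Y[OF y] ii_sum ii_scaleR scaleR_sum_right)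
  finally show ?thesis by blast
qed

lemma herm_D_\<phi>_Y: "y \<in> W \<Longrightarrow> herm (D \<phi> y (Y i y)) (D \<phi> y (Y j y)) = (if i = j then 1 else 0)"
  by (simp add: D_\<phi>_Y herm_F[OF g_in])

end

section \<open>The product case\<close>

lemma unitary_isometry:
  fixes E :: "4 \<Rightarrow> complex^4"
  assumes E: "\<And>i j. herm (E i) (E j) = (if i = j then 1 else 0)"
  shows "holomorphic_isometry (\<lambda>z. (\<Sum>k\<in>UNIV. z $ k *s E k) + b)"
  unfolding holomorphic_isometry_def
proof (intro exI conjI allI)
  show "orthogonal_transformation (\<lambda>z. \<Sum>k\<in>UNIV. z $ k *s E k)"
    unfolding orthogonal_transformation_def
  proof (intro conjI allI linearI)
    fix v w :: "complex^4" and c :: real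
    show "(\<Sum>k\<in>UNIV. (v + w) $ k *s E k) = (\<Sum>k\<in>UNIV. v $ k *s E k) + (\<Sum>k\<in>UNIV. w $ k *s E k)"
      by (simp add: sum.distrib[symmetric] vec_eq_iff algebra_simps)
    show "(\<Sum>k\<in>UNIV. (c *\<^sub>R v) $ k *s E k) = c *\<^sub>R (\<Sum>k\<in>UNIV. v $ k *s E k)"
      by (simp add: vec_eq_iff scaleR_sum_right)
    have "herm (\<Sum>k\<in>UNIV. v $ k *s E k) (\<Sum>k\<in>UNIV. w $ k *s E k) = herm v w"
      by (simp add: herm_sum_left herm_sum_right herm_scale_left herm_scale_right E if_distrib cong: if_cong)
        (simp add: herm_def mult.commute)
    then show "(\<Sum>k\<in>UNIV. v $ k *s E k) \<bullet> (\<Sum>k\<in>UNIV. w $ k *s E k) = v \<bullet> w"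
      by (simp add: inner_eq_Re_herm)
  qed
  show "(\<Sum>k\<in>UNIV. (\<i> *s z) $ k *s E k) = \<i> *s (\<Sum>k\<in>UNIV. z $ k *s E k)" for z
    by (simp add: ii_sum vec_eq_iff algebra_simps)
qed simp

context lagrangian_chart
begin

text \<open>The coordinates with respect to the unitary frame at \<open>p\<close> identify the complement of the
  constant vector \<open>n\<close> with \<open>\<complex>\<^sup>3\<close>; this identification is complex linear and preserves the Hermitian
  product.\<close>
lemma product_case:
  assumes n: "\<And>x. x \<in> U \<Longrightarrow> F 4 x = n" and fq: "\<And>x. x \<in> U \<Longrightarrow> f x = q x + t x *\<^sub>R n"
    and qn: "\<And>x. x \<in> U \<Longrightarrow> herm (q x) n = c0"
  shows "\<exists>\<Psi> \<phi>. holomorphic_isometry \<Psi> \<and> special_lagrangian flat_metric W \<phi> \<and> S3_symmetric flat_metric W \<phi> \<and>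
     (\<forall>s\<in>{a<..<b}. \<forall>y\<in>W. f (h (s, y)) = \<Psi> (cons_C4 (of_real s) (\<phi> y)))"
proof -
  define M :: "complex^4 \<Rightarrow> complex^3" where "M = (\<lambda>z. \<chi> j. herm z (F (emb j) p))"
  have M: "linear M"
    unfolding M_def by (rule linearI)
      (simp_all add: vec_eq_iff herm_add_left herm_scaleR_left scaleR_conv_of_real[where 'a = complex])
  then have Mb: "bounded_linear M" by (simp add: linear_conv_bounded_linear)
  have Mi: "M (\<i> *s z) = \<i> *s M z" for z by (simp add: M_def vec_eq_iff herm_scale_left)
  have Mn: "M n = 0" using n[OF p] herm_F[OF p] by (simp add: M_def vec_eq_iff flip: n[OF p])
  have n4: "F 4 p = n" using n[OF p] .
  have expand: "z = (\<Sum>k\<in>UNIV. M z $ k *s F (emb k) p) + herm z n *s n" for z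
    using unitary_expansion[of "\<lambda>k. F k p" z] herm_F[OF p] by (simp add: sum_4_emb M_def n4)
  have hermM: "herm (M u) (M v) = herm u v" if "herm u n = 0" for u v
  proof -
    have "herm u v = herm ((\<Sum>k\<in>UNIV. M u $ k *s F (emb k) p) + herm u n *s n) v" using expand[of u] by simp
    also have "\<dots> = (\<Sum>k\<in>UNIV. M u $ k * herm (F (emb k) p) v)"
      using that by (simp add: herm_add_left herm_sum_left herm_scale_left)
    also have "\<dots> = herm (M u) (M v)"
    proof -
      have "herm (F (emb k) p) v = cnj (M v $ k)" for k by (simp add: M_def herm_cnj[of _ v])
      then show ?thesis by (simp add: herm_def)
    qed
    finally show ?thesis by simp
  qed
  define \<phi>3 where "\<phi>3 = (\<lambda>y. M (\<phi> y))"
  have D\<phi>3: "D \<phi>3 y u = M (D \<phi> y u)" if "y \<in> W" for y u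
    unfolding \<phi>3_def by (rule D_linear_compose[OF Mb smooth_differentiable[OF smooth_\<phi> that]])
  have sm3: "smooth_on W \<phi>3" unfolding \<phi>3_def by (rule smooth_bounded_linear[OF Mb open_W smooth_\<phi>])
  have hermD: "herm (D \<phi>3 y u) (D \<phi>3 y v) = herm (D \<phi> y u) (D \<phi> y v)" if "y \<in> W" for y u v
    using \<phi>_orthogonal[OF that, of u] n[OF g_in[OF that]] by (simp add: D\<phi>3[OF that] hermM)
  have imm: "smooth_immersion_on W \<phi>3"
    unfolding smooth_immersion_on_def
  proof (intro conjI ballI open_W sm3)
    fix y assume y: "y \<in> W"
    show "inj (D \<phi>3 y)"
    proof (subst linear_injective_0[OF linear_D_smooth[OF sm3 y]], intro allI impI)
      fix u assume "D \<phi>3 y u = 0"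
      then have "D \<phi> y u = 0" using hermD[OF y, of u u] by (simp add: herm_self_eq_0)
      moreover have "inj (D \<phi> y)" using immersion_\<phi> y by (simp add: smooth_immersion_on_def)
      ultimately show "u = 0"
        using linear_injective_0[OF linear_D_smooth[OF smooth_\<phi> y]] by blast
    qed
  qed
  have framing: "special_lagrangian flat_metric W \<phi>3 \<and> adapted_frame flat_metric W \<phi>3 Y (\<lambda>y. r (g y) / \<kappa> p)"
  proof (rule conjI)
    note * = adapted_framing[of W \<phi>3 Y flat_metric "\<lambda>y. r (g y) / \<kappa> p"]
    have 1: "bilinear (christoffel flat_metric (\<phi>3 x))" for x
      by (simp add: christoffel_flat bilinear_def linearI)
    have 2: "flat_metric (\<phi>3 x) (D \<phi>3 x (Y i x)) (D \<phi>3 x (Y j x)) = (if i = j then 1 else 0)" if "x \<in> W" for x i j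
      by (simp add: flat_metric_def inner_eq_Re_herm hermD[OF that] herm_D_\<phi>_Y[OF that])
    have 3: "flat_metric (\<phi>3 x) (D \<phi>3 x (Y i x)) (\<i> *s D \<phi>3 x (Y j x)) = 0" if "x \<in> W" for x i j
      by (simp add: flat_metric_def inner_ii_eq_Im_herm hermD[OF that] \<phi>_lagrangian[OF that])
    have 4: "r (g x) / \<kappa> p > 0" if "x \<in> W" for x using r_pos[OF g_in[OF that]] \<kappa>_pos[OF p] by simp
    have 5: "\<exists>e. cov_deriv flat_metric \<phi>3 (Y i) (Y j) x
        = D \<phi>3 x e + \<i> *s D \<phi>3 x ((r (g x) / \<kappa> p) *\<^sub>R (\<Sum>k\<in>UNIV. cubic i j k *\<^sub>R Y k x))" if x: "x \<in> W" for x i j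
    proof -
      obtain e c where ec: "D (\<lambda>y. D \<phi> y (Y j y)) x (Y i x) = D \<phi> x e
          + \<i> *s D \<phi> x ((r (g x) / \<kappa> p) *\<^sub>R (\<Sum>k\<in>UNIV. cubic i j k *\<^sub>R Y k x)) + c *\<^sub>R F 4 (g x)"
        using second_fundamental_form_\<phi>[OF x] by blast
      have "D (\<lambda>y. D \<phi>3 y (Y j y)) x = D (\<lambda>y. M (D \<phi> y (Y j y))) x"
        by (rule D_cong_open(1)[OF open_W x]) (rule D\<phi>3)
      then have "cov_deriv flat_metric \<phi>3 (Y i) (Y j) x = M (D (\<lambda>y. D \<phi> y (Y j y)) x (Y i x))"
        unfolding cov_deriv_flat
        using D_linear_compose[OF Mb smooth_differentiable[OF smooth_D_field[OF open_W smooth_\<phi> smooth_Y] x], of j "Y i x"]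
        by simp
      then show ?thesis
        unfolding ec by (simp add: linear_add[OF M] linear_cmul[OF M] Mi D\<phi>3[OF x] n[OF g_in[OF x]] Mn) blast
    qed
    show "special_lagrangian flat_metric W \<phi>3"
      by (rule *(1)[OF imm smooth_Y hermitian_form_flat 1 2 3 4 5])
    show "adapted_frame flat_metric W \<phi>3 Y (\<lambda>y. r (g y) / \<kappa> p)"
      by (rule *(2)[OF imm smooth_Y hermitian_form_flat 1 2 3 4 5])
  qed
  then have sym: "S3_symmetric flat_metric W \<phi>3"
    unfolding S3_symmetric_def using open_W by blast
  define E where "E = (\<lambda>k::4. if k = 1 then n else if k = 2 then F 1 p else if k = 3 then F 2 p else F 3 p)"
  have E: "herm (E i) (E j) = (if i = j then 1 else 0)" for i j
    using exhaust_4[of i] exhaust_4[of j] by (auto simp: E_def distinct_4 herm_F[OF p] n4[symmetric])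
  define \<Psi> where "\<Psi> = (\<lambda>z. (\<Sum>k\<in>UNIV. z $ k *s E k) + c0 *s n)"
  have "f (h (s, y)) = \<Psi> (cons_C4 (of_real s) (\<phi>3 y))" if s: "s \<in> {a<..<b}" and y: "y \<in> W" for s y
  proof -
    have "f (h (s, y)) = \<phi> y + s *\<^sub>R n"
      using fq[OF h_in[OF s y]] q_h[OF s y] t_h[OF s y] by simp
    also have "\<phi> y = (\<Sum>k\<in>UNIV. \<phi>3 y $ k *s F (emb k) p) + c0 *s n"
      using expand[of "\<phi> y"] qn[OF g_in[OF y]] by (simp add: \<phi>3_def \<phi>_def)
    finally show ?thesis
      by (simp add: \<Psi>_def cons_C4_def E_def sum_4 sum_3 distinct_4 scaleR_eq_scale algebra_simps)
  qed
  then show ?thesis using unitary_isometry[OF E, of "c0 *s n"] framing sym unfolding \<Psi>_def by blast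
qed

end

lemma (in product_lagrangian) chart_exists:
  assumes p: "p \<in> U"
  shows "\<exists>V a b W h. p \<in> V \<and> lagrangian_chart U f Z r t q \<kappa> \<epsilon> p V a b W h"
proof -
  obtain V a b W h where *: "open V" "p \<in> V" "V \<subseteq> U" "open W" "t p \<in> {a<..<b}" "w p p \<in> W"
    "homeomorphism ({a<..<b} \<times> W) V h (\<lambda>x. (t x, w p x))" "smooth_on ({a<..<b} \<times> W) h"
    by (rule product_chart[OF open_U smooth_t smooth_w p chart_injective[OF p]])
  have "lagrangian_chart U f Z r t q \<kappa> \<epsilon> p V a b W h"
    by unfold_locales (use p * in auto)
  with *(2) show ?thesis by blast
qed

section \<open>The Fubini-Study metric in affine charts\<close>

text \<open>The vector with entry \<open>c\<close> at position \<open>k\<close> and the entries of \<open>v\<close> elsewhere: \<open>homog k 1 z\<close>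
  represents the point with affine coordinates \<open>z\<close> in the chart \<open>k\<close>, and \<open>homog k 0\<close> is the linear part of
  this parametrization.\<close>
definition homog :: "4 \<Rightarrow> complex \<Rightarrow> complex^3 \<Rightarrow> complex^4" where
  "homog k c v = (\<chi> i. cons_C4 c v $ Transposition.transpose 1 k i)"

lemma sum_transpose: "(\<Sum>i\<in>UNIV. g (Transposition.transpose 1 k i)) = (\<Sum>i\<in>UNIV. g i)"
  for g :: "4 \<Rightarrow> 'a::comm_monoid_add"
  by (rule sum.reindex_bij_betw) simp

lemma herm_homog: "herm (homog k c v) (homog k d w) = c * cnj d + herm v w"
proof -
  have "herm (homog k c v) (homog k d w) = (\<Sum>i\<in>UNIV. cons_C4 c v $ i * cnj (cons_C4 d w $ i))"
    unfolding herm_def homog_def by (simp add: sum_transpose[of "\<lambda>i. cons_C4 c v $ i * cnj (cons_C4 d w $ i)"])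
  then show ?thesis by (simp add: herm_def sum_4 sum_3 cons_C4_def distinct_4)
qed

lemma homog_add: "homog k (c + d) (v + w) = homog k c v + homog k d w"
  by (simp add: homog_def cons_C4_def vec_eq_iff)

lemma homog_scale: "homog k (a * c) (a *s v) = a *s homog k c v"
  by (simp add: homog_def cons_C4_def vec_eq_iff)

lemma homog_diff: "homog k (c - d) (v - w) = homog k c v - homog k d w"
  by (simp add: homog_def cons_C4_def vec_eq_iff)

lemma homog_inject: "homog k c v = homog k d w \<longleftrightarrow> c = d \<and> v = w"
proof
  assume "homog k c v = homog k d w"
  then have "herm (homog k (c - d) (v - w)) (homog k (c - d) (v - w)) = 0" by (simp add: homog_diff)
  moreover have "herm (homog k (c - d) (v - w)) (homog k (c - d) (v - w)) = (c - d) * cnj (c - d) + herm (v - w) (v - w)"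
    by (rule herm_homog)
  moreover have "\<dots> = complex_of_real ((cmod (c - d))\<^sup>2 + (norm (v - w))\<^sup>2)"
    by (simp only: herm_self complex_norm_square of_real_add)
  ultimately have "complex_of_real ((cmod (c - d))\<^sup>2 + (norm (v - w))\<^sup>2) = 0" by simp
  then have "(cmod (c - d))\<^sup>2 + (norm (v - w))\<^sup>2 = 0" by (simp only: of_real_eq_0_iff)
  then show "c = d \<and> v = w" by (simp add: sum_power2_eq_zero_iff)
qed auto

lemma homog_nth: "homog k c v $ k = c"
  by (simp add: homog_def cons_C4_def)

lemma homog_surj: "x = homog k (x $ k) (\<chi> j. x $ Transposition.transpose 1 k (if j = 1 then 2 else if j = 2 then 3 else 4))"
proof (subst vec_eq_iff, intro allI)
  fix i
  define m where "m = Transposition.transpose 1 k i"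
  have i: "i = Transposition.transpose 1 k m" by (simp add: m_def)
  show "x $ i = homog k (x $ k) (\<chi> j. x $ Transposition.transpose 1 k (if j = 1 then 2 else if j = 2 then 3 else 4)) $ i"
    unfolding homog_def using exhaust_4[of m] by (auto simp: i cons_C4_def distinct_4 distinct_3)
qed

lemma linear_homog0: "linear (homog k 0)"
proof (rule linearI)
  show "homog k 0 (v + w) = homog k 0 v + homog k 0 w" for v w using homog_add[of k 0 0 v w] by simp
  show "homog k 0 (a *\<^sub>R v) = a *\<^sub>R homog k 0 v" for a v
    using homog_scale[of k "of_real a" 0 v] by (simp add: scaleR_eq_scale)
qed

lemma bounded_linear_homog0: "bounded_linear (homog k 0)"
  using linear_homog0 by (simp add: linear_conv_bounded_linear)

lemma homog_split: "homog k c v = homog k c 0 + homog k 0 v"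
  using homog_add[of k c 0 0 v] by simp

lemma smooth_homog:
  assumes "open U" "smooth_on U z"
  shows "smooth_on U (\<lambda>x. homog k c (z x))"
proof -
  have "(\<lambda>x. homog k c (z x)) = (\<lambda>x. homog k c 0 + homog k 0 (z x))" by (rule ext) (rule homog_split)
  moreover have "smooth_on U (\<lambda>x. homog k c 0 + homog k 0 (z x))"
    by (intro smooth_add smooth_const smooth_bounded_linear[OF bounded_linear_homog0] assms)
  ultimately show ?thesis by simp
qed

lemma D_homog:
  assumes "z differentiable (at x)"
  shows "D (\<lambda>x. homog k c (z x)) x v = homog k 0 (D z x v)"
proof -
  have "((\<lambda>x. homog k c 0 + homog k 0 (z x)) has_derivative (\<lambda>v. 0 + homog k 0 (D z x v))) (at x)"
    by (rule has_derivative_add[OF has_derivative_const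
          bounded_linear.has_derivative[OF bounded_linear_homog0 D_works[OF assms]]])
  moreover have "(\<lambda>x. homog k c 0 + homog k 0 (z x)) = (\<lambda>x. homog k c (z x))"
    by (rule ext) (rule homog_split[symmetric])
  ultimately have "D (\<lambda>x. homog k c (z x)) x = (\<lambda>v. 0 + homog k 0 (D z x v))" by (intro D_eqI) simp
  then show ?thesis by simp
qed

definition \<rho> :: "complex^3 \<Rightarrow> real" where "\<rho> z = 1 + (norm z)\<^sup>2"

text \<open>The component of \<open>homog k 0 v\<close> that is Hermitian orthogonal to the line through \<open>homog k 1 z\<close>.  Up to a
  factor it is the horizontal vector over \<open>v\<close>.\<close>
definition perp :: "4 \<Rightarrow> complex^3 \<Rightarrow> complex^3 \<Rightarrow> complex^4" where
  "perp k z v = homog k 0 v - (herm v z / of_real (\<rho> z)) *s homog k 1 z"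

lemma \<rho>_pos: "\<rho> z > 0" by (simp add: \<rho>_def add_pos_nonneg)

lemma \<rho>_nz [simp]: "\<rho> z \<noteq> 0" using \<rho>_pos[of z] by simp

lemma herm_homog_self: "herm (homog k 1 z) (homog k 1 z) = of_real (\<rho> z)"
  by (simp only: herm_homog) (simp add: \<rho>_def herm_self)

lemma one_plus_herm: "1 + herm z z = of_real (\<rho> z)"
  by (simp add: \<rho>_def herm_self)

lemma herm_perp: "herm (perp k z v) (perp k z w) = herm v w - herm v z * herm z w / of_real (\<rho> z)"
  by (simp add: perp_def herm_diff_left herm_diff_right herm_scale_left herm_scale_right herm_homog one_plus_herm
      herm_cnj[of z w])

lemma perp_ii: "perp k z (\<i> *s v) = \<i> *s perp k z v"
  using homog_scale[of k \<i> 0 v] by (simp add: perp_def herm_scale_left vec_eq_iff algebra_simps)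

lemma D_cp_section:
  shows "cp_section k differentiable (at z)"
    and "\<exists>d. D (cp_section k) z v = (1 / sqrt (\<rho> z)) *\<^sub>R homog k 0 v + d *\<^sub>R homog k 1 z"
proof -
  have eq: "cp_section k = (\<lambda>z. (1 / sqrt (1 + z \<bullet> z)) *\<^sub>R homog k 1 z)"
    by (simp add: cp_section_def homog_def fun_eq_iff power2_norm_eq_inner)
  have pos: "1 + z \<bullet> z > 0" for z :: "complex^3" using inner_ge_zero[of z] by linarith
  have opn: "open (UNIV :: (complex^3) set)" by simp
  have smi: "smooth_on UNIV (\<lambda>z :: complex^3. 1 + z \<bullet> z)"
    by (intro smooth_add smooth_const smooth_inner smooth_ident opn)
  have sm: "smooth_on UNIV (\<lambda>z :: complex^3. 1 / sqrt (1 + z \<bullet> z))"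
    by (rule smooth_divide[OF opn smooth_const smooth_sqrt[OF opn smi]]) (use pos in \<open>auto simp: less_imp_neq[symmetric]\<close>)
  have smp: "smooth_on UNIV (\<lambda>z. homog k 1 z)"
    by (intro smooth_homog smooth_ident opn)
  show "cp_section k differentiable (at z)"
    unfolding eq using smooth_differentiable[OF smooth_scaleR[OF opn sm smp]] by simp
  have "D (cp_section k) z v = (1 / sqrt (1 + z \<bullet> z)) *\<^sub>R homog k 0 v + D (\<lambda>z. 1 / sqrt (1 + z \<bullet> z)) z v *\<^sub>R homog k 1 z"
    unfolding eq
    using D_scaleR[OF smooth_differentiable[OF sm] smooth_differentiable[OF smp], of z v] D_homog[of "\<lambda>z. z" z k 1 v]
    by simp
  then show "\<exists>d. D (cp_section k) z v = (1 / sqrt (\<rho> z)) *\<^sub>R homog k 0 v + d *\<^sub>R homog k 1 z"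
    unfolding \<rho>_def power2_norm_eq_inner by blast
qed

lemma cp_section_eq: "cp_section k z = (1 / sqrt (\<rho> z)) *\<^sub>R homog k 1 z"
  by (simp add: cp_section_def \<rho>_def homog_def)

lemma herm_cp_section: "herm (cp_section k z) (cp_section k z) = 1"
proof -
  have "(1 / sqrt (\<rho> z)) * (1 / sqrt (\<rho> z)) * \<rho> z = 1" using \<rho>_pos[of z] by (simp add: field_simps)
  then have "complex_of_real ((1 / sqrt (\<rho> z)) * (1 / sqrt (\<rho> z)) * \<rho> z) = 1" by (simp only: of_real_1)
  then show ?thesis
    by (simp only: cp_section_eq herm_scaleR_left herm_scaleR_right herm_homog_self of_real_mult mult.assoc)
qed

text \<open>The section has unit length, so that its derivative has no real component along the section, and
  removing the vertical component amounts to the Hermitian projection.\<close>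
lemma horizontal_part_section:
  "horizontal_part (cp_section k z) (D (cp_section k) z v) = (1 / sqrt (\<rho> z)) *\<^sub>R perp k z v"
proof -
  let ?s = "cp_section k z" and ?u = "D (cp_section k) z v"
  define c where "c = 1 / sqrt (\<rho> z)"
  have cc: "c * c = 1 / \<rho> z" using \<rho>_pos[of z] by (simp add: c_def)
  have s: "?s = c *\<^sub>R homog k 1 z" by (simp only: cp_section_eq c_def)
  have "D (\<lambda>z. herm (cp_section k z) (cp_section k z)) z v = 0"
    by (rule D_const_on_open[of UNIV]) (simp_all add: herm_cp_section)
  then have "herm ?s ?u + herm ?u ?s = 0"
    by (simp add: D_herm[OF D_cp_section(1) D_cp_section(1)])
  then have re: "Re (herm ?u ?s) = 0"
    using herm_cnj[of ?s ?u] by (simp add: complex_eq_iff)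
  have hor: "horizontal_part ?s ?u = ?u - herm ?u ?s *s ?s"
    unfolding horizontal_part_def inner_ii_eq_Im_herm
    using re by (simp add: vec_eq_iff complex_eq_iff)
  obtain d where d: "?u = c *\<^sub>R homog k 0 v + d *\<^sub>R homog k 1 z" using D_cp_section(2) c_def by metis
  have "herm ?u ?s = of_real (c * c) * herm v z + of_real (d * c * \<rho> z)"
    unfolding d unfolding s
    by (simp add: herm_add_left herm_scaleR_left herm_scaleR_right herm_homog one_plus_herm algebra_simps)
  then have "herm ?u ?s * of_real c = of_real c * (of_real (c * c) * herm v z) + of_real (d * (c * c * \<rho> z))"
    by (simp add: algebra_simps)
  also have "\<dots> = of_real c * (herm v z / of_real (\<rho> z)) + of_real d"
    unfolding cc by simp
  finally have *: "herm ?u ?s * of_real c = of_real c * (herm v z / of_real (\<rho> z)) + of_real d" .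
  have "herm ?u ?s *s ?s = (herm ?u ?s * of_real c) *s homog k 1 z"
    by (subst (2) s) (simp add: vec_eq_iff scaleR_conv_of_real[where 'a = complex] mult.assoc)
  then have "?u - herm ?u ?s *s ?s = c *\<^sub>R homog k 0 v + d *\<^sub>R homog k 1 z
      - (of_real c * (herm v z / of_real (\<rho> z)) + of_real d) *s homog k 1 z"
    unfolding * using d by simp
  also have "\<dots> = c *\<^sub>R perp k z v"
    unfolding perp_def by (simp add: vec_eq_iff scaleR_conv_of_real[where 'a = complex] algebra_simps)
  finally show ?thesis unfolding hor c_def .
qed

lemma fubini_study_perp: "fubini_study k z v w = Re (herm (perp k z v) (perp k z w)) / \<rho> z"
proof -
  have cc: "1 / sqrt (\<rho> z) * (1 / sqrt (\<rho> z)) = 1 / \<rho> z" using \<rho>_pos[of z] by (simp add: field_simps)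
  have "fubini_study k z v w = (1 / sqrt (\<rho> z) * (1 / sqrt (\<rho> z))) * Re (herm (perp k z v) (perp k z w))"
    unfolding fubini_study_def horizontal_part_section inner_eq_Re_herm
    by (simp add: herm_scaleR_left herm_scaleR_right)
  then show ?thesis unfolding cc by simp
qed

lemma fubini_study_formula:
  "fubini_study k z v w = Re (herm v w) / \<rho> z - Re (herm v z * herm z w) / (\<rho> z)\<^sup>2"
proof -
  have "Re (x / of_real c) = Re x / c" for x :: complex and c by simp
  then show ?thesis unfolding fubini_study_perp herm_perp by (simp add: power2_eq_square diff_divide_distrib)
qed

lemma hermitian_form_fubini_study: "hermitian_form (fubini_study k z)"
  unfolding hermitian_form_def
proof (intro conjI allI impI)
  have "linear (\<lambda>v. fubini_study k z v w)" "linear (fubini_study k z w)" for w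
    by (rule linearI; simp add: fubini_study_formula[abs_def] herm_add_left herm_add_right herm_scaleR_left herm_scaleR_right
        algebra_simps add_divide_distrib diff_divide_distrib)+
  then show "bilinear (fubini_study k z)" by (simp add: bilinear_def)
  show "fubini_study k z v w = fubini_study k z w v" for v w
  proof -
    have "Re (herm (perp k z v) (perp k z w)) = Re (herm (perp k z w) (perp k z v))" by (subst herm_cnj) simp
    then show ?thesis by (simp add: fubini_study_perp)
  qed
  show "fubini_study k z (\<i> *s v) (\<i> *s w) = fubini_study k z v w" for v w
    by (simp add: fubini_study_perp perp_ii herm_scale_left herm_scale_right)
  fix v :: "complex^3" assume v: "v \<noteq> 0"
  have "perp k z v \<noteq> 0"
  proof
    assume "perp k z v = 0"
    then have "homog k 0 v = homog k (herm v z / of_real (\<rho> z)) ((herm v z / of_real (\<rho> z)) *s z)"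
      using homog_scale[of k "herm v z / of_real (\<rho> z)" 1 z] by (simp add: perp_def)
    then show False using v by (auto simp: homog_inject)
  qed
  then show "fubini_study k z v v > 0"
    using \<rho>_pos[of z] by (simp add: fubini_study_perp herm_self)
qed

text \<open>The formula comes from differentiating a horizontal lift \<open>\<zeta> homog k 1 z\<close> twice: modulo the line spanned by
  the lift, the result is \<open>\<zeta> homog k 0\<close> applied to the second derivative of \<open>z\<close> plus this form.\<close>
definition fs_christoffel :: "complex^3 \<Rightarrow> complex^3 \<Rightarrow> complex^3 \<Rightarrow> complex^3" where
  "fs_christoffel z u v = - (1 / \<rho> z) *\<^sub>R (herm u z *s v + herm v z *s u)"

lemma D_fubini_study:
  "D (\<lambda>y. fubini_study k y v w) z u =
    - (2 * Re (herm u z) * Re (herm v w)) / (\<rho> z)\<^sup>2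
    - Re (herm v u * herm z w + herm v z * herm u w) / (\<rho> z)\<^sup>2
    + 2 * (2 * Re (herm u z)) * Re (herm v z * herm z w) / (\<rho> z) ^ 3"
proof -
  have \<rho>': "\<rho> = (\<lambda>z. 1 + Re (herm z z))"
    by (simp add: \<rho>_def fun_eq_iff power2_norm_eq_inner inner_eq_Re_herm)
  have h1: "((\<lambda>y. herm v y) has_derivative (\<lambda>u. herm v u)) (at z)" and h2: "((\<lambda>y. herm y w) has_derivative (\<lambda>u. herm u w)) (at z)"
    using bounded_linear_imp_has_derivative[OF bounded_bilinear.bounded_linear_right[OF bounded_bilinear_herm]]
      bounded_linear_imp_has_derivative[OF bounded_bilinear.bounded_linear_left[OF bounded_bilinear_herm]] by auto
  have A: "((\<lambda>y. Re (herm v y * herm y w)) has_derivative (\<lambda>u. Re (herm v z * herm u w + herm v u * herm z w))) (at z)"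
    by (rule bounded_linear.has_derivative[OF bounded_linear_Re has_derivative_mult[OF h1 h2]])
  have R: "(\<rho> has_derivative (\<lambda>u. 2 * Re (herm u z))) (at z)"
  proof -
    have "((\<lambda>y. 1 + Re (herm y y)) has_derivative (\<lambda>u. 0 + Re (herm z u + herm u z))) (at z)"
      by (rule has_derivative_add[OF has_derivative_const bounded_linear.has_derivative[OF bounded_linear_Re
            bounded_bilinear.FDERIV[OF bounded_bilinear_herm has_derivative_ident has_derivative_ident]]])
    moreover have "Re (herm z u) = Re (herm u z)" for u by (subst herm_cnj) simp
    ultimately show ?thesis by (simp add: \<rho>')
  qed
  have I: "((\<lambda>y. inverse (\<rho> y)) has_derivative (\<lambda>u. - (inverse (\<rho> z) * (2 * Re (herm u z)) * inverse (\<rho> z)))) (at z)"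
    by (rule Deriv.has_derivative_inverse[OF \<rho>_nz R])
  have "((\<lambda>y. Re (herm v w) * inverse (\<rho> y) - Re (herm v y * herm y w) * (inverse (\<rho> y) * inverse (\<rho> y)))
      has_derivative (\<lambda>u. Re (herm v w) * - (inverse (\<rho> z) * (2 * Re (herm u z)) * inverse (\<rho> z))
        - (Re (herm v z * herm z w) * (inverse (\<rho> z) * - (inverse (\<rho> z) * (2 * Re (herm u z)) * inverse (\<rho> z))
            + - (inverse (\<rho> z) * (2 * Re (herm u z)) * inverse (\<rho> z)) * inverse (\<rho> z))
          + Re (herm v z * herm u w + herm v u * herm z w) * (inverse (\<rho> z) * inverse (\<rho> z))))) (at z)"
    by (intro has_derivative_diff has_derivative_mult_right I has_derivative_mult[OF A] has_derivative_mult[OF I I])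
  moreover have "(\<lambda>y. fubini_study k y v w) = (\<lambda>y. Re (herm v w) * inverse (\<rho> y) - Re (herm v y * herm y w) * (inverse (\<rho> y) * inverse (\<rho> y)))"
    by (simp add: fubini_study_formula fun_eq_iff divide_inverse power2_eq_square)
  ultimately show ?thesis
    using D_eqI by (simp add: D_eqI divide_inverse power2_eq_square power3_eq_cube algebra_simps)
qed

text \<open>With the abbreviations for the Hermitian products of \<open>u, v, w, z\<close> the condition that the metric is
  parallel is a polynomial identity in their real and imaginary parts.\<close>
lemma levi_civita_fubini_study: "is_levi_civita_at (fubini_study k) z (fs_christoffel z)"
  unfolding is_levi_civita_at_def
proof (intro conjI allI)
  show "bilinear (fs_christoffel z)"
    unfolding bilinear_def fs_christoffel_def
    by (auto intro!: linearI simp: herm_add_left herm_scaleR_left vec_eq_iff scaleR_conv_of_real[where 'a = complex] algebra_simps)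
  show "fs_christoffel z u v = fs_christoffel z v u" for u v by (simp add: fs_christoffel_def add.commute)
  fix u v w
  define a b c d e h where "a = herm u z" and "b = herm v z" and "c = herm w z" and "d = herm v w"
    and "e = herm v u" and "h = herm u w"
  define I where "I = 1 / \<rho> z"
  have zs: "herm z w = cnj c" "herm z u = cnj a" "herm z v = cnj b"
    by (simp_all add: a_def b_def c_def herm_cnj[of z])
  have \<Gamma>1: "herm (fs_christoffel z u v) x = - of_real I * (a * herm v x + b * herm u x)" for x
    by (simp add: fs_christoffel_def herm_scaleR_left herm_add_left herm_scale_left a_def b_def I_def herm_minus_left)
  have \<Gamma>2: "herm x (fs_christoffel z u w) = - of_real I * (cnj a * herm x w + cnj c * herm x u)" for x
    by (simp add: fs_christoffel_def herm_scaleR_right herm_add_right herm_scale_right a_def c_def I_def herm_minus_right)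
  have fs: "fubini_study k z x y = I * Re (herm x y) - I * I * Re (herm x z * herm z y)" for x y
    by (simp add: fubini_study_formula I_def power2_eq_square)
  have "D (\<lambda>y. fubini_study k y v w) z u = - 2 * Re a * Re d * I * I - Re (e * cnj c + b * h) * I * I
      + 4 * Re a * Re (b * cnj c) * I * I * I"
    unfolding D_fubini_study by (simp add: zs a_def[symmetric] b_def[symmetric] d_def[symmetric] e_def[symmetric] h_def[symmetric]
        I_def power2_eq_square power3_eq_cube)
  also have "\<dots> = fubini_study k z (fs_christoffel z u v) w + fubini_study k z v (fs_christoffel z u w)"
    unfolding fs \<Gamma>1 \<Gamma>2 zs a_def[symmetric] b_def[symmetric] d_def[symmetric] e_def[symmetric] h_def[symmetric]
    by (simp add: algebra_simps)
  finally show "D (\<lambda>y. fubini_study k y v w) z u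
      = fubini_study k z (fs_christoffel z u v) w + fubini_study k z v (fs_christoffel z u w)" .
qed

lemma christoffel_fubini_study: "christoffel (fubini_study k) z = fs_christoffel z"
  by (rule christoffel_eqI[OF hermitian_form_fubini_study levi_civita_fubini_study])

section \<open>Horizontal lifts\<close>

lemma hopf_scale:
  assumes "cmod c = 1"
  shows "hopf (c *s x) = hopf x"
proof -
  have c0: "c \<noteq> 0" using assms by auto
  have "d *s (c *s x) \<in> hopf x" if "cmod d = 1" for d
    unfolding hopf_def using that assms by (auto simp: norm_mult intro!: exI[of _ "d * c"])
  moreover have "d *s x \<in> hopf (c *s x)" if "cmod d = 1" for d
    unfolding hopf_def using that assms c0 by (auto simp: norm_divide intro!: exI[of _ "d / c"])
  ultimately show ?thesis unfolding hopf_def by blast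
qed

text \<open>An immersion into the unit sphere that is orthogonal to the Hopf circles; the vanishing of the
  complex number \<open>herm (D \<phi> y u) (\<phi> y)\<close> comprises both conditions.\<close>
locale horizontal_immersion =
  fixes W :: "(real^3) set" and \<phi> :: "real^3 \<Rightarrow> complex^4"
  assumes imm: "smooth_immersion_on W \<phi>" and unit: "\<And>y. y \<in> W \<Longrightarrow> herm (\<phi> y) (\<phi> y) = 1"
    and horizontal: "\<And>y u. y \<in> W \<Longrightarrow> herm (D \<phi> y u) (\<phi> y) = 0"
begin

lemma open_W: "open W" and smooth_\<phi>: "smooth_on W \<phi>" and inj_\<phi>: "y \<in> W \<Longrightarrow> inj (D \<phi> y)"
  using imm by (auto simp: smooth_immersion_on_def)

definition chart_dom :: "4 \<Rightarrow> (real^3) set" where "chart_dom k = {y \<in> W. \<phi> y $ k \<noteq> 0}"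

text \<open>The local expression of the projection of \<open>\<phi>\<close> in the chart \<open>k\<close>.\<close>
definition aff_coords :: "4 \<Rightarrow> real^3 \<Rightarrow> complex^3" where
  "aff_coords k y = (\<chi> j. \<phi> y $ Transposition.transpose 1 k (if j = 1 then 2 else if j = 2 then 3 else 4) / \<phi> y $ k)"

lemma chart_dom_subset: "chart_dom k \<subseteq> W" by (auto simp: chart_dom_def)

lemma open_chart_dom: "open (chart_dom k)"
proof -
  have "continuous_on W (\<lambda>y. \<phi> y $ k)"
    using smooth_continuous[OF smooth_vec_nth[OF open_W smooth_\<phi>]] .
  then have "open (W \<inter> (\<lambda>y. \<phi> y $ k) -` (- {0}))"
    by (rule continuous_open_preimage[OF _ open_W]) (simp add: open_Compl)
  moreover have "W \<inter> (\<lambda>y. \<phi> y $ k) -` (- {0}) = chart_dom k" by (auto simp: chart_dom_def)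
  ultimately show ?thesis by simp
qed

lemma smooth_\<zeta>: "smooth_on (chart_dom k) (\<lambda>y. \<phi> y $ m)"
  by (rule smooth_vec_nth[OF open_chart_dom smooth_subset[OF smooth_\<phi> chart_dom_subset]])

lemma smooth_aff_coords: "smooth_on (chart_dom k) (aff_coords k)"
proof (rule smooth_vecI[OF open_chart_dom])
  fix j
  have "smooth_on (chart_dom k) (\<lambda>y. \<phi> y $ m / \<phi> y $ k)" for m
    by (rule smooth_divide[OF open_chart_dom smooth_\<zeta> smooth_\<zeta>]) (simp add: chart_dom_def)
  then show "smooth_on (chart_dom k) (\<lambda>y. aff_coords k y $ j)"
    by (simp only: aff_coords_def vec_lambda_beta)
qed

lemma \<phi>_aff: "y \<in> chart_dom k \<Longrightarrow> \<phi> y = \<phi> y $ k *s homog k 1 (aff_coords k y)"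
proof -
  assume y: "y \<in> chart_dom k"
  have "\<phi> y = homog k (\<phi> y $ k) (\<chi> j. \<phi> y $ Transposition.transpose 1 k (if j = 1 then 2 else if j = 2 then 3 else 4))"
    by (rule homog_surj)
  also have "\<dots> = homog k (\<phi> y $ k) (\<phi> y $ k *s aff_coords k y)"
    by (rule arg_cong[where f = "homog k (\<phi> y $ k)"]) (use y in \<open>simp add: vec_eq_iff aff_coords_def chart_dom_def\<close>)
  finally show ?thesis using homog_scale[of k "\<phi> y $ k" 1 "aff_coords k y"] by simp
qed

lemma norm_\<zeta>: "y \<in> chart_dom k \<Longrightarrow> \<phi> y $ k * cnj (\<phi> y $ k) * of_real (\<rho> (aff_coords k y)) = 1"
proof -
  assume y: "y \<in> chart_dom k"
  then have "herm (\<phi> y $ k *s homog k 1 (aff_coords k y)) (\<phi> y $ k *s homog k 1 (aff_coords k y)) = 1"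
    using unit[of y] \<phi>_aff[OF y] chart_dom_subset by auto
  then show ?thesis by (simp add: herm_scale_left herm_scale_right herm_homog one_plus_herm mult_ac)
qed

lemma D_\<phi>_raw:
  assumes y: "y \<in> chart_dom k"
  shows "D \<phi> y u = D (\<lambda>y. \<phi> y $ k) y u *s homog k 1 (aff_coords k y) + \<phi> y $ k *s homog k 0 (D (aff_coords k) y u)"
proof -
  note da = smooth_differentiable[OF smooth_aff_coords y]
  have dpc: "(\<lambda>y. homog k 1 (aff_coords k y)) differentiable (at y)"
    by (intro smooth_differentiable[OF _ y] smooth_homog smooth_aff_coords open_chart_dom)
  have "D \<phi> y = D (\<lambda>y. \<phi> y $ k *s homog k 1 (aff_coords k y)) y"
    by (rule D_cong_open(1)[OF open_chart_dom y]) (rule \<phi>_aff)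
  then show ?thesis
    using D_bilinear[OF bounded_bilinear_scale smooth_differentiable[OF smooth_\<zeta> y] dpc] D_homog[OF da]
    by simp
qed

text \<open>Horizontality determines how the factor \<open>\<phi> y $ k\<close> between \<open>\<phi>\<close> and its normalized
  representative varies.\<close>
lemma D_\<zeta>:
  assumes y: "y \<in> chart_dom k"
  shows "D (\<lambda>y. \<phi> y $ k) y u = - \<phi> y $ k * (herm (D (aff_coords k) y u) (aff_coords k y) / of_real (\<rho> (aff_coords k y)))"
proof -
  let ?\<zeta> = "\<phi> y $ k" and ?z = "aff_coords k y"
  have nz: "?\<zeta> \<noteq> 0" using y by (simp add: chart_dom_def)
  have "herm (D \<phi> y u) (?\<zeta> *s homog k 1 ?z) = 0"
    using horizontal[of y u] \<phi>_aff[OF y] y chart_dom_subset by auto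
  then have "cnj ?\<zeta> * (D (\<lambda>y. \<phi> y $ k) y u * of_real (\<rho> ?z) + ?\<zeta> * herm (D (aff_coords k) y u) ?z) = 0"
    unfolding D_\<phi>_raw[OF y]
    by (simp add: herm_add_left herm_scale_left herm_scale_right herm_homog one_plus_herm)
  then have "D (\<lambda>y. \<phi> y $ k) y u * of_real (\<rho> ?z) = - ?\<zeta> * herm (D (aff_coords k) y u) ?z"
    using nz by (simp add: add_eq_0_iff)
  then show ?thesis by (simp add: field_simps)
qed

lemma D_\<phi>_perp:
  assumes y: "y \<in> chart_dom k"
  shows "D \<phi> y u = \<phi> y $ k *s perp k (aff_coords k y) (D (aff_coords k) y u)"
  unfolding D_\<phi>_raw[OF y] D_\<zeta>[OF y] perp_def by (simp add: vec_eq_iff algebra_simps)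

lemma herm_lift:
  assumes y: "y \<in> chart_dom k"
  shows "Re (herm (\<phi> y $ k *s perp k (aff_coords k y) v) (\<phi> y $ k *s perp k (aff_coords k y) w)) = fubini_study k (aff_coords k y) v w"
proof -
  let ?\<zeta> = "\<phi> y $ k" and ?z = "aff_coords k y"
  have "?\<zeta> * cnj ?\<zeta> = of_real (1 / \<rho> ?z)" using norm_\<zeta>[OF y] by (simp add: field_simps)
  then have "herm (?\<zeta> *s perp k ?z v) (?\<zeta> *s perp k ?z w) = of_real (1 / \<rho> ?z) * herm (perp k ?z v) (perp k ?z w)"
    by (metis herm_scale_left herm_scale_right mult.assoc)
  then show ?thesis by (simp add: fubini_study_perp)
qed

text \<open>The projection is isometric on horizontal vectors; the second equation identifies the Kaehler form.\<close>
lemma fubini_study_pullback: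
  assumes y: "y \<in> chart_dom k"
  shows "fubini_study k (aff_coords k y) (D (aff_coords k) y u) (D (aff_coords k) y v) = Re (herm (D \<phi> y u) (D \<phi> y v))"
    and "fubini_study k (aff_coords k y) (D (aff_coords k) y u) (\<i> *s D (aff_coords k) y v) = Im (herm (D \<phi> y u) (D \<phi> y v))"
proof -
  show "fubini_study k (aff_coords k y) (D (aff_coords k) y u) (D (aff_coords k) y v) = Re (herm (D \<phi> y u) (D \<phi> y v))"
    unfolding D_\<phi>_perp[OF y] herm_lift[OF y] ..
  have "\<phi> y $ k *s perp k (aff_coords k y) (\<i> *s D (aff_coords k) y v) = \<i> *s D \<phi> y v"
    unfolding D_\<phi>_perp[OF y] perp_ii by (simp add: vec_eq_iff algebra_simps)
  then show "fubini_study k (aff_coords k y) (D (aff_coords k) y u) (\<i> *s D (aff_coords k) y v) = Im (herm (D \<phi> y u) (D \<phi> y v))"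
    using herm_lift[OF y, of "D (aff_coords k) y u" "\<i> *s D (aff_coords k) y v"] D_\<phi>_perp[OF y, of u]
    by (simp add: herm_scale_right)
qed

lemma immersion_aff_coords: "smooth_immersion_on (chart_dom k) (aff_coords k)"
  unfolding smooth_immersion_on_def
proof (intro conjI ballI open_chart_dom smooth_aff_coords)
  fix y assume y: "y \<in> chart_dom k"
  then have yW: "y \<in> W" using chart_dom_subset by blast
  show "inj (D (aff_coords k) y)"
  proof (subst linear_injective_0[OF linear_D_smooth[OF smooth_aff_coords y]], intro allI impI)
    fix u assume "D (aff_coords k) y u = 0"
    then have "D \<phi> y u = 0"
      unfolding D_\<phi>_perp[OF y] by (simp add: perp_def linear_0[OF linear_homog0])
    then show "u = 0"
      using inj_\<phi>[OF yW] linear_injective_0[OF linear_D_smooth[OF smooth_\<phi> yW]] by blast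
  qed
qed

lemma homog1_\<phi>: "y \<in> chart_dom k \<Longrightarrow> c *s homog k 1 (aff_coords k y) = (c / \<phi> y $ k) *s \<phi> y"
proof -
  assume y: "y \<in> chart_dom k"
  then have "\<phi> y $ k \<noteq> 0" by (simp add: chart_dom_def)
  moreover have "(c / \<phi> y $ k) *s \<phi> y = (c / \<phi> y $ k) *s (\<phi> y $ k *s homog k 1 (aff_coords k y))"
    by (rule arg_cong[OF \<phi>_aff[OF y]])
  ultimately show ?thesis by simp
qed

lemma decomposition_unique:
  assumes y: "y \<in> chart_dom k" and eq: "\<alpha> *s \<phi> y + homog k 0 v = \<beta> *s \<phi> y + homog k 0 w"
  shows "v = w"
proof -
  have "(\<alpha> *s \<phi> y + homog k 0 v) $ k = (\<beta> *s \<phi> y + homog k 0 w) $ k" by (simp add: eq)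
  then have "\<alpha> = \<beta>" using y by (simp add: homog_nth chart_dom_def)
  then show ?thesis using eq by (simp add: homog_inject)
qed

lemma D_\<phi>_split: "y \<in> chart_dom k \<Longrightarrow>
    \<exists>c. D \<phi> y u = c *s \<phi> y + homog k 0 (\<phi> y $ k *s D (aff_coords k) y u)"
proof -
  assume y: "y \<in> chart_dom k"
  have "\<phi> y $ k *s homog k 0 (D (aff_coords k) y u) = homog k 0 (\<phi> y $ k *s D (aff_coords k) y u)"
    using homog_scale[of k "\<phi> y $ k" 0] by simp
  then show ?thesis unfolding D_\<phi>_raw[OF y] homog1_\<phi>[OF y] by auto
qed

text \<open>The Levi-Civita connection of the quotient is the horizontal part of the flat connection of \<open>\<complex>\<^sup>4\<close>.
  Differentiating \<open>\<phi> = \<zeta> homog k 1 z\<close> twice, the two mixed terms contain \<open>d\<zeta>\<close>, and by \<open>D_\<zeta>\<close> they add up to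
  the Christoffel term.\<close>
lemma cov_deriv_lift:
  assumes y: "y \<in> chart_dom k" and X: "smooth_on W X"
  shows "\<exists>c. D (\<lambda>y. D \<phi> y (X y)) y (Z y)
    = c *s \<phi> y + homog k 0 (\<phi> y $ k *s cov_deriv (fubini_study k) (aff_coords k) Z X y)"
proof -
  let ?\<zeta> = "\<lambda>y. \<phi> y $ k" and ?z = "aff_coords k" and ?u = "Z y"
  define G where "G = (\<lambda>y. D (aff_coords k) y (X y))"
  define B where "B = (\<lambda>y. D ?\<zeta> y (X y))"
  have X': "smooth_on (chart_dom k) X" by (rule smooth_subset[OF X chart_dom_subset])
  have smG: "smooth_on (chart_dom k) G" unfolding G_def by (rule smooth_D_field[OF open_chart_dom smooth_aff_coords X'])
  have smB: "smooth_on (chart_dom k) B" unfolding B_def by (rule smooth_D_field[OF open_chart_dom smooth_\<zeta> X'])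
  have smP: "smooth_on (chart_dom k) (\<lambda>y. homog k 1 (?z y))"
    by (intro smooth_homog smooth_aff_coords open_chart_dom)
  have smPG: "smooth_on (chart_dom k) (\<lambda>y. homog k 0 (G y))"
    by (rule smooth_bounded_linear[OF bounded_linear_homog0 open_chart_dom smG])
  note sc = smooth_bilinear[OF bounded_bilinear_scale open_chart_dom]
  note dif = smooth_differentiable[OF _ y]
  have "D (\<lambda>y. D \<phi> y (X y)) y = D (\<lambda>y. B y *s homog k 1 (?z y) + ?\<zeta> y *s homog k 0 (G y)) y"
    by (rule D_cong_open(1)[OF open_chart_dom y]) (simp add: D_\<phi>_raw B_def G_def)
  then have "D (\<lambda>y. D \<phi> y (X y)) y ?u = (B y *s homog k 0 (D ?z y ?u) + D B y ?u *s homog k 1 (?z y))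
      + (?\<zeta> y *s homog k 0 (D G y ?u) + D ?\<zeta> y ?u *s homog k 0 (G y))"
    by (simp add: D_add[OF dif[OF sc[OF smB smP]] dif[OF sc[OF smooth_\<zeta> smPG]]]
        D_bilinear[OF bounded_bilinear_scale dif[OF smB] dif[OF smP]]
        D_bilinear[OF bounded_bilinear_scale dif[OF smooth_\<zeta>] dif[OF smPG]]
        D_homog[OF dif[OF smooth_aff_coords]] D_homog[OF dif[OF smG]] D_linear_compose[OF bounded_linear_homog0 dif[OF smG]])
  also have "\<dots> = D B y ?u *s homog k 1 (?z y) + homog k 0 (B y *s D ?z y ?u + (?\<zeta> y *s D G y ?u + D ?\<zeta> y ?u *s G y))"
    by (simp add: homog_def cons_C4_def vec_eq_iff)
  also have "B y *s D ?z y ?u + (?\<zeta> y *s D G y ?u + D ?\<zeta> y ?u *s G y)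
      = ?\<zeta> y *s cov_deriv (fubini_study k) (aff_coords k) Z X y"
    unfolding cov_deriv_def christoffel_fubini_study fs_christoffel_def B_def D_\<zeta>[OF y] G_def
    by (simp add: vec_eq_iff scaleR_conv_of_real[where 'a = complex] field_simps)
  finally show ?thesis unfolding homog1_\<phi>[OF y] by blast
qed

lemma charts_cover: "y \<in> W \<Longrightarrow> \<exists>k. y \<in> chart_dom k"
proof (rule ccontr)
  assume y: "y \<in> W" and "\<nexists>k. y \<in> chart_dom k"
  then have "\<phi> y = 0" by (simp add: chart_dom_def vec_eq_iff)
  then show False using unit[OF y] by simp
qed

text \<open>The two vectors over this point have unit length and hence differ by a factor in \<open>S\<^sup>1\<close>.\<close>
lemma hopf_chart: "y \<in> chart_dom k \<Longrightarrow> hopf (\<phi> y) = cp_chart k (aff_coords k y)"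
proof -
  assume y: "y \<in> chart_dom k"
  let ?c = "\<phi> y $ k * of_real (sqrt (\<rho> (aff_coords k y)))"
  have "?c * cnj ?c = 1"
  proof -
    have "?c * cnj ?c = \<phi> y $ k * cnj (\<phi> y $ k) * of_real (sqrt (\<rho> (aff_coords k y)) * sqrt (\<rho> (aff_coords k y)))"
      by (simp only: complex_cnj_mult complex_cnj_complex_of_real of_real_mult mult_ac)
    then show ?thesis using \<rho>_pos[of "aff_coords k y"] norm_\<zeta>[OF y] by simp
  qed
  then have "complex_of_real ((cmod ?c)\<^sup>2) = 1" by (simp only: complex_norm_square)
  then have "(cmod ?c)\<^sup>2 = 1" by (simp only: of_real_eq_1_iff)
  then have c: "cmod ?c = 1" by (simp add: power2_eq_1_iff) (metis norm_ge_zero norm_mult not_one_le_zero neg_0_le_iff_le)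
  have "\<phi> y = ?c *s cp_section k (aff_coords k y)"
    using \<rho>_pos[of "aff_coords k y"] by (subst \<phi>_aff[OF y]) (simp add: cp_section_eq vec_eq_iff scaleR_conv_of_real[where 'a = complex])
  then have "hopf (\<phi> y) = hopf (?c *s cp_section k (aff_coords k y))" by simp
  then show ?thesis unfolding cp_chart_def hopf_scale[OF c] .
qed

lemma cp_locallyI:
  assumes "\<And>k. P k (chart_dom k) (aff_coords k)"
  shows "cp_locally W (\<lambda>y. hopf (\<phi> y)) P"
  unfolding cp_locally_def
proof
  fix y assume "y \<in> W"
  then obtain k where "y \<in> chart_dom k" using charts_cover by blast
  then show "\<exists>k V \<psi>'. open V \<and> y \<in> V \<and> V \<subseteq> W \<and> (\<forall>x\<in>V. hopf (\<phi> x) = cp_chart k (\<psi>' x)) \<and> P k V \<psi>'"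
    using assms open_chart_dom chart_dom_subset hopf_chart by (intro exI[of _ k] exI[of _ "chart_dom k"] exI[of _ "aff_coords k"]) auto
qed

lemma is_horizontal_lift: "horizontal_lift W \<phi> (\<lambda>y. hopf (\<phi> y))"
  unfolding horizontal_lift_def
proof (intro conjI ballI allI imm cp_locallyI)
  show "\<phi> ` W \<subseteq> sphere 0 1"
  proof (rule image_subsetI)
    fix y assume "y \<in> W"
    then have "complex_of_real ((norm (\<phi> y))\<^sup>2) = 1" using unit[of y] by (simp only: herm_self)
    then have "(norm (\<phi> y))\<^sup>2 = 1" by (simp only: of_real_eq_1_iff)
    then show "\<phi> y \<in> sphere 0 1" by (simp add: norm_eq_1 power2_norm_eq_inner)
  qed
  show "(\<i> *s \<phi> x) \<bullet> D \<phi> x v = 0" if "x \<in> W" for x v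
    using horizontal[OF that, of v] by (simp add: inner_commute[of "\<i> *s \<phi> x"] inner_ii_eq_Im_herm)
  show "fubini_study k (aff_coords k x) (D (aff_coords k) x u) (D (aff_coords k) x v) = D \<phi> x u \<bullet> D \<phi> x v"
    if "x \<in> chart_dom k" for k x u v
    using fubini_study_pullback(1)[OF that] by (simp add: inner_eq_Re_herm)
qed simp

text \<open>By \<open>cov_deriv_lift\<close> the second derivatives of \<open>\<phi>\<close> and of its local expressions correspond to each
  other modulo the line through \<open>\<phi>\<close>, so that the criterion \<open>adapted_framing\<close> applies in every chart.\<close>
lemma projective_case:
  fixes Y :: "3 \<Rightarrow> real^3 \<Rightarrow> real^3"
  assumes Y: "\<And>i. smooth_on W (Y i)" and r: "\<And>y. y \<in> W \<Longrightarrow> r y > 0"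
    and orth: "\<And>y i j. y \<in> W \<Longrightarrow> herm (D \<phi> y (Y i y)) (D \<phi> y (Y j y)) = (if i = j then 1 else 0)"
    and sff: "\<And>y i j. y \<in> W \<Longrightarrow> \<exists>e c. D (\<lambda>y. D \<phi> y (Y j y)) y (Y i y) = D \<phi> y e
        + \<i> *s D \<phi> y (r y *\<^sub>R (\<Sum>k\<in>UNIV. cubic i j k *\<^sub>R Y k y)) + c *s \<phi> y"
  shows "cp_special_lagrangian W (\<lambda>y. hopf (\<phi> y))" "cp_S3_symmetric W (\<lambda>y. hopf (\<phi> y))"
proof -
  have framing: "special_lagrangian (fubini_study k) (chart_dom k) (aff_coords k) \<and> adapted_frame (fubini_study k) (chart_dom k) (aff_coords k) Y r" for k
  proof (rule conjI)
    note * = adapted_framing[of "chart_dom k" "aff_coords k" Y "fubini_study k" r]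
    have 0: "smooth_on (chart_dom k) (Y i)" for i by (rule smooth_subset[OF Y chart_dom_subset])
    have 1: "bilinear (christoffel (fubini_study k) z)" for z
      using levi_civita_fubini_study[of k z] by (simp add: christoffel_fubini_study is_levi_civita_at_def)
    have 2: "fubini_study k (aff_coords k x) (D (aff_coords k) x (Y i x)) (D (aff_coords k) x (Y j x)) = (if i = j then 1 else 0)"
      if "x \<in> chart_dom k" for x i j
      using orth[OF subsetD[OF chart_dom_subset that]] by (simp add: fubini_study_pullback[OF that])
    have 3: "fubini_study k (aff_coords k x) (D (aff_coords k) x (Y i x)) (\<i> *s D (aff_coords k) x (Y j x)) = 0" if "x \<in> chart_dom k" for x i j
      using orth[OF subsetD[OF chart_dom_subset that]] by (simp add: fubini_study_pullback[OF that])
    have 4: "r x > 0" if "x \<in> chart_dom k" for x using r that chart_dom_subset by blast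
    have 5: "\<exists>e. cov_deriv (fubini_study k) (aff_coords k) (Y i) (Y j) x
        = D (aff_coords k) x e + \<i> *s D (aff_coords k) x (r x *\<^sub>R (\<Sum>k\<in>UNIV. cubic i j k *\<^sub>R Y k x))" if x: "x \<in> chart_dom k" for x i j
    proof -
      let ?\<zeta> = "\<phi> x $ k" and ?a = "r x *\<^sub>R (\<Sum>k\<in>UNIV. cubic i j k *\<^sub>R Y k x)"
      have nz: "?\<zeta> \<noteq> 0" and xW: "x \<in> W" using x by (auto simp: chart_dom_def)
      obtain e c where ec: "D (\<lambda>y. D \<phi> y (Y j y)) x (Y i x) = D \<phi> x e + \<i> *s D \<phi> x ?a + c *s \<phi> x"
        using sff[OF xW] by blast
      obtain c1 where c1: "D \<phi> x e = c1 *s \<phi> x + homog k 0 (?\<zeta> *s D (aff_coords k) x e)" using D_\<phi>_split[OF x] by blast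
      obtain c2 where c2: "D \<phi> x ?a = c2 *s \<phi> x + homog k 0 (?\<zeta> *s D (aff_coords k) x ?a)" using D_\<phi>_split[OF x] by blast
      obtain c3 where c3: "D (\<lambda>y. D \<phi> y (Y j y)) x (Y i x)
          = c3 *s \<phi> x + homog k 0 (?\<zeta> *s cov_deriv (fubini_study k) (aff_coords k) (Y i) (Y j) x)"
        using cov_deriv_lift[OF x Y] by blast
      have "D \<phi> x e + \<i> *s D \<phi> x ?a + c *s \<phi> x
          = (c1 + \<i> * c2 + c) *s \<phi> x + homog k 0 (?\<zeta> *s (D (aff_coords k) x e + \<i> *s D (aff_coords k) x ?a))"
        unfolding c1 c2 by (simp add: homog_def cons_C4_def vec_eq_iff algebra_simps)
      then have "c3 *s \<phi> x + homog k 0 (?\<zeta> *s cov_deriv (fubini_study k) (aff_coords k) (Y i) (Y j) x)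
          = (c1 + \<i> * c2 + c) *s \<phi> x + homog k 0 (?\<zeta> *s (D (aff_coords k) x e + \<i> *s D (aff_coords k) x ?a))"
        using ec c3 by simp
      from decomposition_unique[OF x this]
      have "cov_deriv (fubini_study k) (aff_coords k) (Y i) (Y j) x = D (aff_coords k) x e + \<i> *s D (aff_coords k) x ?a"
        using nz by (simp only: vector_mul_lcancel) simp
      then show ?thesis by blast
    qed
    show "special_lagrangian (fubini_study k) (chart_dom k) (aff_coords k)"
      by (rule *(1)[OF immersion_aff_coords 0 hermitian_form_fubini_study 1 2 3 4 5])
    show "adapted_frame (fubini_study k) (chart_dom k) (aff_coords k) Y r"
      by (rule *(2)[OF immersion_aff_coords 0 hermitian_form_fubini_study 1 2 3 4 5])
  qed
  show "cp_special_lagrangian W (\<lambda>y. hopf (\<phi> y))"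
    unfolding cp_special_lagrangian_def using open_W framing by (auto intro: cp_locallyI)
  show "cp_S3_symmetric W (\<lambda>y. hopf (\<phi> y))"
    unfolding cp_S3_symmetric_def
  proof (rule cp_locallyI)
    show "S3_symmetric (fubini_study k) (chart_dom k) (aff_coords k)" for k
      unfolding S3_symmetric_def using framing[of k] open_chart_dom[of k] by blast
  qed
qed

end

section \<open>The classification\<close>

lemma (in conical_lagrangian) restrict:
  assumes "open U'" "U' \<subseteq> U"
  shows "conical_lagrangian U' f Z r"
proof -
  have sub: "x \<in> U" if "x \<in> U'" for x using that assms(2) by blast
  interpret A: adapted_lagrangian U' f Z r
    by unfold_locales (use assms(1) smooth_subset[OF smooth_f assms(2)] smooth_subset[OF smooth_Z assms(2)]
        inj_f unitary lagrangian sff r_pos sub in auto)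
  show ?thesis
    by unfold_locales (use \<gamma>4 \<gamma>3 \<omega>43_1 \<omega>43_2 sub in auto)
qed

text \<open>The vector \<open>F 4\<close> is orthogonal to the slice, so that \<open>\<phi> = \<plusminus>F 4\<close> is a horizontal map.\<close>
lemma (in lagrangian_chart) cone_case:
  assumes q: "\<And>x. x \<in> U \<Longrightarrow> q x = \<epsilon> *\<^sub>R F 4 x" and fq: "\<And>x. x \<in> U \<Longrightarrow> f x = t x *\<^sub>R q x + c0"
  shows "\<exists>\<phi> \<psi>. cp_special_lagrangian W \<psi> \<and> cp_S3_symmetric W \<psi> \<and> horizontal_lift W \<phi> \<psi> \<and>
     (\<forall>s\<in>{a<..<b}. \<forall>y\<in>W. f (h (s, y)) = s *\<^sub>R \<phi> y + c0)"
proof -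
  have \<phi>F: "\<phi> y = \<epsilon> *\<^sub>R F 4 (g y)" if "y \<in> W" for y
    using q[OF g_in[OF that]] by (simp add: \<phi>_def)
  have F\<phi>: "F 4 (g y) = \<epsilon> *\<^sub>R \<phi> y" if "y \<in> W" for y
    using \<epsilon> by (simp add: \<phi>F[OF that])
  interpret H: horizontal_immersion W \<phi>
  proof
    show "smooth_immersion_on W \<phi>" by (rule immersion_\<phi>)
    show "herm (\<phi> y) (\<phi> y) = 1" if "y \<in> W" for y
    proof -
      have "herm (\<phi> y) (\<phi> y) = of_real (\<epsilon> * \<epsilon>)"
        by (simp add: \<phi>F[OF that] herm_scaleR_left herm_scaleR_right herm_F[OF g_in[OF that]])
      then show ?thesis by (simp add: \<epsilon>)
    qed
    show "herm (D \<phi> y u) (\<phi> y) = 0" if "y \<in> W" for y u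
      by (simp add: \<phi>F[OF that] herm_scaleR_right \<phi>_orthogonal[OF that])
  qed
  have pos: "r (g y) / \<kappa> p > 0" if "y \<in> W" for y using r_pos[OF g_in[OF that]] \<kappa>_pos[OF p] by simp
  have sff: "\<exists>e c. D (\<lambda>y. D \<phi> y (Y j y)) y (Y i y) = D \<phi> y e
        + \<i> *s D \<phi> y ((r (g y) / \<kappa> p) *\<^sub>R (\<Sum>k\<in>UNIV. cubic i j k *\<^sub>R Y k y)) + c *s \<phi> y" if y: "y \<in> W" for y i j
  proof -
    obtain e c where "D (\<lambda>y. D \<phi> y (Y j y)) y (Y i y) = D \<phi> y e
        + \<i> *s D \<phi> y ((r (g y) / \<kappa> p) *\<^sub>R (\<Sum>k\<in>UNIV. cubic i j k *\<^sub>R Y k y)) + c *\<^sub>R F 4 (g y)"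
      using second_fundamental_form_\<phi>[OF y] by blast
    moreover have "c *\<^sub>R F 4 (g y) = of_real (c * \<epsilon>) *s \<phi> y"
      unfolding F\<phi>[OF y] by (simp only: scaleR_scaleR scaleR_eq_scale[symmetric])
    ultimately have "D (\<lambda>y. D \<phi> y (Y j y)) y (Y i y) = D \<phi> y e
        + \<i> *s D \<phi> y ((r (g y) / \<kappa> p) *\<^sub>R (\<Sum>k\<in>UNIV. cubic i j k *\<^sub>R Y k y)) + of_real (c * \<epsilon>) *s \<phi> y"
      by simp
    then show ?thesis by (intro exI)
  qed
  have "f (h (s, y)) = s *\<^sub>R \<phi> y + c0" if "s \<in> {a<..<b}" "y \<in> W" for s y
    using fq[OF h_in[OF that]] q_h[OF that] t_h[OF that] by simp
  then show ?thesis
    using H.projective_case[OF smooth_Y pos herm_D_\<phi>_Y sff] H.is_horizontal_lift by blast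
qed


context conical_lagrangian
begin

lemma continuous_\<theta>: "continuous_on U (\<lambda>x. \<theta> i x v)"
  unfolding \<theta>_def
  by (rule smooth_continuous[OF smooth_Re[OF open_U smooth_herm[OF open_U smooth_D[OF smooth_f] smooth_F]]])

lemma differentiable_f: "x \<in> U \<Longrightarrow> f differentiable (at x)"
  by (rule smooth_differentiable[OF smooth_f])

text \<open>By \<open>linear_ode_zero\<close> the function \<open>\<beta> 4\<close> vanishes everywhere, and \<open>F 4\<close> is constant by
  \<open>D_F4\<close>.\<close>
lemma local_product:
  assumes conv: "convex U" and p: "p \<in> U" and zero: "\<beta> 4 p = 0"
  shows "\<exists>V a b W h \<Psi> \<phi>. p \<in> V \<and> V \<subseteq> U \<and> diffeomorphism_on ({a<..<b} \<times> (W :: (real^3) set)) V h \<and> holomorphic_isometry \<Psi> \<and>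
      special_lagrangian flat_metric W \<phi> \<and> S3_symmetric flat_metric W \<phi> \<and>
      (\<forall>t\<in>{a<..<b}. \<forall>w\<in>W. f (h (t, w)) = \<Psi> (cons_C4 (of_real t) (\<phi> w)))"
proof -
  have b0: "\<beta> 4 x = 0" if x: "x \<in> U" for x
  proof (rule linear_ode_zero[OF smooth_\<beta>4])
    show "continuous_on U (\<lambda>x. - \<beta> 4 x * \<theta> 4 x v)" for v
      by (intro continuous_intros continuous_\<theta> smooth_continuous[OF smooth_\<beta>4])
    show "D (\<beta> 4) x v = \<beta> 4 x * (- \<beta> 4 x * \<theta> 4 x v)" if "x \<in> U" for x v
      by (simp add: D_\<beta>4[OF that] power2_eq_square)
    show "closed_segment p x \<subseteq> U" by (rule closed_segment_subset[OF p x conv])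
  qed (rule zero)
  define n where "n = F 4 p"
  have n: "F 4 x = n" if "x \<in> U" for x
    unfolding n_def
    by (rule constant_on_convex[OF conv smooth_differentiable[OF smooth_F] _ that p]) (simp_all add: D_F4 b0)
  define t where "t = (\<lambda>x. Re (herm (f x) n))"
  define q where "q = (\<lambda>x. f x - t x *\<^sub>R n)"
  have smt: "smooth_on U t"
    unfolding t_def by (rule smooth_Re[OF open_U smooth_herm[OF open_U smooth_f smooth_const]])
  have smq: "smooth_on U q"
    unfolding q_def by (intro smooth_diff smooth_scaleR open_U smooth_f smt smooth_const)
  have Dh: "D (\<lambda>x. herm (f x) n) x v = herm (D f x v) n" if "x \<in> U" for x v
    by (simp add: D_herm[OF differentiable_f[OF that]])
  note dh = smooth_herm_differentiable[OF smooth_f smooth_const]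
  have Dt: "D t x v = \<theta> 4 x v" if "x \<in> U" for x v
    unfolding t_def by (simp add: D_Re[OF dh[OF that]] Dh[OF that] \<theta>_def n[OF that])
  have Dq: "D q x v = D f x v - \<theta> 4 x v *\<^sub>R F 4 x" if x: "x \<in> U" for x v
    unfolding q_def
    by (simp add: D_diff[OF differentiable_f[OF x] smooth_differentiable[OF smooth_scaleR[OF open_U smt smooth_const] x]]
        D_scaleR[OF smooth_differentiable[OF smt x]] Dt[OF x] n[OF x])
  have im: "Im (herm (f x) n) = Im (herm (f p) n)" if x: "x \<in> U" for x
  proof (rule constant_on_convex[OF conv _ _ x p])
    show "(\<lambda>x. Im (herm (f x) n)) differentiable (at x)" if "x \<in> U" for x
      by (rule smooth_differentiable[OF smooth_Im[OF open_U smooth_herm[OF open_U smooth_f smooth_const]] that])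
    show "D (\<lambda>x. Im (herm (f x) n)) x v = 0" if "x \<in> U" for x v
      using lagrangian[OF that, of v "Z 4 x"] n[OF that] by (simp add: D_Im[OF dh[OF that]] Dh[OF that] F_def)
  qed
  have nn: "herm n n = 1" using herm_F[OF p, of 4 4] by (simp add: n_def)
  have qn: "herm (q x) n = \<i> * of_real (Im (herm (f p) n))" if "x \<in> U" for x
    using im[OF that] by (simp add: q_def t_def herm_diff_left herm_scaleR_left nn complex_eq_iff)
  interpret P: product_lagrangian U f Z r t q "\<lambda>_. 1" 1
    by unfold_locales (use smt smq Dt Dq in auto)
  obtain V a b W h where pV: "p \<in> V" and ch: "lagrangian_chart U f Z r t q (\<lambda>_. 1) 1 p V a b W h"
    using P.chart_exists[OF p] by blast
  interpret Q: lagrangian_chart U f Z r t q "\<lambda>_. 1" 1 p V a b W h by (rule ch)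
  have "\<exists>\<Psi> \<phi>. holomorphic_isometry \<Psi> \<and> special_lagrangian flat_metric W \<phi> \<and> S3_symmetric flat_metric W \<phi> \<and>
     (\<forall>s\<in>{a<..<b}. \<forall>y\<in>W. f (h (s, y)) = \<Psi> (cons_C4 (of_real s) (\<phi> y)))"
    by (rule Q.product_case[OF n _ qn]) (simp_all add: q_def)
  then obtain \<Psi> \<phi> where "holomorphic_isometry \<Psi>" "special_lagrangian flat_metric W \<phi>" "S3_symmetric flat_metric W \<phi>"
     "\<forall>s\<in>{a<..<b}. \<forall>y\<in>W. f (h (s, y)) = \<Psi> (cons_C4 (of_real s) (\<phi> y))" by blast
  then show ?thesis
    using pV Q.V_sub Q.diffeo
    by blast
qed

text \<open>The equations \<open>D_F4\<close> and \<open>D_\<beta>4\<close> say that \<open>f - F 4 / \<beta> 4\<close> has derivative zero; its constant value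
  is the vertex of the cone.\<close>
lemma local_cone:
  assumes conv: "convex U" and p: "p \<in> U" and \<epsilon>: "\<epsilon> * \<epsilon> = (1 :: real)"
    and pos: "\<And>x. x \<in> U \<Longrightarrow> \<epsilon> * \<beta> 4 x > 0"
  shows "\<exists>V a b W h \<Psi> \<phi> \<psi>. p \<in> V \<and> V \<subseteq> U \<and> diffeomorphism_on ({a<..<b} \<times> (W :: (real^3) set)) V h \<and> holomorphic_isometry \<Psi> \<and>
      cp_special_lagrangian W \<psi> \<and> cp_S3_symmetric W \<psi> \<and> horizontal_lift W \<phi> \<psi> \<and>
      (\<forall>t\<in>{a<..<b}. \<forall>w\<in>W. f (h (t, w)) = \<Psi> (t *\<^sub>R \<phi> w))"
proof -
  define \<kappa> where "\<kappa> = (\<lambda>x. \<epsilon> * \<beta> 4 x)"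
  define t where "t = (\<lambda>x. inverse (\<kappa> x))"
  define q where "q = (\<lambda>x. \<epsilon> *\<^sub>R F 4 x)"
  have \<kappa>pos: "\<kappa> x > 0" if "x \<in> U" for x using pos[OF that] by (simp add: \<kappa>_def)
  have sm\<kappa>: "smooth_on U \<kappa>" unfolding \<kappa>_def by (intro smooth_mult open_U smooth_const smooth_\<beta>4)
  have smt: "smooth_on U t"
    unfolding t_def by (rule smooth_inverse[OF open_U sm\<kappa>]) (use \<kappa>pos in force)
  have smq: "smooth_on U q" unfolding q_def by (intro smooth_scaleR open_U smooth_const smooth_F)
  have D\<kappa>: "D \<kappa> x v = - \<epsilon> * (\<kappa> x)\<^sup>2 * \<theta> 4 x v" if x: "x \<in> U" for x v
  proof -
    have "D \<kappa> x v = - \<epsilon> * (\<epsilon> * \<epsilon>) * (\<beta> 4 x)\<^sup>2 * \<theta> 4 x v"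
      unfolding \<kappa>_def \<epsilon> using D_mult[OF _ smooth_differentiable[OF smooth_\<beta>4 x], of "\<lambda>_. \<epsilon>" v] by (simp add: D_\<beta>4[OF x])
    then show ?thesis by (simp add: \<kappa>_def power2_eq_square)
  qed
  have Dt: "D t x v = \<epsilon> * \<theta> 4 x v" if x: "x \<in> U" for x v
  proof -
    have nz: "\<kappa> x \<noteq> 0" using \<kappa>pos[OF x] by simp
    have "D t x v = - (inverse (\<kappa> x) * D \<kappa> x v * inverse (\<kappa> x))"
      unfolding t_def
      using D_eqI[OF Deriv.has_derivative_inverse[OF nz smooth_has_derivative[OF sm\<kappa> x]]] by simp
    then show ?thesis using nz by (simp add: D\<kappa>[OF x] power2_eq_square field_simps)
  qed
  have Dq: "D q x v = \<kappa> x *\<^sub>R (D f x v - \<theta> 4 x v *\<^sub>R F 4 x)" if x: "x \<in> U" for x v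
    unfolding q_def
    using D_linear_compose[OF bounded_linear_scaleR_right smooth_differentiable[OF smooth_F x], of \<epsilon> 4 v]
    by (simp add: D_F4[OF x] \<kappa>_def)
  define c0 where "c0 = f p - t p *\<^sub>R q p"
  have fq: "f x = t x *\<^sub>R q x + c0" if x: "x \<in> U" for x
  proof -
    have "f x - t x *\<^sub>R q x = f p - t p *\<^sub>R q p"
    proof (rule constant_on_convex[OF conv _ _ x p])
      show "(\<lambda>x. f x - t x *\<^sub>R q x) differentiable (at x)" if "x \<in> U" for x
        by (rule smooth_differentiable[OF smooth_diff[OF open_U smooth_f smooth_scaleR[OF open_U smt smq]] that])
      fix x v assume x: "x \<in> U"
      have "D (\<lambda>x. f x - t x *\<^sub>R q x) x v = D f x v - (t x *\<^sub>R D q x v + D t x v *\<^sub>R q x)"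
        by (simp add: D_diff[OF differentiable_f[OF x] smooth_differentiable[OF smooth_scaleR[OF open_U smt smq] x]]
            D_scaleR[OF smooth_differentiable[OF smt x] smooth_differentiable[OF smq x]])
      also have "t x *\<^sub>R D q x v = D f x v - \<theta> 4 x v *\<^sub>R F 4 x"
        using \<kappa>pos[OF x] by (simp add: Dq[OF x] t_def)
      also have "D t x v *\<^sub>R q x = ((\<epsilon> * \<epsilon>) * \<theta> 4 x v) *\<^sub>R F 4 x"
        by (simp add: Dt[OF x] q_def mult_ac)
      finally show "D (\<lambda>x. f x - t x *\<^sub>R q x) x v = 0" by (simp add: \<epsilon>)
    qed
    then show ?thesis by (simp add: c0_def algebra_simps)
  qed
  interpret P: product_lagrangian U f Z r t q \<kappa> \<epsilon>
    by unfold_locales (use smt smq Dt Dq \<epsilon> \<kappa>pos in \<open>auto simp: t_def\<close>)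
  obtain V a b W h where pV: "p \<in> V" and ch: "lagrangian_chart U f Z r t q \<kappa> \<epsilon> p V a b W h"
    using P.chart_exists[OF p] by blast
  interpret Q: lagrangian_chart U f Z r t q \<kappa> \<epsilon> p V a b W h by (rule ch)
  obtain \<phi> \<psi> where "cp_special_lagrangian W \<psi>" "cp_S3_symmetric W \<psi>" "horizontal_lift W \<phi> \<psi>"
    "\<forall>s\<in>{a<..<b}. \<forall>y\<in>W. f (h (s, y)) = s *\<^sub>R \<phi> y + c0"
    using Q.cone_case[OF _ fq] q_def by blast
  moreover have "holomorphic_isometry (\<lambda>z. z + c0)"
    unfolding holomorphic_isometry_def
    by (intro exI[of _ "\<lambda>z. z"] exI[of _ c0]) (simp add: orthogonal_transformation_def linear_id[unfolded id_def])
  ultimately show ?thesis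
    using pV Q.V_sub Q.diffeo
    by blast
qed

end

theorem theorem3p3:
  fixes U :: "(real^4) set" and f :: "real^4 \<Rightarrow> complex^4"
    and X :: "4 \<Rightarrow> real^4 \<Rightarrow> real^4" and r :: "real^4 \<Rightarrow> real"
  assumes "special_lagrangian flat_metric U f"
    and "adapted_frame flat_metric U f X r"
    and "\<And>x. x \<in> U \<Longrightarrow> lie_bracket (X 1) (X 2) x \<notin> span {X 1 x, X 2 x}"
    and "integrable_distribution_on TYPE(real^3) U
           (\<lambda>x. span {X 1 x, X 2 x, lie_bracket (X 1) (X 2) x})"
    and "p \<in> U"
  shows "\<exists>V a b (W :: (real^3) set) h \<Psi>.
           p \<in> V \<and> V \<subseteq> U \<and> diffeomorphism_on ({a<..<b} \<times> W) V h \<and> holomorphic_isometry \<Psi> \<and>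
           ((\<exists>\<phi>. special_lagrangian flat_metric W \<phi> \<and> S3_symmetric flat_metric W \<phi> \<and>
                 (\<forall>t\<in>{a<..<b}. \<forall>w\<in>W. f (h (t, w)) = \<Psi> (cons_C4 (of_real t) (\<phi> w)))) \<or>
            (\<exists>\<phi> \<psi>. cp_special_lagrangian W \<psi> \<and> cp_S3_symmetric W \<psi> \<and> horizontal_lift W \<phi> \<psi> \<and>
                 (\<forall>t\<in>{a<..<b}. \<forall>w\<in>W. f (h (t, w)) = \<Psi> (t *\<^sub>R \<phi> w))))"
proof -
  obtain Z where "conical_lagrangian U f Z r" using conical_frame_exists[OF assms(1-4)] by blast
  then interpret C: conical_lagrangian U f Z r .
  show ?thesis
  proof (cases "C.\<beta> 4 p = 0")
    case True
    obtain e where e: "e > 0" "ball p e \<subseteq> U" using C.open_U assms(5) open_contains_ball by blast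
    interpret B: conical_lagrangian "ball p e" f Z r by (rule C.restrict[OF open_ball e(2)])
    have "p \<in> ball p e" using e(1) by simp
    from B.local_product[OF convex_ball this True] obtain V a b W h \<Psi> \<phi> where
      "p \<in> V" "V \<subseteq> ball p e" "diffeomorphism_on ({a<..<b} \<times> (W :: (real^3) set)) V h" "holomorphic_isometry \<Psi>"
      "special_lagrangian flat_metric W \<phi>" "S3_symmetric flat_metric W \<phi>"
      "\<forall>t\<in>{a<..<b}. \<forall>w\<in>W. f (h (t, w)) = \<Psi> (cons_C4 (of_real t) (\<phi> w))" by (elim exE conjE) (rule that)
    moreover from this e(2) have "V \<subseteq> U" by blast
    ultimately show ?thesis by blast
  next
    case False
    \<comment> \<open>The sign for which \<open>\<epsilon> F 4\<close> points away from the vertex.\<close>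
    define \<epsilon> where "\<epsilon> = sgn (C.\<beta> 4 p)"
    have \<epsilon>: "\<epsilon> * \<epsilon> = 1" using False by (auto simp: \<epsilon>_def sgn_if)
    let ?U = "U \<inter> (\<lambda>x. \<epsilon> * C.\<beta> 4 x) -` {0<..}"
    have "open ?U"
      by (rule continuous_open_preimage[OF _ C.open_U open_greaterThan])
        (intro continuous_intros smooth_continuous[OF C.smooth_\<beta>4])
    moreover have "p \<in> ?U" using False assms(5) by (auto simp: \<epsilon>_def sgn_if zero_less_mult_iff)
    ultimately obtain e where e: "e > 0" "ball p e \<subseteq> ?U" using open_contains_ball by blast
    have eU: "ball p e \<subseteq> U" using e(2) by blast
    interpret B: conical_lagrangian "ball p e" f Z r by (rule C.restrict[OF open_ball eU])
    have pB: "p \<in> ball p e" using e(1) by simp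
    have "\<epsilon> * C.\<beta> 4 x > 0" if "x \<in> ball p e" for x using e(2) that by blast
    from B.local_cone[OF convex_ball pB \<epsilon> this] obtain V a b W h \<Psi> \<phi> \<psi> where
      "p \<in> V" "V \<subseteq> ball p e" "diffeomorphism_on ({a<..<b} \<times> (W :: (real^3) set)) V h" "holomorphic_isometry \<Psi>"
      "cp_special_lagrangian W \<psi>" "cp_S3_symmetric W \<psi>" "horizontal_lift W \<phi> \<psi>"
      "\<forall>t\<in>{a<..<b}. \<forall>w\<in>W. f (h (t, w)) = \<Psi> (t *\<^sub>R \<phi> w)"
      by blast
    moreover from this eU have "V \<subseteq> U" by blast
    ultimately show ?thesis by blast
  qed
qed

end
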